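(* Let $C_{\mathrm{main}}>0$ be a constant, depending on the radii $r_1,\dots,r_N$, the dielectric constants $\kappa_0,\dots,\kappa_N$ and the minimal separation $\delta$ but independent of $N$, such that for every real $s\ge0$, every $\ell_{\max}\in\mathbb{N}$ and every $\sigma_f\in H^s(\partial\Omega)$ the solutions $\nu$ and $\nu_{\ell_{\max}}$ of the two problems (P) and (G) given in the context satisfy $$|||\nu-\nu_{\ell_{\max}}|||^*\le C_{\mathrm{main}}\left(\frac{\max_j r_j}{\ell_{\max}+1}\right)^{s+\frac12}\left(|||\mathbb{Q}_0^\perp\nu|||_{H^s(\partial\Omega)}+\frac{8\pi}{\kappa_0}|||\mathbb{Q}_0^\perp\sigma_f|||_{H^s(\partial\Omega)}\right),$$ $$\big|\mathcal{E}_{\sigma_f}(\nu)-\mathcal{E}_{\sigma_f}(\nu_{\ell_{\max}})\big|\le C_{\mathrm{main}}\left(\frac{\max_j r_j}{\ell_{\max}+1}\right)^{s+\frac12}|||\mathcal{V}\sigma_f|||\left(|||\mathbb{Q}_0^\perp\nu|||_{H^s(\partial\Omega)}+\frac{8\pi}{\kappa_0}|||\mathbb{Q}_0^\perp\sigma_f|||_{H^s(\partial\Omega)}\right)$$ (such a constant exists). Let $\sigma_f\in C^\infty(\partial\Omega)$ be analytic on $\partial\Omega$, let $\nu\in H^{-1/2}(\partial\Omega)$ be the unique solution of (P) with this $\sigma_f$, and for $\ell_{\max}\in\mathbb{N}$ let $\nu_{\ell_{\max}}\in W^{\ell_{\max}}$ be the unique solution of (G) with this $\sigma_f$. If $\nu$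 is analytic on $\partial\Omega$, then there exists a constant $C_{\nu,\sigma_f}>0$ depending on the exact solution $\nu$ and on $\sigma_f$ (but not on $\ell_{\max}$) such that for all sufficiently large $\ell_{\max}$ $$\frac{1}{\sqrt N}|||\nu-\nu_{\ell_{\max}}|||^*\le\sqrt{8\pi\max_j r_j^2}\,(2\max_j r_j)^{\frac14}\,C_{\nu,\sigma_f}\,C_{\mathrm{main}}\exp\left(-\frac{1}{4C_{\nu,\sigma_f}}\frac{\ell_{\max}+1}{\max_j r_j}+\frac12\right),$$ $$\frac{1}{\sqrt N}\big|\mathcal{E}_{\sigma_f}(\nu)-\mathcal{E}_{\sigma_f}(\nu_{\ell_{\max}})\big|\le\sqrt{8\pi\max_j r_j^2}\,(2\max_j r_j)^{\frac14}\,C_{\nu,\sigma_f}\,C_{\mathrm{main}}\,|||\mathcal{V}\sigma_f|||\exp\left(-\frac{1}{4C_{\nu,\sigma_f}}\frac{\ell_{\max}+1}{\max_j r_j}+\frac12\right).$$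
   Context: Geometry. $N\ge1$ is an integer, $\mathbf{x}_1,\dots,\mathbf{x}_N\in\mathbb{R}^3$, $r_1,\dots,r_N>0$, and $\Omega_i$ is the open ball of radius $r_i$ centred at $\mathbf{x}_i$. The minimal inter-sphere separation distance $\delta:=\min_{i\ne j}(|\mathbf{x}_i-\mathbf{x}_j|-r_i-r_j)$ is assumed positive (no condition and no dependence on $\delta$ if $N=1$). $\Omega^-:=\bigcup_{i=1}^N\Omega_i$, with boundary $\partial\Omega$. The dielectric constants $\kappa_0,\kappa_1,\dots,\kappa_N$ are positive reals with $\kappa_i\neq\kappa_0$ for all $i\ge1$ (standing assumption); $\kappa:\partial\Omega\to\mathbb{R}$ is the function equal to $\kappa_i$ on $\partial\Omega_i$. Spaces. All functions are real-valued. $H^{1/2}(\partial\Omega)$ is the Sobolev space on $\partial\Omega$, with norm $\|\lambda\|^2_{H^{1/2}(\partial\Omega)}=\sum_{i=1}^N\big(\|\lambda\|^2_{L^2(\partial\Omega_i)}+\int_{\partial\Omega_i}\int_{\partial\Omega_i}\frac{|\lambda(\mathbf{x})-\lambda(\mathbf{y})|^2}{|\mathbf{x}-\mathbf{y}|^3}d\mathbf{x}\,d\mathbf{y}\big)$; $H^{-1/2}(\partial\Omega)$ is its dual; $\langle\cdot,\cdot\rangle_{\partial\Omega}$ is the duality pairing extending the $L^2(\partial\Omega)$ inner product (expressions $(\cdot,\cdot)_{L^2(\partial\Omega)}$ involving elements of $H^{-1/2}(\partial\Omega)$ are read as this pairing). $\mathcal{C}(\partial\Omega)$ is the space of functions on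 $\partial\Omega$ constant on each $\partial\Omega_i$. $\breve H^{\pm1/2}(\partial\Omega)$ is the subspace of $H^{\pm1/2}(\partial\Omega)$ of elements whose $L^2$/duality pairing with every element of $\mathcal{C}(\partial\Omega)$ vanishes. $\mathbb{P}_0,\mathbb{P}_0^\perp$ are the projections of $H^{1/2}(\partial\Omega)=\breve H^{1/2}(\partial\Omega)\oplus\mathcal{C}(\partial\Omega)$ onto $\mathcal{C}(\partial\Omega)$ and $\breve H^{1/2}(\partial\Omega)$ respectively; $\mathbb{Q}_0,\mathbb{Q}_0^\perp$ are the analogous projections of $H^{-1/2}(\partial\Omega)=\breve H^{-1/2}(\partial\Omega)\oplus\mathcal{C}(\partial\Omega)$ onto $\mathcal C(\partial\Omega)$ and $\breve H^{-1/2}(\partial\Omega)$. Operators. $\mathrm{DtN}:H^{1/2}(\partial\Omega)\to H^{-1/2}(\partial\Omega)$ is the interior Dirichlet-to-Neumann map: $\mathrm{DtN}\lambda$ is the Neumann trace (with respect to the unit normal exterior to $\Omega^-$) of the harmonic function in $H^1(\Omega^-)$ with Dirichlet trace $\lambda$. $\mathcal{V}:H^{-1/2}(\partial\Omega)\to H^{1/2}(\partial\Omega)$ is the single layer boundary operator, $\mathcal{V}\nu(\mathbf{x})=\int_{\partial\Omega}\frac{\nu(\mathbf{y})}{4\pi|\mathbf{x}-\mathbf{y}|}d\mathbf{y}$. $\mathcal{A}:H^{1/2}(\partial\Omega)\to H^{1/2}(\partial\Omega)$ is $\mathcal{A}\lambda:=\lambda-\mathcal{V}\,\mathrm{DtN}\big(\frac{\kappa_0-\kappa}{\kappa_0}\lambda\big)$,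 and $\mathcal{A}^*:H^{-1/2}(\partial\Omega)\to H^{-1/2}(\partial\Omega)$ is its adjoint with respect to $\langle\cdot,\cdot\rangle_{\partial\Omega}$. Norms. $|||\lambda|||^2:=\|\mathbb{P}_0\lambda\|^2_{L^2(\partial\Omega)}+\langle\mathrm{DtN}\lambda,\lambda\rangle_{\partial\Omega}$ on $H^{1/2}(\partial\Omega)$, and $|||\sigma|||^*:=\sup_{0\ne\psi\in H^{1/2}(\partial\Omega)}\langle\sigma,\psi\rangle_{\partial\Omega}/|||\psi|||$ on $H^{-1/2}(\partial\Omega)$. Let $\mathcal{Y}_\ell^m$ ($\ell\in\mathbb{N}_0$, $-\ell\le m\le\ell$) be the real-valued $L^2(\mathbb{S}^2)$-orthonormal spherical harmonics. $W^{\ell_{\max}}$ is the space of functions $u$ on $\partial\Omega$ such that, for each $i$, $u|_{\partial\Omega_i}$ is a linear combination of the functions $\mathcal{Y}_\ell^m\big(\frac{\mathbf{x}-\mathbf{x}_i}{|\mathbf{x}-\mathbf{x}_i|}\big)$ with $0\le\ell\le\ell_{\max}$, $|m|\le\ell$. For $s\ge0$, $H^s(\partial\Omega)$ is the space of functions $u$ with $u|_{\partial\Omega_i}(\mathbf{x})=\sum_{\ell\ge0}\sum_{|m|\le\ell}[u_i]_\ell^m\mathcal{Y}_\ell^m\big(\frac{\mathbf{x}-\mathbf{x}_i}{|\mathbf{x}-\mathbf{x}_i|}\big)$ for which $$|||u|||^2_{H^s(\partial\Omega)}:=\sum_{i=1}^N\Big(r_i^2([u_i]_0^0)^2+r_i^2\sum_{\ell=1}^\infty\sum_{m=-\ell}^{\ell}\big(\tfrac{\ell}{r_i}\big)^{2s}([u_i]_\ell^m)^2\Big)<\infty.$$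 It is known that $\sigma_f\in H^s(\partial\Omega)$ implies $\nu\in H^s(\partial\Omega)$. Problem (P): given $\sigma_f\in H^{-1/2}(\partial\Omega)$, find $\nu\in H^{-1/2}(\partial\Omega)$ with $\langle\mathcal{A}^*\nu,\lambda\rangle_{\partial\Omega}=\frac{4\pi}{\kappa_0}\langle\sigma_f,\lambda\rangle_{\partial\Omega}$ for all $\lambda\in H^{1/2}(\partial\Omega)$. Problem (G): find $\nu_{\ell_{\max}}\in W^{\ell_{\max}}$ with $(\mathcal{A}^*\nu_{\ell_{\max}},\psi)_{L^2(\partial\Omega)}=\frac{4\pi}{\kappa_0}(\sigma_f,\psi)_{L^2(\partial\Omega)}$ for all $\psi\in W^{\ell_{\max}}$. Energy. For $\sigma_f\in H^{-1/2}(\partial\Omega)$, the electrostatic energy functional is $\mathcal{E}_{\sigma_f}(\sigma):=\frac12\langle\sigma,\mathcal{V}\sigma_f\rangle_{\partial\Omega}$, $\sigma\in H^{-1/2}(\partial\Omega)$. "Analytic on $\partial\Omega$" means real-analytic on each sphere $\partial\Omega_i$. Convention on constants. "Depending on the radii, the dielectric constants and the minimal separation but independent of $N$" means that the constant can be chosen as a function of the set $\{r_1,\dots,r_N\}$ (without multiplicity), of $\kappa_0$ and the set $\{\kappa_1,\dots,\kappa_N\}$ (without multiplicity), and of $\delta$. *)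

theory Defs
  imports "HOL-Analysis.Analysis" "HOL-Computational_Algebra.Polynomial"
begin

type_synonym pt = "real^3"

(* Functions on the boundary are total functions pt => real of which only the values on the
   spheres matter.  An element of H^(-1/2) is a functional on such functions, and the duality
   pairing <sigma, psi> is the application  sigma psi. *)
type_synonym bfun = "pt \<Rightarrow> real"
type_synonym bdual = "bfun \<Rightarrow> real"

subsection \<open>Geometry\<close>

(* The spheres are numbered 0, ..., N - 1; ctr and rad are irrelevant from N on. *)
record spheres =
  nsph :: nat
  ctr :: "nat \<Rightarrow> pt"
  rad :: "nat \<Rightarrow> real"

definition sph :: "spheres \<Rightarrow> nat \<Rightarrow> pt set" where
  "sph G i = sphere (ctr G i) (rad G i)"

definition bdry :: "spheres \<Rightarrow> pt set" where
  "bdry G = (\<Union>i<nsph G. sph G i)"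

definition Omega :: "spheres \<Rightarrow> pt set" where
  "Omega G = (\<Union>i<nsph G. ball (ctr G i) (rad G i))"

(* For a single sphere there is no separation distance; 0 is then a dummy value, never
   attained by an admissible geometry with at least two spheres. *)
definition sep_dist :: "spheres \<Rightarrow> real" where
  "sep_dist G = (if nsph G \<le> 1 then 0 else
     Min {dist (ctr G i) (ctr G j) - rad G i - rad G j | i j. i < nsph G \<and> j < nsph G \<and> i \<noteq> j})"

definition admissible_geometry :: "spheres \<Rightarrow> bool" where
  "admissible_geometry G \<longleftrightarrow> nsph G \<ge> 1 \<and> (\<forall>i<nsph G. rad G i > 0) \<and> (nsph G \<ge> 2 \<longrightarrow> sep_dist G > 0)"

definition admissible_dielectric :: "spheres \<Rightarrow> real \<Rightarrow> (nat \<Rightarrow> real) \<Rightarrow> bool" where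
  "admissible_dielectric G k0 k \<longleftrightarrow> k0 > 0 \<and> (\<forall>i<nsph G. k i > 0 \<and> k i \<noteq> k0)"

definition max_rad :: "spheres \<Rightarrow> real" where
  "max_rad G = Max (rad G ` {..<nsph G})"

(* Surface measure of a sphere of radius R as the cone measure: on the unit sphere the area of A
   is 3 times the volume of the cone over A in the unit ball. *)
definition sphere_measure :: "pt \<Rightarrow> real \<Rightarrow> pt measure" where
  "sphere_measure c R = scale_measure (ennreal (3 * R\<^sup>2))
     (distr (restrict_space lborel (ball 0 1 - {0})) (restrict_space borel (sphere c R))
        (\<lambda>y. c + (R / norm y) *\<^sub>R y))"

definition surf :: "spheres \<Rightarrow> nat \<Rightarrow> pt measure" where
  "surf G i = sphere_measure (ctr G i) (rad G i)"

subsection \<open>Function spaces on the boundary\<close>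

definition sq_integrable :: "pt measure \<Rightarrow> (pt \<Rightarrow> real) \<Rightarrow> bool" where
  "sq_integrable M f \<longleftrightarrow> f \<in> borel_measurable M \<and> integrable M (\<lambda>x. (f x)\<^sup>2)"

definition L2 :: "spheres \<Rightarrow> bfun set" where
  "L2 G = {f. \<forall>i<nsph G. sq_integrable (surf G i) f}"

definition L2_inner :: "spheres \<Rightarrow> bfun \<Rightarrow> bfun \<Rightarrow> real" where
  "L2_inner G f g = (\<Sum>i<nsph G. \<integral>x. f x * g x \<partial>surf G i)"

definition L2_norm :: "spheres \<Rightarrow> bfun \<Rightarrow> real" where
  "L2_norm G f = sqrt (L2_inner G f f)"

definition slobodeckij :: "bfun \<Rightarrow> pt \<times> pt \<Rightarrow> real" where
  "slobodeckij f = (\<lambda>(x, y). \<bar>f x - f y\<bar>\<^sup>2 / norm (x - y) ^ 3)"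

definition Hhalf :: "spheres \<Rightarrow> bfun set" where
  "Hhalf G = {f \<in> L2 G. \<forall>i<nsph G. integrable (surf G i \<Otimes>\<^sub>M surf G i) (slobodeckij f)}"

definition Hhalf_norm :: "spheres \<Rightarrow> bfun \<Rightarrow> real" where
  "Hhalf_norm G f = sqrt (\<Sum>i<nsph G.
     (\<integral>x. (f x)\<^sup>2 \<partial>surf G i) + (\<integral>p. slobodeckij f p \<partial>(surf G i \<Otimes>\<^sub>M surf G i)))"

(* Functionals vanish outside H^(1/2) so that equality of elements is equality of functionals.
   Boundedness makes them compatible with equality almost everywhere. *)
definition Hminus :: "spheres \<Rightarrow> bdual set" where
  "Hminus G = {\<sigma>.
     (\<forall>f\<in>Hhalf G. \<forall>g\<in>Hhalf G. \<sigma> (\<lambda>x. f x + g x) = \<sigma> f + \<sigma> g) \<and>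
     (\<forall>a. \<forall>f\<in>Hhalf G. \<sigma> (\<lambda>x. a * f x) = a * \<sigma> f) \<and>
     (\<exists>B. \<forall>f\<in>Hhalf G. \<bar>\<sigma> f\<bar> \<le> B * Hhalf_norm G f) \<and>
     (\<forall>f. f \<notin> Hhalf G \<longrightarrow> \<sigma> f = 0)}"

definition Hminus_norm :: "spheres \<Rightarrow> bdual \<Rightarrow> real" where
  "Hminus_norm G \<sigma> = Sup {\<bar>\<sigma> f\<bar> | f. f \<in> Hhalf G \<and> Hhalf_norm G f \<le> 1}"

(* The embedding of L^2 into H^(-1/2). *)
definition dual_of :: "spheres \<Rightarrow> bfun \<Rightarrow> bdual" where
  "dual_of G v = (\<lambda>f. if f \<in> Hhalf G then L2_inner G v f else 0)"

definition dual_diff :: "bdual \<Rightarrow> bdual \<Rightarrow> bdual" where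
  "dual_diff \<sigma> \<tau> = (\<lambda>f. \<sigma> f - \<tau> f)"

definition Cconst :: "spheres \<Rightarrow> bfun set" where
  "Cconst G = {c. \<forall>i<nsph G. \<exists>a. \<forall>x\<in>sph G i. c x = a}"

definition Hhalf_breve :: "spheres \<Rightarrow> bfun set" where
  "Hhalf_breve G = {f \<in> Hhalf G. \<forall>c\<in>Cconst G. L2_inner G f c = 0}"

definition Hminus_breve :: "spheres \<Rightarrow> bdual set" where
  "Hminus_breve G = {\<sigma> \<in> Hminus G. \<forall>c\<in>Cconst G. \<sigma> c = 0}"

(* P0 and Q0 are determined on the boundary; SOME only picks the values elsewhere. *)
definition P0 :: "spheres \<Rightarrow> bfun \<Rightarrow> bfun" where
  "P0 G f = (SOME c. c \<in> Cconst G \<and> (\<lambda>x. f x - c x) \<in> Hhalf_breve G)"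

definition Q0 :: "spheres \<Rightarrow> bdual \<Rightarrow> bfun" where
  "Q0 G \<sigma> = (SOME c. c \<in> Cconst G \<and> dual_diff \<sigma> (dual_of G c) \<in> Hminus_breve G)"

(* The complementary projection of H^(-1/2), for elements represented by a function v. *)
definition Q0_perp :: "spheres \<Rightarrow> bfun \<Rightarrow> bfun" where
  "Q0_perp G v = (\<lambda>x. v x - Q0 G (dual_of G v) x)"

subsection \<open>Interior Dirichlet-to-Neumann map\<close>

definition pd :: "3 \<Rightarrow> (pt \<Rightarrow> real) \<Rightarrow> pt \<Rightarrow> real" where
  "pd j f x = frechet_derivative f (at x) (axis j 1)"

(* k times continuously differentiable on an open set *)
primrec Ck_on :: "nat \<Rightarrow> pt set \<Rightarrow> (pt \<Rightarrow> real) \<Rightarrow> bool" where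
  "Ck_on 0 S f \<longleftrightarrow> continuous_on S f"
| "Ck_on (Suc k) S f \<longleftrightarrow> (\<forall>x\<in>S. f differentiable (at x)) \<and> (\<forall>j. Ck_on k S (pd j f))"

definition smooth :: "(pt \<Rightarrow> real) \<Rightarrow> bool" where
  "smooth f \<longleftrightarrow> (\<forall>k. Ck_on k UNIV f)"

definition harmonic_on :: "pt set \<Rightarrow> (pt \<Rightarrow> real) \<Rightarrow> bool" where
  "harmonic_on S u \<longleftrightarrow> Ck_on 2 S u \<and> (\<forall>x\<in>S. (\<Sum>j\<in>UNIV. pd j (pd j u) x) = 0)"

definition test_function :: "pt set \<Rightarrow> (pt \<Rightarrow> real) \<Rightarrow> bool" where
  "test_function S f \<longleftrightarrow> smooth f \<and> compact (closure {x. f x \<noteq> 0}) \<and> closure {x. f x \<noteq> 0} \<subseteq> S"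

(* u belongs to H^1(S) and its weak gradient is g *)
definition in_H1 :: "pt set \<Rightarrow> (pt \<Rightarrow> real) \<Rightarrow> (pt \<Rightarrow> pt) \<Rightarrow> bool" where
  "in_H1 S u g \<longleftrightarrow>
     sq_integrable (lebesgue_on S) u \<and>
     (\<forall>j. sq_integrable (lebesgue_on S) (\<lambda>x. g x $ j)) \<and>
     (\<forall>\<phi>. test_function S \<phi> \<longrightarrow>
        (\<forall>j. (\<integral>x. u x * pd j \<phi> x \<partial>lebesgue_on S) = - (\<integral>x. g x $ j * \<phi> x \<partial>lebesgue_on S)))"

(* The Dirichlet trace is the continuous extension of the restriction of smooth functions,
   from H^1 to L^2 of the boundary; g is the weak gradient of u. *)
definition has_trace :: "spheres \<Rightarrow> (pt \<Rightarrow> real) \<Rightarrow> (pt \<Rightarrow> pt) \<Rightarrow> bfun \<Rightarrow> bool" where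
  "has_trace G u g f \<longleftrightarrow> in_H1 (Omega G) u g \<and> f \<in> L2 G \<and>
     (\<exists>\<phi>. (\<forall>n. smooth (\<phi> n)) \<and>
        (\<lambda>n. \<integral>x. (\<phi> n x - u x)\<^sup>2 \<partial>lebesgue_on (Omega G)) \<longlonglongrightarrow> 0 \<and>
        (\<forall>j. (\<lambda>n. \<integral>x. (pd j (\<phi> n) x - g x $ j)\<^sup>2 \<partial>lebesgue_on (Omega G)) \<longlonglongrightarrow> 0) \<and>
        (\<lambda>n. L2_norm G (\<lambda>x. \<phi> n x - f x)) \<longlonglongrightarrow> 0)"

(* tau is the Neumann trace of a harmonic function in H^1 with gradient g (exterior normal), in
   the weak sense given by Green's formula. *)
definition neumann_trace :: "spheres \<Rightarrow> (pt \<Rightarrow> pt) \<Rightarrow> bdual \<Rightarrow> bool" where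
  "neumann_trace G g \<tau> \<longleftrightarrow> \<tau> \<in> Hminus G \<and>
     (\<forall>w h \<mu>. \<mu> \<in> Hhalf G \<and> has_trace G w h \<mu> \<longrightarrow>
        \<tau> \<mu> = (\<integral>x. g x \<bullet> h x \<partial>lebesgue_on (Omega G)))"

definition DtN :: "spheres \<Rightarrow> bfun \<Rightarrow> bdual" where
  "DtN G f = (THE \<tau>. \<exists>u g. harmonic_on (Omega G) u \<and> has_trace G u g f \<and> neumann_trace G g \<tau>)"

subsection \<open>Single layer operator and the operator A\<close>

definition single_layer_fun :: "spheres \<Rightarrow> bfun \<Rightarrow> bfun" where
  "single_layer_fun G g x = (\<Sum>i<nsph G. \<integral>y. g y / (4 * pi * norm (x - y)) \<partial>surf G i)"

(* Continuous extension of the integral operator from L^2 to H^(-1/2), with values in H^(1/2);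
   the function chosen by SOME is determined almost everywhere on the boundary. *)
definition single_layer :: "spheres \<Rightarrow> bdual \<Rightarrow> bfun" where
  "single_layer G \<nu> = (SOME f. f \<in> Hhalf G \<and>
     (\<exists>g. (\<forall>n. g n \<in> L2 G) \<and>
        (\<lambda>n. Hminus_norm G (dual_diff (dual_of G (g n)) \<nu>)) \<longlonglongrightarrow> 0 \<and>
        (\<lambda>n. Hhalf_norm G (\<lambda>x. single_layer_fun G (g n) x - f x)) \<longlonglongrightarrow> 0))"

definition kappa_fun :: "spheres \<Rightarrow> (nat \<Rightarrow> real) \<Rightarrow> bfun" where
  "kappa_fun G k x = (\<Sum>i<nsph G. k i * indicator (sph G i) x)"

definition opA :: "spheres \<Rightarrow> real \<Rightarrow> (nat \<Rightarrow> real) \<Rightarrow> bfun \<Rightarrow> bfun" where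
  "opA G k0 k f = (\<lambda>x. f x -
     single_layer G (DtN G (\<lambda>y. (k0 - kappa_fun G k y) / k0 * f y)) x)"

definition opA_adj :: "spheres \<Rightarrow> real \<Rightarrow> (nat \<Rightarrow> real) \<Rightarrow> bdual \<Rightarrow> bdual" where
  "opA_adj G k0 k \<sigma> = (\<lambda>f. if f \<in> Hhalf G then \<sigma> (opA G k0 k f) else 0)"

subsection \<open>Energy norms and energy functional\<close>

(* The radicand is nonnegative on H^(1/2); powr, unlike sqrt, is never negative. *)
definition tnorm :: "spheres \<Rightarrow> bfun \<Rightarrow> real" where
  "tnorm G f = ((L2_norm G (P0 G f))\<^sup>2 + DtN G f f) powr (1/2)"

definition tnorm_dual :: "spheres \<Rightarrow> bdual \<Rightarrow> real" where
  "tnorm_dual G \<sigma> = Sup {\<sigma> \<psi> / tnorm G \<psi> | \<psi>.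
     \<psi> \<in> Hhalf G \<and> \<not> (\<forall>i<nsph G. AE x in surf G i. \<psi> x = 0)}"

definition energy :: "spheres \<Rightarrow> bdual \<Rightarrow> bdual \<Rightarrow> real" where
  "energy G \<sigma>f \<sigma> = 1/2 * \<sigma> (single_layer G \<sigma>f)"

subsection \<open>Spherical harmonics and higher order spaces\<close>

(* Rodrigues' formula *)
definition legendre :: "nat \<Rightarrow> real poly" where
  "legendre l = smult (1 / (2 ^ l * fact l)) ((pderiv ^^ l) ([:-1, 0, 1:] ^ l))"

(* In polar coordinates w = (sin t cos p, sin t sin p, cos t), with k = |m|, the associated
   Legendre function is (sin t)^k times the k-th derivative of P_l at cos t, and
   (sin t)^k cos (k p), (sin t)^k sin (k p) are the real and imaginary part of (w_1 + i w_2)^k.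
   No Condon-Shortley sign. *)
definition Ylm :: "nat \<Rightarrow> int \<Rightarrow> pt \<Rightarrow> real" where
  "Ylm l m w = (let k = nat \<bar>m\<bar>; z = Complex (w $ 1) (w $ 2) in
     sqrt (real (2 * l + 1) / (4 * pi) * (fact (l - k) / fact (l + k))) *
     poly ((pderiv ^^ k) (legendre l)) (w $ 3) *
     (if m = 0 then 1 else if m > 0 then sqrt 2 * Re (z ^ k) else sqrt 2 * Im (z ^ k)))"

definition Ysph :: "spheres \<Rightarrow> nat \<Rightarrow> nat \<Rightarrow> int \<Rightarrow> bfun" where
  "Ysph G i l m x = Ylm l m ((x - ctr G i) /\<^sub>R norm (x - ctr G i))"

definition Wspace :: "spheres \<Rightarrow> nat \<Rightarrow> bfun set" where
  "Wspace G L = {u. \<forall>i<nsph G. \<exists>a. \<forall>x\<in>sph G i.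
     u x = (\<Sum>l\<le>L. \<Sum>m\<in>{- int l..int l}. a l m * Ysph G i l m x)}"

(* Division by the squared radius: the harmonics are orthonormal on the unit sphere. *)
definition coef :: "spheres \<Rightarrow> bfun \<Rightarrow> nat \<Rightarrow> nat \<Rightarrow> int \<Rightarrow> real" where
  "coef G u i l m = (\<integral>x. u x * Ysph G i l m x \<partial>surf G i) / (rad G i)\<^sup>2"

(* the contribution of degree n + 1 *)
definition Hs_term :: "spheres \<Rightarrow> real \<Rightarrow> bfun \<Rightarrow> nat \<Rightarrow> nat \<Rightarrow> real" where
  "Hs_term G s u i n = (\<Sum>m\<in>{- int (Suc n)..int (Suc n)}.
     (real (Suc n) / rad G i) powr (2 * s) * (coef G u i (Suc n) m)\<^sup>2)"

definition Hs :: "spheres \<Rightarrow> real \<Rightarrow> bfun set" where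
  "Hs G s = {u \<in> L2 G. \<forall>i<nsph G. summable (Hs_term G s u i)}"

definition Hs_norm :: "spheres \<Rightarrow> real \<Rightarrow> bfun \<Rightarrow> real" where
  "Hs_norm G s u = sqrt (\<Sum>i<nsph G.
     (rad G i)\<^sup>2 * (coef G u i 0 0)\<^sup>2 + (rad G i)\<^sup>2 * (\<Sum>n. Hs_term G s u i n))"

subsection \<open>Smooth and analytic functions on the boundary\<close>

definition smooth_bdry :: "spheres \<Rightarrow> bfun \<Rightarrow> bool" where
  "smooth_bdry G f \<longleftrightarrow> (\<exists>F. smooth F \<and> (\<forall>x\<in>bdry G. F x = f x))"

definition real_analytic_at :: "(pt \<Rightarrow> real) \<Rightarrow> pt \<Rightarrow> bool" where
  "real_analytic_at F p \<longleftrightarrow> (\<exists>(a :: nat \<Rightarrow> nat \<Rightarrow> nat \<Rightarrow> real) e. e > 0 \<and> (\<forall>x\<in>ball p e.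
     ((\<lambda>(i, j, k). a i j k * (x $ 1 - p $ 1) ^ i * (x $ 2 - p $ 2) ^ j * (x $ 3 - p $ 3) ^ k)
        has_sum F x) UNIV))"

(* Real-analytic on the submanifold sph G i: near each of its points, the restriction of a
   real-analytic function of three variables. *)
definition analytic_bdry :: "spheres \<Rightarrow> bfun \<Rightarrow> bool" where
  "analytic_bdry G f \<longleftrightarrow> (\<forall>i<nsph G. \<forall>p\<in>sph G i. \<exists>F e. real_analytic_at F p \<and> e > 0 \<and>
     (\<forall>x\<in>sph G i \<inter> ball p e. F x = f x))"

definition analytic_dual :: "spheres \<Rightarrow> bdual \<Rightarrow> bool" where
  "analytic_dual G \<nu> \<longleftrightarrow> (\<exists>v. analytic_bdry G v \<and> \<nu> = dual_of G v)"

subsection \<open>The two problems and the constant of the a priori estimates\<close>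

definition solves_P :: "spheres \<Rightarrow> real \<Rightarrow> (nat \<Rightarrow> real) \<Rightarrow> bdual \<Rightarrow> bdual \<Rightarrow> bool" where
  "solves_P G k0 k \<sigma>f \<nu> \<longleftrightarrow> \<nu> \<in> Hminus G \<and>
     (\<forall>f\<in>Hhalf G. opA_adj G k0 k \<nu> f = 4 * pi / k0 * \<sigma>f f)"

definition solves_G :: "spheres \<Rightarrow> real \<Rightarrow> (nat \<Rightarrow> real) \<Rightarrow> bdual \<Rightarrow> nat \<Rightarrow> bfun \<Rightarrow> bool" where
  "solves_G G k0 k \<sigma>f L w \<longleftrightarrow> w \<in> Wspace G L \<and>
     (\<forall>\<psi>\<in>Wspace G L. opA_adj G k0 k (dual_of G w) \<psi> = 4 * pi / k0 * \<sigma>f \<psi>)"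

(* C depends only on the set of radii, the outer dielectric constant, the set of inner
   dielectric constants and the separation distance (the dummy 0 if there is one sphere), hence
   not on the number of spheres.  As sigma_f lies in H^s, so does the solution of (P); it is
   therefore quantified as a function v in H^s. *)
definition main_constant :: "(real set \<Rightarrow> real \<Rightarrow> real set \<Rightarrow> real \<Rightarrow> real) \<Rightarrow> bool" where
  "main_constant C \<longleftrightarrow> (\<forall>G k0 k. admissible_geometry G \<and> admissible_dielectric G k0 k \<longrightarrow>
     (let c = C (rad G ` {..<nsph G}) k0 (k ` {..<nsph G}) (sep_dist G) in c > 0 \<and>
       (\<forall>s L sf v w. s \<ge> 0 \<and> L \<ge> 1 \<and> sf \<in> Hs G s \<and> v \<in> Hs G s \<and>
          solves_P G k0 k (dual_of G sf) (dual_of G v) \<and> solves_G G k0 k (dual_of G sf) L w \<longrightarrow>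
          tnorm_dual G (dual_diff (dual_of G v) (dual_of G w))
            \<le> c * (max_rad G / real (L + 1)) powr (s + 1/2) *
              (Hs_norm G s (Q0_perp G v) + 8 * pi / k0 * Hs_norm G s (Q0_perp G sf)) \<and>
          \<bar>energy G (dual_of G sf) (dual_of G v) - energy G (dual_of G sf) (dual_of G w)\<bar>
            \<le> c * (max_rad G / real (L + 1)) powr (s + 1/2) *
              tnorm G (single_layer G (dual_of G sf)) *
              (Hs_norm G s (Q0_perp G v) + 8 * pi / k0 * Hs_norm G s (Q0_perp G sf)))))"

end

(* Apply the a priori estimate with s = theta * (lmax + 1) for a small fixed theta.  If the degree-l
   coefficients of v and sigma_f are O(q^l), then their H^s norms are O(1 + (b s)^s), so for small
   theta the right hand side decays like exp (- theta * (lmax + 1)); giving away half of the rate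
   absorbs every constant, including 1/k0, for large lmax.

   The decay of the coefficients: for orthonormal u, v the "beam" ((w . u) + i (w . v))^l is
   multiplied by exp (i l alpha) under rotation by alpha in the plane of u and v.  Since an analytic f
   extends holomorphically in alpha to a disc of fixed radius, an n-th finite difference in alpha with
   step pi / l and n proportional to l shows that the integral of f against a beam is O(q^l).  The
   harmonics of degree l are the Laurent coefficients in t of (w_3 + i/2 (W t + cnj W / t))^l, where
   W = w_1 + i w_2, and this is a multiple of a beam for each complex t.  Cauchy's estimate on
   |t|^2 = (l + |m| + 1) / (l - |m| + 1) loses only a factor polynomial in l. *)

theory Submission
  imports Defs "HOL-Complex_Analysis.Complex_Analysis"
begin

subsection \<open>Surface measure of a sphere\<close>

text \<open>\<open>C\<close> is fixed before \<open>Cmain\<close>, \<open>k0\<close> and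
  \<open>k\<close>, so 8 pi / k0 cannot be put into it and has to go into the threshold for
  \<open>l\<close>; half of the rate pays for this, and \<open>C\<close> can then be read off from
  the rate alone. Finite differences replace a shift of contour because the complex extension is
  only local: for each point of the sphere there is some holomorphic function of the angle on a disc
  around 0, with no control of how it depends on the point. The differences sample real angles
  alone, where the surface measure is invariant under rotation; the holomorphic function only bounds
  the integrand at each point. Beams come before harmonics because a harmonic of degree l and small
  order m turns with the low frequency m about the polar axis, which gives no decay in l. A beam of
  degree l has the full frequency l in its own plane, and the bound is uniform over all
  planes.\<close>

text \<open>An orthogonal map does not send boxes to boxes. The preimage of a box is therefore
  viewed as its image under the inverse map, whose Lebesgue measure is known; being open, it has the
  same measure for \<open>lborel\<close> and \<open>lebesgue\<close>.\<close>

lemma distr_lborel_orthogonal_transformation: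
  fixes T :: "real^'n::{finite,wellorder} \<Rightarrow> real^'n::_"
  assumes T: "orthogonal_transformation T"
  shows "distr lborel lborel T = lborel"
proof -
  have lin: "linear T" using T by (simp add: orthogonal_transformation_linear)
  have meas: "T \<in> borel_measurable borel"
    using lin by (simp add: borel_measurable_continuous_onI linear_continuous_on linear_linear)
  obtain T' where T': "orthogonal_transformation T'" and inv: "\<And>x. T' (T x) = x" "\<And>x. T (T' x) = x"
    using T by (metis orthogonal_transformation_bij orthogonal_transformation_inv bij_inv_eq_iff)
  have "lborel = distr lborel lborel T"
  proof (rule lborel_eqI)
    fix l u :: "real^'n::_"
    assume lu: "\<And>b. b \<in> Basis \<Longrightarrow> l \<bullet> b \<le> u \<bullet> b"
    have vim: "T -` box l u = T' ` box l u"
      using inv by (auto simp: image_iff) metis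
    have op: "open (T -` box l u)"
      by (intro open_vimage linear_continuous_on) (auto simp: lin linear_linear)
    have bd: "bounded (T -` box l u)" unfolding vim
      using T' by (intro bounded_linear_image) (auto simp: orthogonal_transformation_linear linear_linear)
    have "emeasure (distr lborel lborel T) (box l u) = emeasure lborel (T -` box l u)"
      using meas by (subst emeasure_distr) auto
    also have "\<dots> = ennreal (measure lborel (T -` box l u))"
      using bd emeasure_bounded_finite by (intro emeasure_eq_ennreal_measure) fastforce
    also have "measure lborel (T -` box l u) = measure lebesgue (T -` box l u)"
      using op by (simp add: measure_completion)
    also have "\<dots> = measure lebesgue (box l u)"
      unfolding vim using measure_orthogonal_image[OF _ lmeasurable_box] T' by blast
    also have "\<dots> = (\<Prod>b\<in>Basis. (u - l) \<bullet> b)"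
      using lu by (simp add: measure_completion)
    finally show "emeasure (distr lborel lborel T) (box l u) = (\<Prod>b\<in>Basis. (u - l) \<bullet> b)" .
  qed simp
  then show ?thesis by simp
qed

lemma integral_lborel_orthogonal_transformation:
  fixes T :: "real^'n::{finite,wellorder} \<Rightarrow> real^'n::_" and f :: "real^'n::_ \<Rightarrow> 'b::{banach,second_countable_topology}"
  assumes T: "orthogonal_transformation T" and f: "f \<in> borel_measurable borel"
  shows "(\<integral>x. f (T x) \<partial>lborel) = (\<integral>x. f x \<partial>lborel)"
proof -
  have meas: "T \<in> borel_measurable borel"
    using T by (simp add: borel_measurable_continuous_onI linear_continuous_on linear_linear
        orthogonal_transformation_linear)
  have "(\<integral>x. f x \<partial>lborel) = (\<integral>x. f x \<partial>distr lborel lborel T)"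
    by (simp add: distr_lborel_orthogonal_transformation[OF T])
  also have "\<dots> = (\<integral>x. f (T x) \<partial>lborel)"
    using meas f by (intro integral_distr) auto
  finally show ?thesis ..
qed

lemma integral_scale_measure_ennreal:
  fixes f :: "'a \<Rightarrow> 'b::{banach,second_countable_topology}"
  assumes "r \<ge> 0" and "f \<in> borel_measurable M"
  shows "integral\<^sup>L (scale_measure (ennreal r) M) f = r *\<^sub>R integral\<^sup>L M f"
proof -
  have "scale_measure (ennreal r) M = density M (\<lambda>_. ennreal r)"
    by (intro measure_eqI) (auto simp: emeasure_density_const)
  with assms show ?thesis by (simp add: integral_density)
qed

lemma space_sphere_measure [simp]: "space (sphere_measure c R) = sphere c R"
  by (simp add: sphere_measure_def space_scale_measure space_restrict_space)

lemma sets_sphere_measure [simp, measurable_cong]: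
  "sets (sphere_measure c R) = sets (restrict_space borel (sphere c R))"
  by (simp add: sphere_measure_def)

lemma cone_map_measurable:
  assumes "R > 0"
  shows "(\<lambda>y::pt. c + (R / norm y) *\<^sub>R y)
    \<in> measurable (restrict_space lborel (ball 0 1 - {0})) (restrict_space borel (sphere c R))"
proof (rule measurable_restrict_space2)
  show "(\<lambda>y. c + (R / norm y) *\<^sub>R y) \<in> space (restrict_space lborel (ball 0 1 - {0})) \<rightarrow> sphere c R"
    using assms by (auto simp: space_restrict_space dist_norm)
  show "(\<lambda>y. c + (R / norm y) *\<^sub>R y) \<in> borel_measurable (restrict_space lborel (ball 0 1 - {0}))"
    by (rule measurable_restrict_space1) measurable
qed

lemma finite_sphere_measure:
  assumes "R > 0"
  shows "finite_measure (sphere_measure c R)"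
proof (rule finite_measureI)
  let ?B = "ball (0::pt) 1 - {0}"
  have "emeasure (sphere_measure c R) (space (sphere_measure c R)) = ennreal (3 * R\<^sup>2) *
      emeasure (distr (restrict_space lborel ?B) (restrict_space borel (sphere c R))
        (\<lambda>y. c + (R / norm y) *\<^sub>R y)) (space (restrict_space borel (sphere c R)))"
    by (simp add: sphere_measure_def space_scale_measure space_restrict_space)
  also have "\<dots> = ennreal (3 * R\<^sup>2) * emeasure (restrict_space lborel ?B)
      ((\<lambda>y. c + (R / norm y) *\<^sub>R y) -` space (restrict_space borel (sphere c R))
        \<inter> space (restrict_space lborel ?B))"
    by (simp only: emeasure_distr[OF cone_map_measurable[OF assms] sets.top])
  also have "(\<lambda>y. c + (R / norm y) *\<^sub>R y) -` space (restrict_space borel (sphere c R))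
      \<inter> space (restrict_space lborel ?B) = ?B"
    using assms by (auto simp: space_restrict_space dist_norm)
  also have "emeasure (restrict_space lborel ?B) ?B = emeasure lborel ?B"
    by (subst emeasure_restrict_space) auto
  finally have *: "emeasure (sphere_measure c R) (space (sphere_measure c R)) =
    ennreal (3 * R\<^sup>2) * emeasure lborel ?B" .
  have "emeasure lborel ?B < \<infinity>"
    by (rule emeasure_bounded_finite) (auto intro: bounded_subset[of "ball 0 1"])
  then show "emeasure (sphere_measure c R) (space (sphere_measure c R)) \<noteq> \<infinity>"
    by (simp only: *) (simp add: ennreal_mult_eq_top_iff)
qed

lemma integral_sphere_measure:
  fixes f :: "pt \<Rightarrow> 'b::{banach,second_countable_topology}"
  assumes "R > 0" and f: "f \<in> borel_measurable (sphere_measure c R)"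
  shows "integral\<^sup>L (sphere_measure c R) f =
    (3 * R\<^sup>2) *\<^sub>R (\<integral>y. indicator (ball 0 1 - {0}) y *\<^sub>R f (c + (R / norm y) *\<^sub>R y) \<partial>lborel)"
proof -
  let ?N = "distr (restrict_space lborel (ball 0 1 - {0})) (restrict_space borel (sphere c R))
        (\<lambda>y. c + (R / norm y) *\<^sub>R y)"
  have f': "f \<in> borel_measurable (restrict_space borel (sphere c R))"
    using f by (simp cong: measurable_cong_sets)
  have "integral\<^sup>L (sphere_measure c R) f = (3 * R\<^sup>2) *\<^sub>R integral\<^sup>L ?N f"
    unfolding sphere_measure_def
    by (rule integral_scale_measure_ennreal) (use f' in auto)
  also have "integral\<^sup>L ?N f =
    (\<integral>y. f (c + (R / norm y) *\<^sub>R y) \<partial>restrict_space lborel (ball 0 1 - {0}))"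
    using cone_map_measurable[OF assms(1)] f' by (rule integral_distr)
  also have "\<dots> = (\<integral>y. indicator (ball 0 1 - {0}) y *\<^sub>R f (c + (R / norm y) *\<^sub>R y) \<partial>lborel)"
    by (subst integral_restrict_space) auto
  finally show ?thesis .
qed

lemma borel_measurable_sphere_measure:
  assumes "continuous_on (sphere c R) f"
  shows "f \<in> borel_measurable (sphere_measure c R)"
proof -
  have "f \<in> borel_measurable (restrict_space borel (sphere c R))"
    using assms by (rule borel_measurable_continuous_on_restrict)
  then show ?thesis by (simp cong: measurable_cong_sets)
qed

lemma integrable_sphere_measure:
  fixes f :: "pt \<Rightarrow> 'b::{banach,second_countable_topology}"
  assumes "R > 0" and f: "continuous_on (sphere c R) f"
  shows "integrable (sphere_measure c R) f"
proof -
  interpret finite_measure "sphere_measure c R" by (rule finite_sphere_measure[OF assms(1)])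
  have "bounded (f ` sphere c R)"
    by (intro compact_imp_bounded compact_continuous_image f) auto
  then obtain B where "\<forall>x\<in>sphere c R. norm (f x) \<le> B" by (auto simp: bounded_iff)
  then show ?thesis
    by (intro integrable_const_bound[where B = B] borel_measurable_sphere_measure f) auto
qed

text \<open>\<open>T\<close> is linear and preserves norms, so it commutes with the radial map from
  the ball to the sphere, and the invariance of volume passes to the cone measure.\<close>

lemma integral_sphere_measure_orthogonal:
  fixes f :: "pt \<Rightarrow> 'b::{banach,second_countable_topology}"
  assumes "R > 0" and f: "continuous_on (sphere c R) f" and T: "orthogonal_transformation T"
  shows "(\<integral>x. f (c + T (x - c)) \<partial>sphere_measure c R) = (\<integral>x. f x \<partial>sphere_measure c R)"
proof -
  have T0: "T (a *\<^sub>R x) = a *\<^sub>R T x" "norm (T x) = norm x" for a x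
    using T by (simp_all add: orthogonal_transformation_scaleR orthogonal_transformation_norm)
  have T00: "T x = 0 \<longleftrightarrow> x = 0" for x
    using T0(2)[of x] by (metis norm_eq_zero)
  have contT: "continuous_on UNIV T"
    using T by (simp add: linear_continuous_on linear_linear orthogonal_transformation_linear)
  have fT: "continuous_on (sphere c R) (\<lambda>x. f (c + T (x - c)))"
    by (intro continuous_on_compose2[OF f] continuous_intros continuous_on_compose2[OF contT])
      (auto simp: dist_norm T0 norm_minus_commute)
  define g where "g y = indicator (ball 0 1 - {0}) y *\<^sub>R f (c + (R / norm y) *\<^sub>R y)" for y
  have "(\<lambda>y. f (c + (R / norm y) *\<^sub>R y)) \<in> borel_measurable (restrict_space lborel (ball 0 1 - {0}))"
    using measurable_compose[OF cone_map_measurable[OF assms(1)]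
        borel_measurable_continuous_on_restrict[OF f]] .
  then have g: "g \<in> borel_measurable borel"
    unfolding g_def by (subst (asm) borel_measurable_restrict_space_iff) auto
  have "(\<integral>x. f (c + T (x - c)) \<partial>sphere_measure c R) = (3 * R\<^sup>2) *\<^sub>R (\<integral>y. g (T y) \<partial>lborel)"
    by (subst integral_sphere_measure[OF assms(1) borel_measurable_sphere_measure[OF fT]])
      (auto simp: g_def T0 T00 indicator_def intro!: Bochner_Integration.integral_cong)
  also have "\<dots> = (3 * R\<^sup>2) *\<^sub>R (\<integral>y. g y \<partial>lborel)"
    by (simp add: integral_lborel_orthogonal_transformation[OF T g])
  also have "\<dots> = (\<integral>x. f x \<partial>sphere_measure c R)"
    unfolding g_def by (rule integral_sphere_measure[OF assms(1) borel_measurable_sphere_measure[OF f], symmetric])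
  finally show ?thesis .
qed

subsection \<open>Averages of analytic functions along great circles\<close>

text \<open>Pascal's rule: a difference of order \<open>Suc n\<close> is a difference of order
  \<open>n\<close> of first differences. This is the recursion that lowers the degree in the next
  lemma.\<close>

lemma alternating_binomial_sum_Suc:
  fixes f :: "nat \<Rightarrow> 'a::comm_ring_1"
  shows "(\<Sum>j\<le>Suc n. (-1) ^ j * of_nat (Suc n choose j) * f j) =
    (\<Sum>j\<le>n. (-1) ^ j * of_nat (n choose j) * (f j - f (Suc j)))"
proof -
  have "(\<Sum>j\<le>Suc n. (-1) ^ j * of_nat (Suc n choose j) * f j) =
    f 0 + (\<Sum>j\<le>n. (-1) ^ Suc j * of_nat (Suc n choose Suc j) * f (Suc j))"
    by (subst sum.atMost_Suc_shift) simp
  also have "(\<Sum>j\<le>n. (-1) ^ Suc j * of_nat (Suc n choose Suc j) * f (Suc j)) =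
    (\<Sum>j\<le>n. (-1) ^ Suc j * of_nat (n choose Suc j) * f (Suc j)) -
    (\<Sum>j\<le>n. (-1) ^ j * of_nat (n choose j) * f (Suc j))"
    unfolding sum_subtractf[symmetric] by (intro sum.cong refl) (simp add: algebra_simps)
  also have "f 0 + (\<dots>) = (f 0 + (\<Sum>j\<le>n. (-1) ^ Suc j * of_nat (n choose Suc j) * f (Suc j))) -
    (\<Sum>j\<le>n. (-1) ^ j * of_nat (n choose j) * f (Suc j))" by simp
  also have "f 0 + (\<Sum>j\<le>n. (-1) ^ Suc j * of_nat (n choose Suc j) * f (Suc j)) =
    (\<Sum>j\<le>Suc n. (-1) ^ j * of_nat (n choose j) * f j)"
    by (subst sum.atMost_Suc_shift) simp
  also have "\<dots> = (\<Sum>j\<le>n. (-1) ^ j * of_nat (n choose j) * f j)" by (simp add: binomial_eq_0)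
  finally show ?thesis by (simp add: sum_subtractf algebra_simps)
qed

text \<open>Each first difference lowers the degree in \<open>j\<close> by one, so \<open>n\<close>
  of them leave nothing of a power below \<open>n\<close>.\<close>

lemma alternating_binomial_sum_power:
  assumes "k < n"
  shows "(\<Sum>j\<le>n. (-1) ^ j * of_nat (n choose j) * of_nat j ^ k) = (0::'a::comm_ring_1)"
  using assms
proof (induction n arbitrary: k)
  case (Suc n)
  have *: "of_nat j ^ k - of_nat (Suc j) ^ k = - (\<Sum>i<k. of_nat (k choose i) * of_nat j ^ i :: 'a)" for j
  proof -
    have "of_nat (Suc j) ^ k = (of_nat j + 1 :: 'a) ^ k" by (simp add: add.commute)
    also have "\<dots> = (\<Sum>i\<le>k. of_nat (k choose i) * of_nat j ^ i)" by (simp add: binomial_ring)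
    also have "\<dots> = (\<Sum>i<k. of_nat (k choose i) * of_nat j ^ i) + of_nat j ^ k"
      by (simp add: lessThan_Suc_atMost[symmetric])
    finally show ?thesis by simp
  qed
  have "(\<Sum>j\<le>Suc n. (-1) ^ j * of_nat (Suc n choose j) * of_nat j ^ k :: 'a) =
    - (\<Sum>j\<le>n. \<Sum>i<k. of_nat (k choose i) * ((-1) ^ j * of_nat (n choose j) * of_nat j ^ i))"
    by (simp only: alternating_binomial_sum_Suc *)
      (simp add: sum_distrib_left sum_negf mult_ac)
  also have "\<dots> = - (\<Sum>i<k. of_nat (k choose i) * (\<Sum>j\<le>n. (-1) ^ j * of_nat (n choose j) * of_nat j ^ i))"
    by (subst sum.swap) (simp add: sum_distrib_left)
  also have "\<dots> = 0"
  proof -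
    have "(\<Sum>j\<le>n. (-1) ^ j * of_nat (n choose j) * of_nat j ^ i) = (0::'a)" if "i < k" for i
      using that Suc.prems by (intro Suc.IH) auto
    then show ?thesis by simp
  qed
  finally show ?case .
qed simp

text \<open>The Taylor polynomial of degree below \<open>n\<close> is annihilated, so only
  remainders count. Cauchy's estimate on the circle of radius \<open>r\<close> bounds the
  coefficients. The sample points satisfy |z| <= r x with x = n \<epsilon> / r <= 1/2, so a
  geometric tail is at most 2 M x^n; the binomial weights sum to 2^n.\<close>

lemma finite_difference_bound:
  fixes H :: "complex \<Rightarrow> complex"
  assumes H: "H holomorphic_on ball 0 r0" "\<And>z. z \<in> ball 0 r0 \<Longrightarrow> norm (H z) \<le> M"
    and r: "0 < r" "r < r0" and eps: "0 \<le> \<epsilon>" "real n * \<epsilon> \<le> r / 2"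
  shows "norm (\<Sum>j\<le>n. (-1) ^ j * of_nat (n choose j) * H (of_real (real j * \<epsilon>)))
    \<le> 2 ^ n * (2 * M * (real n * \<epsilon> / r) ^ n)"
proof -
  define a where "a k = (deriv ^^ k) H 0 / fact k" for k
  define x where "x = real n * \<epsilon> / r"
  have x: "0 \<le> x" "x \<le> 1/2" using r eps by (auto simp: x_def field_simps)
  have M: "0 \<le> M" using order_trans[OF norm_ge_zero H(2)[of 0]] r by auto
  have a: "norm (a k) \<le> M / r ^ k" for k
  proof -
    have "norm ((deriv ^^ k) H 0) \<le> fact k * M / r ^ k"
      using H r
      by (intro Cauchy_inequality)
        (auto intro!: holomorphic_on_subset[OF H(1)]
          continuous_on_subset[OF holomorphic_on_imp_continuous_on[OF H(1)]])
    then show ?thesis by (simp add: a_def norm_divide field_simps)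
  qed
  have tail: "norm (H (of_real (real j * \<epsilon>)) - (\<Sum>k<n. a k * of_real (real j * \<epsilon>) ^ k)) \<le> 2 * M * x ^ n"
    if j: "j \<le> n" for j
  proof -
    define z :: complex where "z = of_real (real j * \<epsilon>)"
    have "real j * \<epsilon> \<le> real n * \<epsilon>" using j eps by (intro mult_right_mono) auto
    then have z: "norm z \<le> r * x" using r eps by (simp add: z_def x_def norm_mult)
    have "r * x \<le> r * (1/2)" using x r by (intro mult_left_mono) auto
    then have "norm z < r0" using z r by linarith
    then have "(\<lambda>k. a k * z ^ k) sums H z"
      using holomorphic_power_series[OF H(1), of z] by (simp add: a_def)
    then have "(\<lambda>k. a (k + n) * z ^ (k + n)) sums (H z - (\<Sum>k<n. a k * z ^ k))"
      by (subst sums_iff_shift)  simp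
    moreover have "(\<lambda>k. M * x ^ n * x ^ k) sums (M * x ^ n * (1 / (1 - x)))"
      using x by (intro sums_mult geometric_sums) auto
    moreover have "norm (a (k + n) * z ^ (k + n)) \<le> M * x ^ n * x ^ k" for k
    proof -
      have "norm (a (k + n) * z ^ (k + n)) \<le> M / r ^ (k + n) * (r * x) ^ (k + n)"
        unfolding norm_mult norm_power using r x
        by (intro mult_mono a power_mono z) (auto simp: M)
      then show ?thesis using r by (simp add: power_mult_distrib power_add field_simps)
    qed
    ultimately have "norm (H z - (\<Sum>k<n. a k * z ^ k)) \<le> M * x ^ n * (1 / (1 - x))"
      by (metis (no_types, lifting) norm_sums_le)
    also have "\<dots> \<le> M * x ^ n * 2"
      using x M by (intro mult_left_mono) (auto simp: field_simps)
    finally show ?thesis by (simp add: z_def mult_ac)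
  qed
  let ?w = "\<lambda>j. (-1) ^ j * of_nat (n choose j) :: complex"
  have "(\<Sum>j\<le>n. ?w j * (\<Sum>k<n. a k * of_real (real j * \<epsilon>) ^ k)) =
      (\<Sum>k<n. a k * of_real \<epsilon> ^ k * (\<Sum>j\<le>n. ?w j * of_nat j ^ k))"
    by (simp add: sum_distrib_left power_mult_distrib mult_ac sum.swap[of _ "{..n}"])
  also have "\<dots> = 0" by (simp add: alternating_binomial_sum_power)
  finally have "(\<Sum>j\<le>n. ?w j * H (of_real (real j * \<epsilon>))) =
    (\<Sum>j\<le>n. ?w j * (H (of_real (real j * \<epsilon>)) - (\<Sum>k<n. a k * of_real (real j * \<epsilon>) ^ k)))"
    by (simp add: algebra_simps sum_subtractf)
  also have "norm \<dots> \<le> (\<Sum>j\<le>n. real (n choose j) * (2 * M * x ^ n))"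
    by (rule sum_norm_le)
      (simp only: norm_mult norm_power norm_minus_cancel norm_one power_one mult_1_left norm_of_nat
        atMost_iff mult_left_mono[OF tail] of_nat_0_le_iff)
  also have "\<dots> = 2 ^ n * (2 * M * x ^ n)"
    by (simp add: sum_distrib_right[symmetric] choose_row_sum[symmetric] flip: of_nat_sum)
  finally show ?thesis by (simp add: x_def)
qed

section \<open>Rotations in a plane and integrals against beams\<close>

text \<open>For orthonormal \<open>u\<close>, \<open>v\<close> the identity on the orthogonal
  complement of their plane. The angle enters only through \<open>cos \<alpha> - 1\<close> and
  \<open>sin \<alpha>\<close>: both extend to complex angles and vanish at 0, so small complex
  angles move a point little.\<close>

definition plane_rotation :: "'a::real_inner \<Rightarrow> 'a \<Rightarrow> real \<Rightarrow> 'a \<Rightarrow> 'a" where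
  "plane_rotation u v \<alpha> y = y + (cos \<alpha> - 1) *\<^sub>R ((y \<bullet> u) *\<^sub>R u + (y \<bullet> v) *\<^sub>R v)
     + sin \<alpha> *\<^sub>R ((y \<bullet> u) *\<^sub>R v - (y \<bullet> v) *\<^sub>R u)"

lemma plane_rotation_inner:
  assumes "norm u = 1" "norm v = 1" "u \<bullet> v = 0"
  shows "plane_rotation u v \<alpha> y \<bullet> u = cos \<alpha> * (y \<bullet> u) - sin \<alpha> * (y \<bullet> v)"
    and "plane_rotation u v \<alpha> y \<bullet> v = cos \<alpha> * (y \<bullet> v) + sin \<alpha> * (y \<bullet> u)"
  using assms
  by (simp_all add: plane_rotation_def inner_simps norm_eq_1 inner_commute[of v u] algebra_simps)

lemma orthogonal_transformation_plane_rotation: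
  assumes "norm u = 1" "norm v = 1" "u \<bullet> v = 0"
  shows "orthogonal_transformation (plane_rotation u v \<alpha>)"
proof -
  have "linear (plane_rotation u v \<alpha>)"
    by (rule linearI) (simp_all add: plane_rotation_def inner_simps algebra_simps)
  moreover have "norm (plane_rotation u v \<alpha> y) = norm y" for y
  proof -
    let ?a = "y \<bullet> u" and ?b = "y \<bullet> v" and ?c = "cos \<alpha>" and ?s = "sin \<alpha>"
    have uv: "u \<bullet> u = 1" "v \<bullet> v = 1" "v \<bullet> u = 0" using assms by (simp_all add: norm_eq_1 inner_commute)
    have "plane_rotation u v \<alpha> y \<bullet> plane_rotation u v \<alpha> y =
      plane_rotation u v \<alpha> y \<bullet> y + (?c - 1) * (?a * (plane_rotation u v \<alpha> y \<bullet> u) + ?b * (plane_rotation u v \<alpha> y \<bullet> v))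
      + ?s * (?a * (plane_rotation u v \<alpha> y \<bullet> v) - ?b * (plane_rotation u v \<alpha> y \<bullet> u))"
      by (subst (2) plane_rotation_def) (simp add: inner_simps)
    also have "plane_rotation u v \<alpha> y \<bullet> y = y \<bullet> y + (?c - 1) * (?a * ?a + ?b * ?b)"
      unfolding plane_rotation_def by (simp add: inner_simps inner_commute[of u y] inner_commute[of v y])
    also have "(y \<bullet> y + (?c - 1) * (?a * ?a + ?b * ?b)) +
      (?c - 1) * (?a * (plane_rotation u v \<alpha> y \<bullet> u) + ?b * (plane_rotation u v \<alpha> y \<bullet> v))
      + ?s * (?a * (plane_rotation u v \<alpha> y \<bullet> v) - ?b * (plane_rotation u v \<alpha> y \<bullet> u))
      = y \<bullet> y + (?a * ?a + ?b * ?b) * (?c * ?c + ?s * ?s - 1)"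
      unfolding plane_rotation_inner[OF assms] by algebra
    also have "?c * ?c + ?s * ?s = 1" by (metis power2_eq_square sin_cos_squared_add2)
    finally show ?thesis by (simp add: norm_eq)
  qed
  ultimately show ?thesis by (simp add: orthogonal_transformation)
qed

text \<open>\<open>H\<close> is chosen for each point and each plane separately; only the radius
  \<open>r0\<close> and the bound \<open>M\<close> are uniform. That is enough because
  \<open>H\<close> bounds an integrand pointwise and is never integrated itself.\<close>

definition rotation_extends :: "(pt \<Rightarrow> real) \<Rightarrow> pt \<Rightarrow> real \<Rightarrow> real \<Rightarrow> real \<Rightarrow> bool" where
  "rotation_extends f c R r0 M \<longleftrightarrow>
    (\<forall>x\<in>sphere c R. \<forall>u v. norm u = 1 \<and> norm v = 1 \<and> u \<bullet> v = 0 \<longrightarrow>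
      (\<exists>H. H holomorphic_on ball 0 r0 \<and> (\<forall>z\<in>ball 0 r0. norm (H z) \<le> M) \<and>
        (\<forall>\<alpha>. \<bar>\<alpha>\<bar> < r0 \<longrightarrow> H (of_real \<alpha>) = of_real (f (c + plane_rotation u v \<alpha> (x - c))))))"

text \<open>Bessel's inequality; it bounds a beam by 1 on the sphere.\<close>

lemma norm_Complex_inner_le:
  assumes "norm u = 1" "norm v = 1" "u \<bullet> v = 0"
  shows "norm (Complex (y \<bullet> u) (y \<bullet> v)) \<le> norm y"
proof -
  let ?y' = "y - (y \<bullet> u) *\<^sub>R u - (y \<bullet> v) *\<^sub>R v"
  have uv: "u \<bullet> u = 1" "v \<bullet> v = 1" "v \<bullet> u = 0" using assms by (simp_all add: norm_eq_1 inner_commute)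
  have "?y' \<bullet> ?y' = y \<bullet> y - (y \<bullet> u) * (y \<bullet> u) - (y \<bullet> v) * (y \<bullet> v)"
    using assms(3) uv by (simp add: inner_simps inner_commute[of u y] inner_commute[of v y] algebra_simps)
  then have "(y \<bullet> u)\<^sup>2 + (y \<bullet> v)\<^sup>2 \<le> (norm y)\<^sup>2"
    using inner_ge_zero[of ?y'] by (simp only: power2_norm_eq_inner) (simp add: power2_eq_square)
  then show ?thesis
    by (simp add: cmod_def real_le_lsqrt)
qed

(* With step pi / l the factors exp (- i l alpha) alternate in sign, so the n-th difference of the
   rotated integral is 2^n times the integral itself. *)
lemma beam_integral_bound:
  assumes R: "R > 0" and f: "continuous_on (sphere c R) f" and ext: "rotation_extends f c R r0 M"
    and r: "0 < r" "r < r0" and uv: "norm u = 1" "norm v = 1" "u \<bullet> v = 0"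
    and n: "real n * (pi / real l) \<le> r / 2" and n0: "l = 0 \<Longrightarrow> n = 0"
  shows "norm (\<integral>x. of_real (f x) * (Complex ((x - c) \<bullet> u) ((x - c) \<bullet> v) / of_real R) ^ l \<partial>sphere_measure c R)
    \<le> 2 * M * measure (sphere_measure c R) (sphere c R) * (real n * (pi / real l) / r) ^ n"
proof -
  define S where "S = sphere_measure c R"
  define b where "b x = (Complex ((x - c) \<bullet> u) ((x - c) \<bullet> v) / of_real R) ^ l" for x
  define I where "I = (\<integral>x. of_real (f x) * b x \<partial>S)"
  define \<epsilon> where "\<epsilon> = pi / real l"
  let ?rot = "plane_rotation u v"
  let ?w = "\<lambda>j. (-1) ^ j * of_nat (n choose j) :: complex"
  interpret finite_measure S unfolding S_def by (rule finite_sphere_measure[OF R])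
  have Complex_conv: "Complex ((x - c) \<bullet> u) ((x - c) \<bullet> v) = of_real ((x - c) \<bullet> u) + \<i> * of_real ((x - c) \<bullet> v)" for x
    by (simp add: complex_eq_iff)
  have orth: "orthogonal_transformation (?rot \<alpha>)" for \<alpha>
    by (rule orthogonal_transformation_plane_rotation[OF uv])
  have normrot: "norm (?rot \<alpha> y) = norm y" for \<alpha> y
    using orth by (simp add: orthogonal_transformation_norm)
  have controt: "continuous_on A (?rot \<alpha>)" for \<alpha> A
    using orth by (simp add: linear_continuous_on linear_linear orthogonal_transformation_linear)
  have contb: "continuous_on A b" for A
    unfolding b_def Complex_conv using R by (intro continuous_intros) auto
  have contF: "continuous_on (sphere c R) (\<lambda>x. of_real (f (c + ?rot \<alpha> (x - c))) * b x)" for \<alpha>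
    by (intro continuous_intros contb continuous_on_compose2[OF f] continuous_on_compose2[OF controt])
      (auto simp: dist_norm normrot norm_minus_commute)
  have brot: "b (c + ?rot \<alpha> (x - c)) = cis (real l * \<alpha>) * b x" for x \<alpha>
  proof -
    have "Complex (?rot \<alpha> y \<bullet> u) (?rot \<alpha> y \<bullet> v) = cis \<alpha> * Complex (y \<bullet> u) (y \<bullet> v)" for y
      unfolding plane_rotation_inner[OF uv] by (simp add: complex_eq_iff algebra_simps)
    then show ?thesis
      by (simp add: b_def power_mult_distrib power_divide Complex.DeMoivre)
  qed
  have shift: "(\<integral>x. of_real (f (c + ?rot \<alpha> (x - c))) * b x \<partial>S) = cis (- (real l * \<alpha>)) * I" for \<alpha>
  proof -
    have "(\<integral>x. of_real (f (c + ?rot \<alpha> (x - c))) * b x \<partial>S) =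
      (\<integral>x. cis (- (real l * \<alpha>)) * (of_real (f (c + ?rot \<alpha> (x - c))) * b (c + ?rot \<alpha> (x - c))) \<partial>S)"
      unfolding brot by (intro Bochner_Integration.integral_cong refl) (simp add: mult_ac cis_mult mult.left_commute[of "cis _" "cis _"])
    also have "\<dots> = cis (- (real l * \<alpha>)) * (\<integral>x. of_real (f (c + ?rot \<alpha> (x - c))) * b (c + ?rot \<alpha> (x - c)) \<partial>S)"
      by simp
    also have "(\<integral>x. of_real (f (c + ?rot \<alpha> (x - c))) * b (c + ?rot \<alpha> (x - c)) \<partial>S) = I"
      unfolding I_def S_def
      using integral_sphere_measure_orthogonal[OF R _ orth, of c "\<lambda>x. of_real (f x) * b x"]
      by (simp add: continuous_intros contb f)
    finally show ?thesis .
  qed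
  have "(\<Sum>j\<le>n. ?w j * cis (- (real l * (real j * \<epsilon>)))) = 2 ^ n"
  \<comment> \<open>For \<open>l = 0\<close> division by zero makes the step
    \<open>\<epsilon>\<close> equal to 0, and the alternating binomials would sum to 0 for positive
    \<open>n\<close>; assumption \<open>n0\<close> leaves \<open>n = 0\<close>, where the sum is
    1.\<close>
  proof (cases "l = 0")
    case True
    then show ?thesis using n0 by simp
  next
    case False
    have "cis (- (real l * (real j * \<epsilon>))) = (-1) ^ j" for j
    proof -
      have "- (real l * (real j * \<epsilon>)) = real j * (- pi)" using False by (simp add: \<epsilon>_def)
      then have "cis (- (real l * (real j * \<epsilon>))) = cis (- pi) ^ j" by (simp only: Complex.DeMoivre)
      moreover have "cis (- pi) = -1" by (simp add: complex_eq_iff)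
      ultimately show ?thesis by simp
    qed
    then have "(\<Sum>j\<le>n. ?w j * cis (- (real l * (real j * \<epsilon>)))) = (\<Sum>j\<le>n. of_nat (n choose j))"
      by (intro sum.cong refl) (simp flip: power_mult_distrib)
    then show ?thesis by (simp add: choose_row_sum flip: of_nat_sum)
  qed
  then have "2 ^ n * I = (\<Sum>j\<le>n. ?w j * cis (- (real l * (real j * \<epsilon>)))) * I" by simp
  also have "\<dots> = (\<Sum>j\<le>n. ?w j * (\<integral>x. of_real (f (c + ?rot (real j * \<epsilon>) (x - c))) * b x \<partial>S))"
    by (simp add: shift sum_distrib_right mult.assoc)
  also have "\<dots> = (\<integral>x. (\<Sum>j\<le>n. ?w j * (of_real (f (c + ?rot (real j * \<epsilon>) (x - c))) * b x)) \<partial>S)"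
    by (subst Bochner_Integration.integral_sum)
      (auto intro!: integrable_mult_right integrable_sphere_measure R contF simp: S_def)
  finally have "2 ^ n * norm I = norm (\<integral>x. (\<Sum>j\<le>n. ?w j * (of_real (f (c + ?rot (real j * \<epsilon>) (x - c))) * b x)) \<partial>S)"
    by (metis norm_mult norm_numeral norm_power)
  also have "\<dots> \<le> (\<integral>x. 2 ^ n * (2 * M * (real n * \<epsilon> / r) ^ n) \<partial>S)"
  proof (rule Bochner_Integration.integral_norm_bound_integral)
    show "integrable S (\<lambda>x. \<Sum>j\<le>n. ?w j * (of_real (f (c + ?rot (real j * \<epsilon>) (x - c))) * b x))"
      unfolding S_def
      by (intro Bochner_Integration.integrable_sum integrable_mult_right integrable_sphere_measure R contF)
    fix x assume "x \<in> space S"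
    then have x: "x \<in> sphere c R" by (simp add: S_def)
    then obtain H where H: "H holomorphic_on ball 0 r0" "\<And>z. z \<in> ball 0 r0 \<Longrightarrow> norm (H z) \<le> M"
      and Hf: "\<And>\<alpha>. \<bar>\<alpha>\<bar> < r0 \<Longrightarrow> H (of_real \<alpha>) = of_real (f (c + ?rot \<alpha> (x - c)))"
      using ext uv unfolding rotation_extends_def by blast
    have Hj: "H (of_real (real j * \<epsilon>)) = of_real (f (c + ?rot (real j * \<epsilon>) (x - c)))" if "j \<le> n" for j
    proof (rule Hf)
      have "real j * \<epsilon> \<le> real n * \<epsilon>" using that by (intro mult_right_mono) (auto simp: \<epsilon>_def)
      moreover have "0 \<le> real j * \<epsilon>" by (simp add: \<epsilon>_def)
      ultimately show "\<bar>real j * \<epsilon>\<bar> < r0" using n r by (simp add: \<epsilon>_def[symmetric])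
    qed
    have "norm (Complex ((x - c) \<bullet> u) ((x - c) \<bullet> v) / of_real R) \<le> 1"
      using norm_Complex_inner_le[OF uv, of "x - c"] R x by (simp add: norm_divide dist_norm norm_minus_commute)
    then have b1: "norm (b x) \<le> 1" by (simp add: b_def norm_power power_le_one)
    have "norm (\<Sum>j\<le>n. ?w j * (of_real (f (c + ?rot (real j * \<epsilon>) (x - c))) * b x))
       = norm (\<Sum>j\<le>n. ?w j * H (of_real (real j * \<epsilon>))) * norm (b x)"
      unfolding norm_mult[symmetric] sum_distrib_right
      by (intro arg_cong[where f = norm] sum.cong refl) (simp only: Hj atMost_iff mult.assoc)
    also have "\<dots> \<le> norm (\<Sum>j\<le>n. ?w j * H (of_real (real j * \<epsilon>))) * 1"
      by (intro mult_left_mono b1) auto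
    also have "\<dots> \<le> 2 ^ n * (2 * M * (real n * \<epsilon> / r) ^ n)"
      using finite_difference_bound[OF H r, of \<epsilon> n] n by (simp add: \<epsilon>_def)
    finally show "norm (\<Sum>j\<le>n. ?w j * (of_real (f (c + ?rot (real j * \<epsilon>) (x - c))) * b x))
      \<le> 2 ^ n * (2 * M * (real n * \<epsilon> / r) ^ n)" .
  qed simp
  also have "\<dots> = 2 ^ n * (2 * M * measure S (sphere c R) * (real n * \<epsilon> / r) ^ n)"
    by (simp add: S_def)
  finally show ?thesis
    by (simp add: I_def S_def b_def \<epsilon>_def)
qed

text \<open>\<open>n\<close> is the largest order that \<open>beam_integral_bound\<close> admits,
  about l r / (2 pi). The base of the power is then at most 1/2, so the bound decays like 2^(-n);
  rounding down costs the factor 2 between 2 M and 4 M.\<close>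

lemma beam_integral_decay:
  assumes R: "R > 0" and f: "continuous_on (sphere c R) f" and ext: "rotation_extends f c R r0 M"
    and r: "0 < r" "r < r0" and uv: "norm u = 1" "norm v = 1" "u \<bullet> v = 0"
  shows "norm (\<integral>x. of_real (f x) * (Complex ((x - c) \<bullet> u) ((x - c) \<bullet> v) / of_real R) ^ l \<partial>sphere_measure c R)
    \<le> 4 * M * measure (sphere_measure c R) (sphere c R) * (2 powr (- r / (2 * pi))) ^ l"
proof -
  define n where "n = nat \<lfloor>real l * r / (2 * pi)\<rfloor>"
  define x where "x = real n * (pi / real l) / r"
  let ?A = "measure (sphere_measure c R) (sphere c R)"
  have n: "real n \<le> real l * r / (2 * pi)" "real n \<ge> real l * r / (2 * pi) - 1"
    using r by (auto simp: n_def)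
  have x: "0 \<le> x" "x \<le> 1 / 2" using n(1) r
    by (cases "l = 0"; simp add: x_def field_simps; linarith)+
  obtain x0 :: pt where x0: "x0 \<in> sphere c R" using R vector_choose_dist[of R c] by force
  then obtain H :: "complex \<Rightarrow> complex" where "\<forall>z\<in>ball 0 r0. norm (H z) \<le> M"
    using ext uv unfolding rotation_extends_def by blast
  then have "norm (H 0) \<le> M" using r by simp
  then have M: "0 \<le> M" by (rule order_trans[OF norm_ge_zero])
  have "real n * (pi / real l) = r * x" using r by (simp add: x_def)
  also have "\<dots> \<le> r * (1 / 2)" using x r by (intro mult_left_mono) auto
  finally have nl: "real n * (pi / real l) \<le> r / 2" by simp
  have "norm (\<integral>x. of_real (f x) * (Complex ((x - c) \<bullet> u) ((x - c) \<bullet> v) / of_real R) ^ l \<partial>sphere_measure c R)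
    \<le> 2 * M * ?A * x ^ n"
    unfolding x_def by (rule beam_integral_bound[OF R f ext r uv nl]) (simp add: n_def)
  also have "\<dots> \<le> 2 * M * ?A * (2 * (2 powr (- r / (2 * pi))) ^ l)"
  proof (intro mult_left_mono)
    have "x ^ n \<le> (1 / 2) ^ n" using x by (intro power_mono) auto
    also have "\<dots> = 2 powr (- real n)" by (simp add: powr_minus powr_realpow inverse_eq_divide power_divide)
    also have "\<dots> \<le> 2 powr (1 + real l * (- r / (2 * pi)))"
      using n by (intro powr_mono) auto
    also have "\<dots> = 2 * (2 powr (- r / (2 * pi))) ^ l"
      by (subst powr_add) (simp add: powr_power)
    finally show "x ^ n \<le> 2 * (2 powr (- r / (2 * pi))) ^ l" .
  qed (use M in auto)
  finally show ?thesis by (simp add: mult_ac)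
qed

subsection \<open>Complexification of analytic functions on a sphere\<close>

(* The clause about compositions replaces holomorphy of G as a function of three variables. *)
definition local_extension ::
    "(pt \<Rightarrow> real) \<Rightarrow> pt set \<Rightarrow> pt \<Rightarrow> real \<Rightarrow> real \<Rightarrow> (complex \<times> complex \<times> complex \<Rightarrow> complex) \<Rightarrow> bool"
  where "local_extension f S p d M G \<longleftrightarrow> d > 0 \<and>
    (\<forall>x\<in>S. norm (x - p) < d \<longrightarrow>
      G (of_real (x $ 1 - p $ 1), of_real (x $ 2 - p $ 2), of_real (x $ 3 - p $ 3)) = of_real (f x)) \<and>
    (\<forall>y1 y2 y3. norm y1 \<le> d \<and> norm y2 \<le> d \<and> norm y3 \<le> d \<longrightarrow> norm (G (y1, y2, y3)) \<le> M) \<and>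
    (\<forall>U g1 g2 g3. open U \<and> g1 holomorphic_on U \<and> g2 holomorphic_on U \<and> g3 holomorphic_on U \<and>
      (\<forall>z\<in>U. norm (g1 z) \<le> d \<and> norm (g2 z) \<le> d \<and> norm (g3 z) \<le> d) \<longrightarrow>
      (\<lambda>z. G (g1 z, g2 z, g3 z)) holomorphic_on U) \<and>
    continuous (at p within S) f"

lemma local_extension_cong:
  assumes ext: "local_extension F S p d M G" and e: "e > 0" and p: "p \<in> S"
    and eq: "\<And>x. x \<in> S \<Longrightarrow> norm (x - p) < e \<Longrightarrow> F x = f x"
  shows "local_extension f S p (min d e) M G"
  unfolding local_extension_def
proof (intro conjI allI ballI impI)
  show "0 < min d e" using ext e by (simp add: local_extension_def)
  have "continuous (at p within S) F" using ext by (simp add: local_extension_def)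
  then show "continuous (at p within S) f"
    by (rule continuous_transform_within[OF _ e p]) (simp add: eq dist_norm)
next
  fix x assume x: "x \<in> S" "norm (x - p) < min d e"
  have "G (of_real (x $ 1 - p $ 1), of_real (x $ 2 - p $ 2), of_real (x $ 3 - p $ 3)) = of_real (F x)"
    using ext x unfolding local_extension_def by (meson min_less_iff_conj)
  then show "G (of_real (x $ 1 - p $ 1), of_real (x $ 2 - p $ 2), of_real (x $ 3 - p $ 3)) = of_real (f x)"
    using eq x by (metis min_less_iff_conj)
next
  fix y1 y2 y3 :: complex assume "norm y1 \<le> min d e \<and> norm y2 \<le> min d e \<and> norm y3 \<le> min d e"
  then have "norm y1 \<le> d \<and> norm y2 \<le> d \<and> norm y3 \<le> d" by simp
  then show "norm (G (y1, y2, y3)) \<le> M"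
    using ext unfolding local_extension_def by metis
next
  fix U g1 g2 g3
  assume "open U \<and> g1 holomorphic_on U \<and> g2 holomorphic_on U \<and> g3 holomorphic_on U \<and>
    (\<forall>z\<in>U. norm (g1 z) \<le> min d e \<and> norm (g2 z) \<le> min d e \<and> norm (g3 z) \<le> min d e)"
  then have "open U \<and> g1 holomorphic_on U \<and> g2 holomorphic_on U \<and> g3 holomorphic_on U \<and>
    (\<forall>z\<in>U. norm (g1 z) \<le> d \<and> norm (g2 z) \<le> d \<and> norm (g3 z) \<le> d)" by simp
  then show "(\<lambda>z. G (g1 z, g2 z, g3 z)) holomorphic_on U"
    by (rule ext[unfolded local_extension_def, THEN conjunct2, THEN conjunct2, THEN conjunct2,
          THEN conjunct1, rule_format])
qed

text \<open>Unconditional convergence of a real series is absolute, so convergence at one corner of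
  a cube around \<open>p\<close> yields a summable majorant \<open>B\<close> of the complex series
  on the closed polydisc \<open>D\<close>. By the Weierstrass test the series converges uniformly
  there; compositions with holomorphic maps into \<open>D\<close> are thus uniform limits of
  holomorphic functions.\<close>

lemma real_analytic_at_local_extension:
  assumes "real_analytic_at F p"
  shows "\<exists>d M G. local_extension F S p d M G"
proof -
  obtain a e where e: "e > 0" and a: "\<And>x. x \<in> ball p e \<Longrightarrow>
     ((\<lambda>(i, j, k). a i j k * (x $ 1 - p $ 1) ^ i * (x $ 2 - p $ 2) ^ j * (x $ 3 - p $ 3) ^ k) has_sum F x) UNIV"
    using assms unfolding real_analytic_at_def by blast
  \<comment> \<open>The corner of the cube has distance sqrt 3 * \<rho> < 2 * \<rho> = e from
    \<open>p\<close>, so it lies in the ball of convergence.\<close>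
  define \<rho> where "\<rho> = e / 2"
  define B where "B = (\<lambda>(i, j, k). \<bar>a i j k\<bar> * \<rho> ^ i * \<rho> ^ j * \<rho> ^ k)"
  define T where "T = (\<lambda>(i, j, k) (y1, y2, y3). complex_of_real (a i j k) * y1 ^ i * y2 ^ j * y3 ^ k)"
  define G where "G y = (\<Sum>\<^sub>\<infinity>q. T q y)" for y
  define D :: "(complex \<times> complex \<times> complex) set" where "D = {(y1, y2, y3). norm y1 \<le> \<rho> \<and> norm y2 \<le> \<rho> \<and> norm y3 \<le> \<rho>}"
  have \<rho>: "\<rho> > 0" "\<rho> < e" using e by (auto simp: \<rho>_def)
  have B: "B summable_on UNIV"
  proof -
    define x :: pt where "x = p + (\<chi> i. \<rho>)"
    have "norm (x - p) = sqrt 3 * \<rho>"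
      using \<rho> by (simp add: x_def norm_vec_def L2_set_def real_sqrt_mult)
    also have "\<dots> < 2 * \<rho>"
      using \<rho> by (intro mult_strict_right_mono real_less_lsqrt) auto
    finally have "x \<in> ball p e" by (simp add: dist_norm norm_minus_commute \<rho>_def)
    from a[OF this] have "(\<lambda>(i, j, k). a i j k * \<rho> ^ i * \<rho> ^ j * \<rho> ^ k) summable_on UNIV"
      unfolding summable_on_def by (auto simp: x_def)
    then have "(\<lambda>q. norm ((\<lambda>(i, j, k). a i j k * \<rho> ^ i * \<rho> ^ j * \<rho> ^ k) q)) summable_on UNIV"
      by (rule summable_on_iff_abs_summable_on_real[THEN iffD1])
    moreover have "(\<lambda>q. norm ((\<lambda>(i, j, k). a i j k * \<rho> ^ i * \<rho> ^ j * \<rho> ^ k) q)) = B"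
      using \<rho> by (auto simp: B_def fun_eq_iff abs_mult)
    ultimately show ?thesis by simp
  qed
  have TB: "norm (T q y) \<le> B q" if "y \<in> D" for q y
    using that \<rho> unfolding T_def B_def D_def
    by (cases q) (auto simp: norm_mult norm_power intro!: mult_mono power_mono)
  have unif: "uniform_limit D (\<lambda>X y. \<Sum>q\<in>X. T q y) G (finite_subsets_at_top UNIV)"
    unfolding G_def by (rule Weierstrass_m_test_general[OF TB B])
  have Gsum: "((\<lambda>q. T q y) has_sum G y) UNIV" if "y \<in> D" for y
  proof -
    have "(\<lambda>q. norm (T q y)) summable_on UNIV"
      by (rule summable_on_comparison_test[OF B]) (simp_all add: TB that)
    then have "(\<lambda>q. T q y) summable_on UNIV" by (rule abs_summable_summable)
    then show ?thesis unfolding G_def by (rule has_sum_infsum)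
  qed
  have GF: "G (of_real (x $ 1 - p $ 1), of_real (x $ 2 - p $ 2), of_real (x $ 3 - p $ 3)) = of_real (F x)"
    if "norm (x - p) \<le> \<rho>" for x
  proof -
    have "x \<in> ball p e" using that \<rho> by (simp add: dist_norm norm_minus_commute)
    have "((\<lambda>q. complex_of_real ((\<lambda>(i, j, k). a i j k * (x $ 1 - p $ 1) ^ i * (x $ 2 - p $ 2) ^ j * (x $ 3 - p $ 3) ^ k) q))
      has_sum complex_of_real (F x)) UNIV"
      by (rule has_sum_bounded_linear[OF bounded_linear_of_real a[OF \<open>x \<in> ball p e\<close>]])
    then show ?thesis
      unfolding G_def T_def
      by (intro infsumI) (simp add: case_prod_unfold)
  qed
  have GM: "norm (G y) \<le> (\<Sum>\<^sub>\<infinity>q. B q)" if "y \<in> D" for y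
    using norm_infsum_le[OF Gsum[OF that] has_sum_infsum[OF B]] TB[OF that] by auto
  have hol: "(\<lambda>z. G (g1 z, g2 z, g3 z)) holomorphic_on U"
    if U: "open U" and g: "g1 holomorphic_on U" "g2 holomorphic_on U" "g3 holomorphic_on U"
      and bd: "\<And>z. z \<in> U \<Longrightarrow> norm (g1 z) \<le> \<rho> \<and> norm (g2 z) \<le> \<rho> \<and> norm (g3 z) \<le> \<rho>"
    for U g1 g2 g3
  proof -
    have "(\<lambda>z. G (g1 z, g2 z, g3 z)) field_differentiable at z" if z: "z \<in> U" for z
    proof -
      obtain r where r: "r > 0" "cball z r \<subseteq> U" using U z open_contains_cball by blast
      have ul: "uniform_limit (cball z r) (\<lambda>X w. \<Sum>q\<in>X. T q (g1 w, g2 w, g3 w)) (\<lambda>w. G (g1 w, g2 w, g3 w))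
        (finite_subsets_at_top UNIV)"
        by (rule uniform_limit_compose'[OF unif]) (use bd r in \<open>auto simp: D_def\<close>)
      have hT: "(\<lambda>w. \<Sum>q\<in>X. T q (g1 w, g2 w, g3 w)) holomorphic_on U" for X
        unfolding T_def by (auto simp: case_prod_unfold intro!: holomorphic_intros g)
      have ev: "\<forall>\<^sub>F X in finite_subsets_at_top UNIV.
         continuous_on (cball z r) (\<lambda>w. \<Sum>q\<in>X. T q (g1 w, g2 w, g3 w)) \<and>
         (\<lambda>w. \<Sum>q\<in>X. T q (g1 w, g2 w, g3 w)) holomorphic_on ball z r"
        using r by (intro always_eventually allI conjI holomorphic_on_imp_continuous_on
          holomorphic_on_subset[OF hT]) auto
      have "(\<lambda>w. G (g1 w, g2 w, g3 w)) holomorphic_on ball z r"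
        using holomorphic_uniform_limit[OF ev ul] by auto
      then show ?thesis using r by (auto simp: holomorphic_on_open field_differentiable_def)
    qed
    then show ?thesis by (simp add: holomorphic_on_def field_differentiable_at_within)
  qed
  have "continuous_on (cball p \<rho>) (\<lambda>x. G (of_real (x $ 1 - p $ 1), of_real (x $ 2 - p $ 2), of_real (x $ 3 - p $ 3)))"
  proof (rule uniform_limit_theorem)
    show "uniform_limit (cball p \<rho>) (\<lambda>X x. \<Sum>q\<in>X. T q (of_real (x $ 1 - p $ 1), of_real (x $ 2 - p $ 2), of_real (x $ 3 - p $ 3)))
       (\<lambda>x. G (of_real (x $ 1 - p $ 1), of_real (x $ 2 - p $ 2), of_real (x $ 3 - p $ 3))) (finite_subsets_at_top UNIV)"
    proof (rule uniform_limit_compose'[OF unif], rule Pi_I)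
      fix x assume "x \<in> cball p \<rho>"
      then have "norm (x - p) \<le> \<rho>" by (simp add: dist_norm norm_minus_commute)
      moreover have "\<bar>(x - p) $ i\<bar> \<le> norm (x - p)" for i by (rule component_le_norm_cart)
      ultimately have "\<bar>(x - p) $ i\<bar> \<le> \<rho>" for i by (meson order_trans)
      then show "(of_real (x $ 1 - p $ 1), of_real (x $ 2 - p $ 2), of_real (x $ 3 - p $ 3)) \<in> D"
        unfolding D_def by (simp only: mem_Collect_eq case_prod_conv norm_of_real) simp
    qed
    show "\<forall>\<^sub>F X in finite_subsets_at_top UNIV.
      continuous_on (cball p \<rho>) (\<lambda>x. \<Sum>q\<in>X. T q (of_real (x $ 1 - p $ 1), of_real (x $ 2 - p $ 2), of_real (x $ 3 - p $ 3)))"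
      unfolding T_def by (auto simp: case_prod_unfold intro!: always_eventually continuous_intros)
  qed simp
  then have "continuous_on (cball p \<rho>) (\<lambda>x. Re (G (of_real (x $ 1 - p $ 1), of_real (x $ 2 - p $ 2), of_real (x $ 3 - p $ 3))))"
    by (intro continuous_intros)
  then have contF: "continuous_on (cball p \<rho>) F"
    by (rule continuous_on_eq) (simp add: GF dist_norm norm_minus_commute del: of_real_diff)
  have "continuous (at p) F"
    using continuous_on_interior[OF contF, of p] \<rho> by simp
  then have "continuous (at p within S) F" by (rule continuous_at_imp_continuous_at_within)
  then have "local_extension F S p \<rho> (\<Sum>\<^sub>\<infinity>q. B q) G"
    unfolding local_extension_def
    by (intro conjI allI ballI impI \<rho> GF GM hol) (simp_all add: D_def)
  then show ?thesis by blast
qed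

text \<open>Compactness makes the local extensions uniform. Every \<open>x\<close> lies within
  \<open>d p / 4\<close> of one of finitely many centres \<open>p\<close>, and for |z| <
  \<open>r0\<close> the complexified rotation moves each coordinate by less than
  \<open>d0 / 4\<close>. The coordinates relative to \<open>p\<close> thus stay in the polydisc of
  radius \<open>d p\<close>, where the extension at \<open>p\<close> is bounded by
  \<open>M p\<close>.\<close>

lemma analytic_imp_rotation_extends:
  assumes R: "R > 0"
    and an: "\<And>p. p \<in> sphere c R \<Longrightarrow> \<exists>F e. real_analytic_at F p \<and> e > 0 \<and>
      (\<forall>x\<in>sphere c R \<inter> ball p e. F x = f x)"
  shows "continuous_on (sphere c R) f" and "\<exists>r0>0. \<exists>M. rotation_extends f c R r0 M"
proof -
  have "\<exists>d M G. local_extension f (sphere c R) p d M G" if p: "p \<in> sphere c R" for p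
  proof -
    obtain F e where F: "real_analytic_at F p" and e: "e > 0"
      and Ff: "\<And>x. x \<in> sphere c R \<Longrightarrow> x \<in> ball p e \<Longrightarrow> F x = f x"
      using an[OF p] by blast
    obtain d M G where "local_extension F (sphere c R) p d M G"
      using real_analytic_at_local_extension[OF F] by blast
    then have "local_extension f (sphere c R) p (min d e) M G"
      by (rule local_extension_cong[OF _ e p]) (simp add: Ff dist_norm norm_minus_commute)
    then show ?thesis by blast
  qed
  then obtain d M G where P: "\<And>p. p \<in> sphere c R \<Longrightarrow> local_extension f (sphere c R) p (d p) (M p) (G p)" by metis
  have dpos: "d p > 0" if "p \<in> sphere c R" for p using P[OF that] by (simp add: local_extension_def)
  show "continuous_on (sphere c R) f"
    using P by (simp add: continuous_on_eq_continuous_within local_extension_def)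
  have "sphere c R \<subseteq> (\<Union>p\<in>sphere c R. ball p (d p / 4))" using dpos by force
  then obtain C where C: "C \<subseteq> sphere c R" "finite C" and cover: "sphere c R \<subseteq> (\<Union>p\<in>C. ball p (d p / 4))"
    by (rule compactE_image[OF compact_sphere, rotated]) auto
  obtain x0 :: pt where x0: "x0 \<in> sphere c R" using R vector_choose_dist[of R c] by force
  with cover have Cne: "C \<noteq> {}" by blast
  define d0 where "d0 = Min (d ` C)"
  define M0 where "M0 = Max (M ` C)"
  have d0: "d0 > 0" "\<And>p. p \<in> C \<Longrightarrow> d0 \<le> d p" using C Cne dpos by (auto simp: d0_def)
  have M0: "\<And>p. p \<in> C \<Longrightarrow> M p \<le> M0" using C by (auto simp: M0_def)
  \<comment> \<open>The factors \<open>2 * R\<close> bound the vectors \<open>A\<close> and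
    \<open>B\<close> below for all \<open>x\<close>, \<open>u\<close> and \<open>v\<close>, so one
    \<open>r0\<close> serves them all.\<close>
  have "((\<lambda>z::complex. norm (cos z - 1) * (2 * R) + norm (sin z) * (2 * R)) \<longlongrightarrow> norm (cos (0::complex) - 1) * (2 * R) + norm (sin (0::complex)) * (2 * R)) (nhds 0)"
    by (intro tendsto_intros filterlim_ident)
  then have "\<forall>\<^sub>F z::complex in nhds 0. norm (cos z - 1) * (2 * R) + norm (sin z) * (2 * R) < d0 / 4"
    by (rule order_tendstoD(2)) (use d0 in simp)
  then obtain r0 where r0: "r0 > 0"
    and small: "\<And>z::complex. norm z < r0 \<Longrightarrow> norm (cos z - 1) * (2 * R) + norm (sin z) * (2 * R) < d0 / 4"
    unfolding eventually_nhds_metric by auto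
  have "rotation_extends f c R r0 M0"
    unfolding rotation_extends_def
  proof (intro ballI allI impI)
    fix x u v assume x: "x \<in> sphere c R" and "norm u = 1 \<and> norm v = 1 \<and> u \<bullet> (v::pt) = 0"
    then have uv: "norm u = 1" "norm v = 1" "u \<bullet> v = 0" by auto
    obtain p where p: "p \<in> C" "x \<in> ball p (d p / 4)" using cover x by blast
    define A where "A = ((x - c) \<bullet> u) *\<^sub>R u + ((x - c) \<bullet> v) *\<^sub>R v"
    define B where "B = ((x - c) \<bullet> u) *\<^sub>R v - ((x - c) \<bullet> v) *\<^sub>R u"
    \<comment> \<open>Coordinates, relative to \<open>p\<close>, of the rotated point with the real
      angle replaced by \<open>z\<close>.\<close>
    define g where "g j z = of_real ((x - p) $ j) + (cos z - 1) * of_real (A $ j) + sin z * of_real (B $ j)" for j and z :: complex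
    define H where "H z = G p (g 1 z, g 2 z, g 3 z)" for z
    have pS: "p \<in> sphere c R" using p C by blast
    note Pp = P[OF pS, unfolded local_extension_def]
    have in1: "\<bar>(x - c) \<bullet> u\<bar> \<le> R" "\<bar>(x - c) \<bullet> v\<bar> \<le> R"
      using Cauchy_Schwarz_ineq2[of "x - c" u] Cauchy_Schwarz_ineq2[of "x - c" v] x uv
      by (auto simp: dist_norm norm_minus_commute)
    have AB: "norm A \<le> 2 * R" "norm B \<le> 2 * R"
      using in1 uv norm_triangle_ineq[of "((x - c) \<bullet> u) *\<^sub>R u" "((x - c) \<bullet> v) *\<^sub>R v"]
        norm_triangle_ineq4[of "((x - c) \<bullet> u) *\<^sub>R v" "((x - c) \<bullet> v) *\<^sub>R u"]
      by (auto simp: A_def B_def)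
    have xp: "norm (x - p) < d p / 4" using p(2) by (simp add: dist_norm norm_minus_commute)
    have gbound: "norm (g j z) \<le> d p" if z: "norm z < r0" for j z
    proof -
      have "norm (g j z) \<le> norm (of_real ((x - p) $ j) :: complex) + norm ((cos z - 1) * of_real (A $ j)) + norm (sin z * of_real (B $ j))"
        unfolding g_def by (meson norm_triangle_ineq norm_triangle_mono order_refl)
      also have "norm (of_real ((x - p) $ j) :: complex) \<le> norm (x - p)"
        by (simp only: norm_of_real component_le_norm_cart)
      also have "norm ((cos z - 1) * of_real (A $ j)) \<le> norm (cos z - 1) * (2 * R)"
        using order_trans[OF component_le_norm_cart AB(1)] by (simp add: norm_mult mult_left_mono)
      also have "norm (sin z * of_real (B $ j)) \<le> norm (sin z) * (2 * R)"
        using order_trans[OF component_le_norm_cart AB(2)] by (simp add: norm_mult mult_left_mono)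
      finally show ?thesis using small[OF z] xp d0 p(1) by fastforce
    qed
    have ghol: "g j holomorphic_on U" for j U
      unfolding g_def by (intro holomorphic_intros)
    have "H holomorphic_on ball 0 r0"
    proof -
      have "open (ball 0 r0) \<and> g 1 holomorphic_on ball 0 r0 \<and> g 2 holomorphic_on ball 0 r0 \<and> g 3 holomorphic_on ball 0 r0 \<and>
        (\<forall>z\<in>ball 0 r0. norm (g 1 z) \<le> d p \<and> norm (g 2 z) \<le> d p \<and> norm (g 3 z) \<le> d p)"
        using gbound ghol by simp
      moreover note Pp[THEN conjunct2, THEN conjunct2, THEN conjunct2, THEN conjunct1, rule_format,
        of "ball 0 r0" "g 1" "g 2" "g 3"]
      ultimately show ?thesis unfolding H_def by blast
    qed
    moreover have "norm (H z) \<le> M0" if "z \<in> ball 0 r0" for z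
    proof -
      have "norm (g 1 z) \<le> d p \<and> norm (g 2 z) \<le> d p \<and> norm (g 3 z) \<le> d p"
        using gbound that by simp
      then have "norm (H z) \<le> M p"
        unfolding H_def by (rule Pp[THEN conjunct2, THEN conjunct2, THEN conjunct1, rule_format])
      then show ?thesis using M0[OF p(1)] by linarith
    qed
    moreover have "H (of_real \<alpha>) = of_real (f (c + plane_rotation u v \<alpha> (x - c)))" if a: "\<bar>\<alpha>\<bar> < r0" for \<alpha>
    proof -
      define y where "y = c + plane_rotation u v \<alpha> (x - c)"
      have yS: "y \<in> sphere c R"
        using x orthogonal_transformation_norm[OF orthogonal_transformation_plane_rotation[OF uv]]
        by (simp add: y_def dist_norm norm_minus_commute)
      have y: "y - p = (x - p) + (cos \<alpha> - 1) *\<^sub>R A + sin \<alpha> *\<^sub>R B"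
        by (simp add: y_def plane_rotation_def A_def B_def)
      have "norm (y - p) \<le> norm (x - p) + norm ((cos \<alpha> - 1) *\<^sub>R A) + norm (sin \<alpha> *\<^sub>R B)"
        unfolding y by (meson norm_triangle_ineq norm_triangle_mono order_refl)
      also have "\<dots> \<le> norm (x - p) + (\<bar>cos \<alpha> - 1\<bar> * (2 * R) + \<bar>sin \<alpha>\<bar> * (2 * R))"
        using AB by (simp add: mult_left_mono add_mono)
      also have "\<bar>cos \<alpha> - 1\<bar> * (2 * R) + \<bar>sin \<alpha>\<bar> * (2 * R) < d0 / 4"
      proof -
        have "norm (cos (complex_of_real \<alpha>) - 1) = \<bar>cos \<alpha> - 1\<bar>"
          by (metis cos_of_real norm_of_real of_real_1 of_real_diff real_norm_def)
        moreover have "norm (sin (complex_of_real \<alpha>)) = \<bar>sin \<alpha>\<bar>"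
          by (metis sin_of_real norm_of_real real_norm_def)
        ultimately show ?thesis using small[of "of_real \<alpha>"] a by simp
      qed
      finally have "norm (y - p) < d p" using xp d0(1) d0(2)[OF p(1)] norm_ge_zero[of "x - p"] by linarith
      then have "G p (of_real (y $ 1 - p $ 1), of_real (y $ 2 - p $ 2), of_real (y $ 3 - p $ 3)) = of_real (f y)"
        using Pp yS by blast
      moreover have "of_real (y $ j - p $ j) = g j (of_real \<alpha>)" for j
      proof -
        have "y $ j - p $ j = (x - p) $ j + (cos \<alpha> - 1) * A $ j + sin \<alpha> * B $ j"
          using arg_cong[OF y, of "\<lambda>w. w $ j"] by simp
        then show ?thesis
          by (simp only: g_def cos_of_real sin_of_real of_real_add of_real_mult of_real_diff of_real_1)
      qed
      ultimately show ?thesis by (simp add: H_def y_def)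
    qed
    ultimately show "\<exists>H. H holomorphic_on ball 0 r0 \<and> (\<forall>z\<in>ball 0 r0. norm (H z) \<le> M0) \<and>
        (\<forall>\<alpha>. \<bar>\<alpha>\<bar> < r0 \<longrightarrow> H (of_real \<alpha>) = of_real (f (c + plane_rotation u v \<alpha> (x - c))))"
      by blast
  qed
  then show "\<exists>r0>0. \<exists>M. rotation_extends f c R r0 M" using r0 by blast
qed

subsection \<open>A generating function of the spherical harmonics\<close>

lemma higher_pderiv_pcompose_shift:
  "(pderiv ^^ n) (pcompose p [:z, 1:]) = pcompose ((pderiv ^^ n) p) [:z, 1 :: 'a::idom:]"
  by (induction n) (simp_all add: pderiv_pcompose pderiv_pCons)

lemma poly_higher_pderiv_conv_coeff:
  fixes z :: "'a::field_char_0"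
  shows "poly ((pderiv ^^ n) p) z = fact n * coeff (pcompose p [:z, 1:]) n"
proof -
  have "coeff ((pderiv ^^ n) (pcompose p [:z, 1:])) 0 = fact n * coeff (pcompose p [:z, 1:]) n"
    by (simp add: coeff_higher_pderiv pochhammer_fact)
  moreover have "coeff (pcompose q [:z, 1:]) 0 = poly q z" for q by simp
  ultimately show ?thesis by (simp only: higher_pderiv_pcompose_shift)
qed

text \<open>Rodrigues' formula makes this a derivative of order \<open>l + k\<close> of (X^2 - 1)^l
  at \<open>z\<close>, that is (l + k)! times a Taylor coefficient. Shifting X by \<open>z\<close>
  turns the base into X^2 + 2 z X + z^2 - 1.\<close>

lemma poly_higher_pderiv_legendre:
  "poly ((pderiv ^^ k) (legendre l)) z = fact (l + k) / (2 ^ l * fact l) * coeff ([:z\<^sup>2 - 1, 2 * z, 1:] ^ l) (l + k)"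
proof -
  have pow: "pcompose (p ^ n) q = pcompose p q ^ n" for p q :: "real poly" and n
    by (induction n) (simp_all add: pcompose_mult pcompose_1)
  have "pcompose [:-1, 0, 1:] [:z, 1:] = [:z\<^sup>2 - 1, 2 * z, 1:]"
    by (simp add: pcompose_pCons power2_eq_square)
  then have "pcompose ([:-1, 0, 1:] ^ l) [:z, 1:] = [:z\<^sup>2 - 1, 2 * z, 1:] ^ l"
    by (simp only: pow)
  then have "poly ((pderiv ^^ (l + k)) ([:-1, 0, 1:] ^ l)) z = fact (l + k) * coeff ([:z\<^sup>2 - 1, 2 * z, 1:] ^ l) (l + k)"
    by (simp only: poly_higher_pderiv_conv_coeff)
  then show ?thesis
    by (simp add: legendre_def higher_pderiv_smult funpow_add add.commute[of l k])
qed

text \<open>At \<open>t\<close> this is \<open>t\<close> times w_3 + i/2 (W t + cnj W / t). The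
  extra factor makes it a polynomial and shifts the exponents of its power \<open>l\<close> by
  \<open>l\<close>, so the coefficient at \<open>l + k\<close> is the Laurent coefficient of
  t^k.\<close>

definition gen_poly :: "pt \<Rightarrow> complex poly" where
  "gen_poly w = (let W = Complex (w $ 1) (w $ 2) in [:\<i> / 2 * cnj W, of_real (w $ 3), \<i> / 2 * W:])"

lemma coeff_map_poly_of_real_power:
  "coeff (map_poly of_real p ^ l) n = (of_real (coeff (p ^ l) n) :: 'a::{real_algebra_1,idom})"
  by (induction l arbitrary: n) (simp_all add: coeff_mult coeff_map_poly)

text \<open>On the unit sphere |W|^2 = 1 - z^2. Hence inserting X = s t with s = i W into X^2 + 2 z
  X + z^2 - 1 gives 2 s times \<open>gen_poly w\<close> at \<open>t\<close>. Comparing coefficients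
  of the powers \<open>l\<close> and cancelling s^l yields the identity.\<close>

lemma coeff_gen_poly_power:
  assumes "norm w = 1"
  shows "coeff (gen_poly w ^ l) (l + k) =
    (\<i> * Complex (w $ 1) (w $ 2)) ^ k / 2 ^ l * of_real (coeff ([:(w $ 3)\<^sup>2 - 1, 2 * w $ 3, 1:] ^ l) (l + k))"
proof -
  define W where "W = Complex (w $ 1) (w $ 2)"
  define z where "z = w $ 3"
  define s where "s = \<i> * W"
  define R where "R = [:z\<^sup>2 - 1, 2 * z, 1:]"
  have "(w $ 1)\<^sup>2 + (w $ 2)\<^sup>2 + z\<^sup>2 = 1"
    using assms by (simp add: norm_eq_1 inner_vec_def sum_3 power2_eq_square z_def)
  then have Wz: "W * cnj W = of_real (1 - z\<^sup>2)"
    unfolding W_def complex_mult_cnj complex.sel by (intro arg_cong[where f = of_real]) simp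
  have P: "gen_poly w = [:\<i> / 2 * cnj W, of_real z, \<i> / 2 * W:]" by (simp add: gen_poly_def W_def z_def Let_def)
  have coeffR: "complex_of_real (coeff (R ^ l) n) = coeff ([:of_real (z\<^sup>2 - 1), of_real (2 * z), 1:] ^ l) n" for n
  proof -
    have "[:of_real (z\<^sup>2 - 1), of_real (2 * z), 1:] = (map_poly of_real R :: complex poly)"
      by (simp add: R_def map_poly_pCons)
    then show ?thesis
      by (simp add: coeff_map_poly_of_real_power)
  qed
  have "coeff (gen_poly w ^ l) (l + k) = s ^ k / 2 ^ l * of_real (coeff (R ^ l) (l + k))"
  proof (cases "W = 0")
    \<comment> \<open>At the poles of the sphere \<open>s\<close> is 0 and cannot be cancelled.
      There z^2 = 1, the generating polynomial is the monomial z t, and both sides vanish unless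
      \<open>k = 0\<close>.\<close>
    case True
    then have z: "z\<^sup>2 = 1" using Wz by (simp add: complex_eq_iff)
    have "gen_poly w ^ l = monom (of_real z ^ l) l"
      using True unfolding P by (simp add: monom_altdef power_mult_distrib[symmetric] smult_power flip: smult_power)
    moreover have "R ^ l = monom 1 l * [:2 * z, 1:] ^ l"
      by (simp add: R_def z monom_altdef flip: power_mult_distrib)
    ultimately show ?thesis using True
      by (cases "k = 0") (simp_all add: s_def coeff_monom_mult coeff_0_power power_mult_distrib)
  next
    case False
    then have s: "s \<noteq> 0" by (simp add: s_def)
    have "pcompose [:of_real (z\<^sup>2 - 1), of_real (2 * z), 1:] [:0, s:] = smult (2 * s) (gen_poly w)"
      using Wz unfolding P s_def by (simp add: pcompose_pCons algebra_simps power2_eq_square)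
    moreover have pow: "pcompose (p ^ n) q = pcompose p q ^ n" for p q :: "complex poly" and n
      by (induction n) (simp_all add: pcompose_mult pcompose_1)
    ultimately have "pcompose ([:of_real (z\<^sup>2 - 1), of_real (2 * z), 1:] ^ l) [:0, s:] = smult ((2 * s) ^ l) (gen_poly w ^ l)"
      by (simp only: pow smult_power)
    then have "s ^ (l + k) * of_real (coeff (R ^ l) (l + k)) = (2 * s) ^ l * coeff (gen_poly w ^ l) (l + k)"
      unfolding coeffR by (metis coeff_pcompose_linear coeff_smult)
    then show ?thesis using s by (simp add: power_add power_mult_distrib field_simps)
  qed
  then show ?thesis by (simp add: s_def R_def W_def z_def)
qed

text \<open>Real and imaginary parts of the left side are, up to normalization, the harmonics of
  orders \<open>k\<close> and \<open>- k\<close>; one coefficient of the generating polynomial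
  covers both.\<close>

lemma coeff_gen_poly_legendre:
  assumes "norm w = 1"
  shows "Complex (w $ 1) (w $ 2) ^ k * of_real (poly ((pderiv ^^ k) (legendre l)) (w $ 3)) =
    (- \<i>) ^ k * (fact (l + k) / fact l) * coeff (gen_poly w ^ l) (l + k)"
proof -
  have "(- \<i>) ^ k * \<i> ^ k = (1::complex)" by (simp flip: power_mult_distrib)
  then show ?thesis
    unfolding coeff_gen_poly_power[OF assms] poly_higher_pderiv_legendre
    by (simp add: power_mult_distrib field_simps)
qed

lemma norm_coeff_le:
  fixes p :: "complex poly"
  assumes "\<tau> > 0" "\<And>t. norm t = \<tau> \<Longrightarrow> norm (poly p t) \<le> B"
  shows "norm (coeff p n) \<le> B / \<tau> ^ n"
proof -
  have *: "(deriv ^^ n) (poly p) = poly ((pderiv ^^ n) p)" for n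
  proof (induction n)
    case (Suc n)
    then have "(deriv ^^ Suc n) (poly p) = deriv (poly ((pderiv ^^ n) p))" by simp
    also have "\<dots> = poly (pderiv ((pderiv ^^ n) p))" by (intro ext DERIV_imp_deriv poly_DERIV)
    finally show ?case by simp
  qed simp
  have "norm ((deriv ^^ n) (poly p) 0) \<le> fact n * B / \<tau> ^ n"
    by (rule Cauchy_inequality)
      (use assms in \<open>auto intro!: holomorphic_intros continuous_intros simp: norm_minus_commute\<close>)
  also have "(deriv ^^ n) (poly p) 0 = fact n * coeff p n"
    by (simp add: * poly_higher_pderiv_conv_coeff)
  finally have "fact n * norm (coeff p n) \<le> fact n * (B / \<tau> ^ n)" by (simp add: norm_mult)
  then show ?thesis by (subst (asm) mult_le_cancel_left_pos) auto
qed

section \<open>Factorial bounds of Stirling type\<close>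

text \<open>With the next lemma a substitute for Stirling's formula, sharp up to the factor n + 1.
  The induction step is (1 + 1/(n+1))^(n+1) <= e here and (1 - 1/(n+2))^(n+2) <= 1/e there; both
  follow from 1 + x <= exp x.\<close>

lemma power_Suc_le_exp_fact: "(real n + 1) ^ n \<le> exp (real n) * fact n"
proof (induction n)
  case (Suc n)
  have "1 + 1 / (real n + 1) \<le> exp (1 / (real n + 1))" by (rule exp_ge_add_one_self)
  then have "(1 + 1 / (real n + 1)) ^ Suc n \<le> exp (1 / (real n + 1)) ^ Suc n"
    by (intro power_mono) auto
  also have "\<dots> = exp 1" by (subst exp_of_nat_mult[symmetric]) simp
  finally have *: "(1 + 1 / (real n + 1)) ^ Suc n \<le> exp 1" .
  have "(real (Suc n) + 1) ^ Suc n = ((real n + 1) * (1 + 1 / (real n + 1))) ^ Suc n"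
    by (intro arg_cong[where f = "\<lambda>x. x ^ Suc n"]) (simp add: field_simps)
  also have "\<dots> = (real n + 1) * (real n + 1) ^ n * (1 + 1 / (real n + 1)) ^ Suc n"
    by (simp only: power_mult_distrib power_Suc mult_ac)
  also have "\<dots> \<le> (real n + 1) * (exp (real n) * fact n) * exp 1"
    by (intro mult_mono Suc.IH * ) auto
  also have "\<dots> = exp (real (Suc n)) * fact (Suc n)"
    by (simp add: exp_add algebra_simps)
  finally show ?case .
qed simp

lemma exp_fact_le_power_Suc: "exp (real n) * fact n \<le> (real n + 1) ^ Suc n"
proof (induction n)
  case (Suc n)
  have "1 + - (1 / (real n + 2)) \<le> exp (- (1 / (real n + 2)))" by (rule exp_ge_add_one_self)
  then have "((real n + 1) / (real n + 2)) ^ (n + 2) \<le> exp (- (1 / (real n + 2))) ^ (n + 2)"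
    by (intro power_mono) (auto simp: field_simps)
  also have "\<dots> = inverse (exp 1)" by (subst exp_of_nat_mult[symmetric]) (simp add: field_simps exp_minus)
  finally have "(real n + 1) ^ (n + 2) \<le> inverse (exp 1) * (real n + 2) ^ (n + 2)"
    by (simp only: power_divide) (subst (asm) pos_divide_le_eq, auto)
  then have "exp 1 * (real n + 1) ^ (n + 2) \<le> exp 1 * (inverse (exp 1) * (real n + 2) ^ (n + 2))"
    by (intro mult_left_mono) auto
  also have "\<dots> = (real n + 2) ^ (n + 2)" by (simp only: mult.assoc[symmetric]) simp
  finally have *: "exp 1 * (real n + 1) ^ (n + 2) \<le> (real n + 2) ^ (n + 2)" .
  have "exp (real (Suc n)) * fact (Suc n) = exp 1 * (real n + 1) * (exp (real n) * fact n)"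
    by (simp add: exp_add algebra_simps)
  also have "\<dots> \<le> exp 1 * (real n + 1) * (real n + 1) ^ Suc n"
    by (intro mult_left_mono Suc.IH) auto
  also have "\<dots> = exp 1 * (real n + 1) ^ (n + 2)" by simp
  also note *
  finally show ?case by (simp add: algebra_simps)
qed simp

text \<open>For a = l + k and b = l - k this compares the normalization of the harmonics with the
  bound from Cauchy's estimate. The exponentials in the Stirling bounds cancel because (a + b) / 2 =
  l, and the remaining sqrt ((a + 1) (b + 1)) is at most l + 1 by the inequality of the
  means.\<close>

lemma sqrt_fact_mult_le:
  assumes "a + b = 2 * l"
  shows "sqrt (fact a) * sqrt (fact b) * (real l + 1) ^ l
    \<le> fact l * (real l + 1) * (sqrt (real a + 1) ^ a * sqrt (real b + 1) ^ b)"
proof -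
  have s: "sqrt (fact n) \<le> sqrt (real n + 1) ^ n * sqrt (real n + 1) * exp (- real n / 2)" for n
  proof -
    have "fact n = exp (real n) * fact n * exp (- real n / 2) ^ 2"
      by (simp flip: exp_add exp_double add: exp_minus field_simps)
    also have "\<dots> \<le> (real n + 1) ^ Suc n * exp (- real n / 2) ^ 2"
      by (intro mult_right_mono exp_fact_le_power_Suc) auto
    finally have "sqrt (fact n) \<le> sqrt ((real n + 1) ^ Suc n * exp (- real n / 2) ^ 2)"
      by (rule real_sqrt_le_mono)
    then show ?thesis by (simp add: real_sqrt_mult real_sqrt_power mult_ac)
  qed
  let ?A = "sqrt (real a + 1)" and ?B = "sqrt (real b + 1)"
  have AB: "?A * ?B \<le> real l + 1"
    using arith_geo_mean_sqrt[of "real a + 1" "real b + 1"] assms by (simp add: real_sqrt_mult)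
  have "sqrt (fact a) * sqrt (fact b) \<le> (?A ^ a * ?A * exp (- real a / 2)) * (?B ^ b * ?B * exp (- real b / 2))"
    by (intro mult_mono s) auto
  also have "\<dots> = (?A * ?B) * (?A ^ a * ?B ^ b) * (exp (- real a / 2) * exp (- real b / 2))" by (simp add: mult_ac)
  also have "exp (- real a / 2) * exp (- real b / 2) = exp (- real l)"
    using assms by (simp flip: exp_add add: field_simps)
  also have "(?A * ?B) * (?A ^ a * ?B ^ b) * exp (- real l) \<le> (real l + 1) * (?A ^ a * ?B ^ b) * exp (- real l)"
    by (intro mult_right_mono AB) auto
  finally have "sqrt (fact a) * sqrt (fact b) \<le> (real l + 1) * (?A ^ a * ?B ^ b) * exp (- real l)" .
  from mult_mono[OF this power_Suc_le_exp_fact[of l]]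
  have "sqrt (fact a) * sqrt (fact b) * (real l + 1) ^ l
    \<le> (real l + 1) * (?A ^ a * ?B ^ b) * exp (- real l) * (exp (real l) * fact l)"
    by simp
  also have "\<dots> = (exp (- real l) * exp (real l)) * (fact l * (real l + 1) * (?A ^ a * ?B ^ b))"
    by (simp only: mult_ac)
  also have "exp (- real l) * exp (real l) = 1" by (simp flip: exp_add)
  finally show ?thesis by simp
qed

lemma continuous_on_coeff_power:
  fixes p :: "'a::topological_space \<Rightarrow> complex poly"
  assumes "\<And>n. continuous_on S (\<lambda>x. coeff (p x) n)"
  shows "continuous_on S (\<lambda>x. coeff (p x ^ l) n)"
proof (induction l arbitrary: n)
  case (Suc l)
  then show ?case by (simp add: coeff_mult) (intro continuous_intros assms)
qed (simp add: continuous_on_const)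

text \<open>The form w_3 + i/2 (W t + cnj W / t) is isotropic: the squares of its three complex
  coefficients sum to 0. So the real and imaginary parts of the coefficient vector are orthogonal
  and of equal length \<rho> = (\<tau> + 1/\<tau>) / 2; \<open>u\<close> and \<open>v\<close> are
  these parts divided by \<rho>.\<close>

lemma poly_gen_poly:
  assumes "\<tau> > 0"
  obtains u v :: pt where "norm u = 1" "norm v = 1" "u \<bullet> v = 0"
    "\<And>w. poly (gen_poly w) (rcis \<tau> \<theta>) =
      rcis \<tau> \<theta> * of_real ((\<tau> + 1 / \<tau>) / 2) * Complex (w \<bullet> u) (w \<bullet> v)"
proof -
  define \<rho> where "\<rho> = (\<tau> + 1 / \<tau>) / 2"
  define \<sigma> where "\<sigma> = (\<tau> - 1 / \<tau>) / 2"
  define u :: pt where "u = vector [- \<sigma> * sin \<theta> / \<rho>, - \<sigma> * cos \<theta> / \<rho>, 1 / \<rho>]"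
  define v :: pt where "v = vector [cos \<theta>, - sin \<theta>, 0]"
  have \<rho>: "\<rho> > 0" using assms by (simp add: \<rho>_def add_pos_pos)
  have sc: "sin \<theta> * sin \<theta> + cos \<theta> * cos \<theta> = 1"
    by (metis power2_eq_square sin_cos_squared_add)
  have \<rho>\<sigma>: "\<rho> * \<rho> = 1 + \<sigma> * \<sigma>"
    using assms by (simp add: \<rho>_def \<sigma>_def field_simps)
  have "u \<bullet> u = (\<sigma> * \<sigma> * (sin \<theta> * sin \<theta> + cos \<theta> * cos \<theta>) + 1) / (\<rho> * \<rho>)"
    unfolding distrib_left add_divide_distrib by (simp add: u_def inner_vec_def sum_3 vector_3 mult_ac)
  also have "\<sigma> * \<sigma> * (sin \<theta> * sin \<theta> + cos \<theta> * cos \<theta>) + 1 = \<rho> * \<rho>" by (simp add: sc \<rho>\<sigma>)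
  finally have "norm u = 1" using \<rho> by (simp add: norm_eq_1)
  moreover have "norm v = 1"
    using sc by (simp add: v_def norm_eq_1 inner_vec_def sum_3 vector_3)
  moreover have "u \<bullet> v = 0"
    using \<rho> by (simp add: u_def v_def inner_vec_def sum_3 vector_3 field_simps)
  moreover have "poly (gen_poly w) (rcis \<tau> \<theta>) =
      rcis \<tau> \<theta> * of_real ((\<tau> + 1 / \<tau>) / 2) * Complex (w \<bullet> u) (w \<bullet> v)" for w
  proof -
    define W where "W = Complex (w $ 1) (w $ 2)"
    define t where "t = rcis \<tau> \<theta>"
    define t' where "t' = rcis (1 / \<tau>) (- \<theta>)"
    have tt: "t' * t = 1" using assms by (simp add: t_def t'_def rcis_mult)
    have "poly (gen_poly w) t = \<i> / 2 * cnj W * (t' * t) + of_real (w $ 3) * t + \<i> / 2 * W * t * t"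
      unfolding tt by (simp add: gen_poly_def W_def Let_def algebra_simps)
    also have "\<dots> = t * (of_real (w $ 3) + \<i> / 2 * (W * t + cnj W * t'))"
      by (simp add: algebra_simps)
    also have "of_real (w $ 3) + \<i> / 2 * (W * t + cnj W * t') = of_real \<rho> * Complex (w \<bullet> u) (w \<bullet> v)"
      using \<rho> assms by (simp add: complex_eq_iff t_def t'_def W_def u_def v_def inner_vec_def sum_3 vector_3
          \<rho>_def[symmetric] \<sigma>_def[symmetric] algebra_simps) (simp add: \<rho>_def \<sigma>_def field_simps)
    finally show ?thesis by (simp add: t_def \<rho>_def mult.assoc)
  qed
  ultimately show thesis by (rule that)
qed

lemma continuous_on_coeff_gen_poly:
  assumes "continuous_on S g"
  shows "continuous_on S (\<lambda>x. coeff (gen_poly (g x) ^ l) n)"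
proof (rule continuous_on_coeff_power)
  fix n
  have W: "Complex a b = of_real a + \<i> * of_real b" for a b by (simp add: complex_eq_iff)
  consider "n = 0" | "n = 1" | "n = 2" | m where "n = Suc (Suc (Suc m))"
    by (metis One_nat_def Suc_1 old.nat.exhaust)
  then show "continuous_on S (\<lambda>x. coeff (gen_poly (g x)) n)"
    by cases (simp_all add: gen_poly_def Let_def W numeral_2_eq_2 continuous_intros assms)
qed

text \<open>Integrating coefficientwise gives a polynomial \<open>Q\<close> whose value at
  \<open>t\<close> is the integral of \<open>f\<close> against a multiple of a beam, hence is
  controlled by \<open>K\<close>. Cauchy's estimate on |t| = \<tau> bounds its coefficients;
  \<tau>^l from the multiple cancels against part of \<tau>^(l + k).\<close>

lemma coeff_gen_poly_integral_bound:
  assumes R: "R > 0" and f: "continuous_on (sphere c R) f"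
    and K: "\<And>u v. norm u = 1 \<Longrightarrow> norm v = 1 \<Longrightarrow> u \<bullet> v = 0 \<Longrightarrow>
      norm (\<integral>x. of_real (f x) * (Complex ((x - c) \<bullet> u) ((x - c) \<bullet> v) / of_real R) ^ l \<partial>sphere_measure c R) \<le> K"
    and \<tau>: "\<tau> > 0"
  shows "norm (\<integral>x. of_real (f x) * coeff (gen_poly ((x - c) /\<^sub>R R) ^ l) (l + k) \<partial>sphere_measure c R)
    \<le> ((\<tau> + 1 / \<tau>) / 2) ^ l * K / \<tau> ^ k"
proof -
  let ?S = "sphere_measure c R" and ?\<rho> = "(\<tau> + 1 / \<tau>) / 2"
  define P where "P x = gen_poly ((x - c) /\<^sub>R R)" for x
  define C where "C n = (\<integral>x. of_real (f x) * coeff (P x ^ l) n \<partial>?S)" for n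
  define Q where "Q = (\<Sum>n\<le>2 * l. monom (C n) n)"
  have int: "integrable ?S (\<lambda>x. of_real (f x) * coeff (P x ^ l) n)" for n
    unfolding P_def
    by (intro integrable_sphere_measure R continuous_intros f continuous_on_coeff_gen_poly)
  have degP: "degree (P x ^ l) \<le> 2 * l" for x
  proof -
    have "degree (P x) \<le> 2"
      unfolding P_def gen_poly_def Let_def by (simp add: degree_pCons_le le_SucI)
    then show ?thesis using degree_power_le[of "P x" l] by (meson mult_le_mono1 order_trans)
  qed
  have C0: "C n = 0" if "n > 2 * l" for n
  proof -
    have "coeff (P x ^ l) n = 0" for x using degP[of x] that by (intro coeff_eq_0) linarith
    then show ?thesis by (simp add: C_def)
  qed
  have coeffQ: "coeff Q n = C n" for n
    using C0[of n] by (auto simp: Q_def coeff_sum coeff_monom)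
  have polyQ: "poly Q t = (\<integral>x. of_real (f x) * poly (P x) t ^ l \<partial>?S)" for t
  proof -
    have "poly Q t = (\<Sum>n\<le>2 * l. (\<integral>x. of_real (f x) * coeff (P x ^ l) n * t ^ n \<partial>?S))"
      unfolding Q_def poly_sum poly_monom C_def by (intro sum.cong refl) simp
    also have "\<dots> = (\<integral>x. (\<Sum>n\<le>2 * l. of_real (f x) * coeff (P x ^ l) n * t ^ n) \<partial>?S)"
      by (rule Bochner_Integration.integral_sum[symmetric]) (intro integrable_mult_left int)
    also have "\<dots> = (\<integral>x. of_real (f x) * poly (P x) t ^ l \<partial>?S)"
    proof (intro Bochner_Integration.integral_cong refl)
      fix x
      have "poly (P x ^ l) t = (\<Sum>n\<le>2 * l. coeff (P x ^ l) n * t ^ n)"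
        unfolding poly_altdef using degP[of x]
        by (intro sum.mono_neutral_left) (auto simp: coeff_eq_0)
      then show "(\<Sum>n\<le>2 * l. of_real (f x) * coeff (P x ^ l) n * t ^ n) = of_real (f x) * poly (P x) t ^ l"
        by (simp add: sum_distrib_left mult.assoc)
    qed
    finally show ?thesis .
  qed
  have "norm (poly Q t) \<le> \<tau> ^ l * ?\<rho> ^ l * K" if t: "norm t = \<tau>" for t
  proof -
    have t': "t = rcis \<tau> (Arg t)" using t by (metis rcis_cmod_Arg)
    obtain u v where uv: "norm u = 1" "norm v = 1" "u \<bullet> v = 0"
      and Puv: "\<And>w. poly (gen_poly w) (rcis \<tau> (Arg t)) = rcis \<tau> (Arg t) * of_real ?\<rho> * Complex (w \<bullet> u) (w \<bullet> v)"
      using poly_gen_poly[OF \<tau>, of "Arg t"] by blast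
    have "poly (P x) t = t * of_real ?\<rho> * (Complex ((x - c) \<bullet> u) ((x - c) \<bullet> v) / of_real R)" for x
    proof -
      have "Complex (((x - c) /\<^sub>R R) \<bullet> u) (((x - c) /\<^sub>R R) \<bullet> v) = Complex ((x - c) \<bullet> u) ((x - c) \<bullet> v) / of_real R"
        using R by (simp add: complex_eq_iff Re_divide_of_real Im_divide_of_real divide_inverse power2_eq_square)
      then show ?thesis using Puv[of "(x - c) /\<^sub>R R"] t' by (simp add: P_def)
    qed
    then have "poly Q t = (\<integral>x. (t * of_real ?\<rho>) ^ l * (of_real (f x) * (Complex ((x - c) \<bullet> u) ((x - c) \<bullet> v) / of_real R) ^ l) \<partial>?S)"
      unfolding polyQ by (intro Bochner_Integration.integral_cong refl) (simp only: power_mult_distrib mult_ac)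
    also have "\<dots> = (t * of_real ?\<rho>) ^ l * (\<integral>x. of_real (f x) * (Complex ((x - c) \<bullet> u) ((x - c) \<bullet> v) / of_real R) ^ l \<partial>?S)"
      by simp
    also have "norm \<dots> \<le> (\<tau> * ?\<rho>) ^ l * K"
    proof -
      have "norm (t * of_real ?\<rho>) = \<tau> * ?\<rho>" using t \<tau> by (simp only: norm_mult norm_of_real) (simp add: add_pos_pos)
      then show ?thesis
        unfolding norm_mult[of "_ ^ _"] norm_power using K[OF uv] \<tau> by (simp add: mult_left_mono add_nonneg_nonneg)
    qed
    finally show ?thesis by (simp only: power_mult_distrib)
  qed
  then have "norm (coeff Q (l + k)) \<le> \<tau> ^ l * ?\<rho> ^ l * K / \<tau> ^ (l + k)"
    by (rule norm_coeff_le[OF \<tau>])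
  also have "\<dots> = ?\<rho> ^ l * K / \<tau> ^ k" using \<tau> by (simp add: power_add)
  finally show ?thesis by (simp add: coeffQ C_def P_def)
qed

subsection \<open>Exponential decay of the coefficients\<close>

lemma Ylm_conv:
  assumes "k = nat \<bar>m\<bar>"
  shows "Ylm l m w = sqrt (real (2 * l + 1) / (4 * pi) * (fact (l - k) / fact (l + k))) *
    (let z = Complex (w $ 1) (w $ 2) ^ k * of_real (poly ((pderiv ^^ k) (legendre l)) (w $ 3))
     in if m = 0 then Re z else if m > 0 then sqrt 2 * Re z else sqrt 2 * Im z)"
proof (cases "m = 0")
  case True
  then show ?thesis using assms by (simp add: Ylm_def)
next
  case False
  then show ?thesis unfolding Ylm_def Let_def assms[symmetric] by simp
qed

text \<open>Minimizing ((\<tau> + 1/\<tau>) / 2)^l / \<tau>^k leads to \<tau>^2 = (l + k) / (l - k);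
  adding 1 to numerator and denominator keeps it finite at k = l. The bound becomes (l + 1)^l / (A^a
  B^b), which cancels sqrt (a! b!) / l! from the normalization up to a factor l + 1. The circle |t|
  = 1 would leave that quotient, which for k = l grows like 2^l up to powers of l.\<close>

lemma Ylm_integral_bound:
  assumes R: "R > 0" and f: "continuous_on (sphere c R) f" and m: "\<bar>m\<bar> \<le> int l"
    and K: "\<And>u v. norm u = 1 \<Longrightarrow> norm v = 1 \<Longrightarrow> u \<bullet> v = 0 \<Longrightarrow>
      norm (\<integral>x. of_real (f x) * (Complex ((x - c) \<bullet> u) ((x - c) \<bullet> v) / of_real R) ^ l \<partial>sphere_measure c R) \<le> K"
  shows "\<bar>\<integral>x. f x * Ylm l m ((x - c) /\<^sub>R R) \<partial>sphere_measure c R\<bar> \<le> 4 * (real l + 1)\<^sup>2 * K"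
proof -
  let ?S = "sphere_measure c R"
  define k where "k = nat \<bar>m\<bar>"
  define a where "a = l + k"
  define b where "b = l - k"
  define N where "N = sqrt (real (2 * l + 1) / (4 * pi) * (fact b / fact a))"
  define w where "w x = (x - c) /\<^sub>R R" for x
  define h where "h x = Complex (w x $ 1) (w x $ 2) ^ k * of_real (poly ((pderiv ^^ k) (legendre l)) (w x $ 3))" for x
  define E where "E = (\<integral>x. of_real (f x) * h x \<partial>?S)"
  define D where "D = (\<integral>x. of_real (f x) * coeff (gen_poly (w x) ^ l) a \<partial>?S)"
  define A where "A = sqrt (real a + 1)"
  define B where "B = sqrt (real b + 1)"
  have kl: "k \<le> l" using m by (simp add: k_def)
  then have ab: "a + b = 2 * l" by (simp add: a_def b_def)
  have AB: "A > 0" "B > 0" "A * A = real a + 1" "B * B = real b + 1" by (auto simp: A_def B_def)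
  have contw: "continuous_on S w" for S unfolding w_def by (intro continuous_intros)
  have intE: "integrable ?S (\<lambda>x. of_real (f x) * h x)"
    unfolding h_def Complex_eq
    by (intro integrable_sphere_measure R continuous_intros f contw)
  have wS: "norm (w x) = 1" if "x \<in> sphere c R" for x
    using that R by (simp add: w_def dist_norm norm_minus_commute)
  have hD: "E = (- \<i>) ^ k * (fact a / fact l) * D"
  proof -
    have "E = (\<integral>x. ((- \<i>) ^ k * (fact a / fact l)) * (of_real (f x) * coeff (gen_poly (w x) ^ l) a) \<partial>?S)"
      unfolding E_def h_def
      by (intro Bochner_Integration.integral_cong refl)
        (simp add: coeff_gen_poly_legendre[OF wS] a_def)
    then show ?thesis unfolding D_def by simp
  qed
  have Dbound: "norm D \<le> (real l + 1) ^ l / (A ^ a * B ^ b) * K"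
  proof -
    have "norm D \<le> ((A / B + 1 / (A / B)) / 2) ^ l * K / (A / B) ^ k"
      unfolding D_def w_def a_def
      by (rule coeff_gen_poly_integral_bound[OF R f K]) (use AB in auto)
    also have "(A / B + 1 / (A / B)) / 2 = (A * A + B * B) / (2 * (A * B))"
      using AB by (simp add: field_simps)
    also have "A * A + B * B = 2 * (real l + 1)" using arg_cong[OF ab, of real] AB(3,4) by simp
    also have "2 * (real l + 1) / (2 * (A * B)) = (real l + 1) / (A * B)"
      by (rule mult_divide_mult_cancel_left) simp
    also have "((real l + 1) / (A * B)) ^ l * K / (A / B) ^ k = (real l + 1) ^ l * K * B ^ k / (A ^ (l + k) * B ^ l)"
      using AB by (simp add: power_divide power_mult_distrib power_add)
    also have "B ^ l = B ^ k * B ^ b" using kl by (simp add: b_def flip: power_add)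
    finally show ?thesis using AB by (simp add: a_def)
  qed
  have "\<bar>\<integral>x. f x * Ylm l m (w x) \<partial>?S\<bar> \<le> 2 * N * norm E"
  proof -
    have re: "(\<integral>x. f x * Re (h x) \<partial>?S) = Re E" and im: "(\<integral>x. f x * Im (h x) \<partial>?S) = Im E"
      using integral_Re[OF intE] integral_Im[OF intE] by (simp_all add: E_def)
    have N: "N \<ge> 0" by (simp add: N_def)
    have "(\<integral>x. f x * Ylm l m (w x) \<partial>?S) = (\<integral>x. N * (if m = 0 then 1 else sqrt 2) * (f x * (if m \<ge> 0 then Re (h x) else Im (h x))) \<partial>?S)"
      by (intro Bochner_Integration.integral_cong refl)
        (auto simp: Ylm_conv[OF k_def] N_def a_def b_def h_def Let_def)
    also have "\<dots> = N * (if m = 0 then 1 else sqrt 2) * (\<integral>x. f x * (if m \<ge> 0 then Re (h x) else Im (h x)) \<partial>?S)"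
      by simp
    also have "(\<integral>x. f x * (if m \<ge> 0 then Re (h x) else Im (h x)) \<partial>?S) = (if m \<ge> 0 then Re E else Im E)"
      using re im by simp
    also have "\<bar>N * (if m = 0 then 1 else sqrt 2) * (if m \<ge> 0 then Re E else Im E)\<bar> \<le> N * 2 * norm E"
      unfolding abs_mult using N abs_Re_le_cmod[of E] abs_Im_le_cmod[of E] sqrt2_less_2
      by (intro mult_mono) auto
    finally show ?thesis by (simp add: mult_ac)
  qed
  also have "norm E = fact a / fact l * norm D"
    by (simp add: hD norm_mult norm_power norm_divide)
  also have "2 * N * (fact a / fact l * norm D) \<le> 2 * N * (fact a / fact l * ((real l + 1) ^ l / (A ^ a * B ^ b) * K))"
    by (intro mult_left_mono Dbound) (auto simp: N_def)
  also have "\<dots> = 2 * sqrt (real (2 * l + 1) / (4 * pi)) *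
      (sqrt (fact a) * sqrt (fact b) * (real l + 1) ^ l / (fact l * (A ^ a * B ^ b))) * K"
  proof -
    define X where "X = real (2 * l + 1) / (4 * pi)"
    have NX: "N = sqrt X * (sqrt (fact b) / sqrt (fact a))"
      by (simp only: N_def X_def[symmetric] real_sqrt_mult real_sqrt_divide)
    have "N * (sqrt (fact a) * sqrt (fact a)) = sqrt X * (sqrt (fact a) * sqrt (fact b))"
    proof -
      have "x * (y / s) * (s * s) = x * (s * y)" if "s \<noteq> 0" for x y s :: real using that by simp
      then show ?thesis unfolding NX by (metis fact_nonzero real_sqrt_eq_zero_cancel_iff)
    qed
    moreover have "sqrt (fact a) * sqrt (fact a) = fact a" by simp
    ultimately have "N * fact a = sqrt (real (2 * l + 1) / (4 * pi)) * (sqrt (fact a) * sqrt (fact b))"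
      by (simp only: X_def)
    then have "2 * (N * fact a) / fact l * ((real l + 1) ^ l / (A ^ a * B ^ b) * K) =
      2 * (sqrt (real (2 * l + 1) / (4 * pi)) * (sqrt (fact a) * sqrt (fact b))) / fact l * ((real l + 1) ^ l / (A ^ a * B ^ b) * K)"
      by simp
    then show ?thesis by (simp add: mult_ac)
  qed
  also have "\<dots> \<le> 2 * (2 * (real l + 1)) * (real l + 1) * K"
  proof -
    have K0: "K \<ge> 0"
      using order_trans[OF norm_ge_zero K[of "axis 1 1" "axis 2 1"]] by (simp add: inner_axis_axis)
    have "real (2 * l + 1) / (4 * pi) \<le> real (2 * l + 1) / 1"
      using pi_gt3 by (intro divide_left_mono) auto
    also have "\<dots> \<le> (2 * (real l + 1))\<^sup>2" by (simp add: power2_eq_square algebra_simps)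
    finally have "sqrt (real (2 * l + 1) / (4 * pi)) \<le> 2 * (real l + 1)"
      by (intro real_le_lsqrt) auto
    moreover have "sqrt (fact a) * sqrt (fact b) * (real l + 1) ^ l / (fact l * (A ^ a * B ^ b)) \<le> real l + 1"
      using sqrt_fact_mult_le[OF ab] AB by (simp add: A_def B_def divide_le_eq mult_ac)
    ultimately show ?thesis using K0
      by (intro mult_right_mono mult_mono) (auto simp: A_def B_def)
  qed
  also have "\<dots> = 4 * (real l + 1)\<^sup>2 * K" by (simp add: power2_eq_square)
  finally show ?thesis by (simp add: w_def)
qed

lemma analytic_Ylm_integral_decay:
  assumes R: "R > 0"
    and an: "\<And>p. p \<in> sphere c R \<Longrightarrow> \<exists>F e. real_analytic_at F p \<and> e > 0 \<and>
      (\<forall>x\<in>sphere c R \<inter> ball p e. F x = f x)"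
  shows "\<exists>K q. 0 < q \<and> q < 1 \<and>
    (\<forall>l m. \<bar>m\<bar> \<le> int l \<longrightarrow> \<bar>\<integral>x. f x * Ylm l m ((x - c) /\<^sub>R R) \<partial>sphere_measure c R\<bar> \<le> K * q ^ l)"
proof -
  have f: "continuous_on (sphere c R) f" using analytic_imp_rotation_extends(1)[OF R an] .
  obtain r0 M where r0: "r0 > 0" and ext: "rotation_extends f c R r0 M"
    using analytic_imp_rotation_extends(2)[OF R an] by blast
  \<comment> \<open>Beams decay like \<open>p ^ 4\<close> per degree when \<open>r = r0 / 2\<close>.
    Half of this absorbs the factor (l + 1)^2, and the rate p^2 remains.\<close>
  define p :: real where "p = 2 powr (- r0 / (16 * pi))"
  define K where "K = 4 * M * measure (sphere_measure c R) (sphere c R)"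
  have p: "0 < p" "p < 1" using r0 by (auto simp: p_def powr_less_one)
  have p4: "2 powr (- (r0 / 2) / (2 * pi)) = p ^ 4"
    by (simp add: p_def powr_power)
  have "(\<lambda>n. real n * p ^ n) \<longlonglongrightarrow> 0" using powser_times_n_limit_0[of p] p by simp
  then have "Bseq (\<lambda>n. real n * p ^ n)" by (intro convergent_imp_Bseq convergentI)
  then obtain B where B: "B > 0" "\<And>n. norm (real n * p ^ n) \<le> B" by (auto elim: BseqE)
  have "\<bar>\<integral>x. f x * Ylm l m ((x - c) /\<^sub>R R) \<partial>sphere_measure c R\<bar> \<le> 4 * (B + 1)\<^sup>2 * K * (p\<^sup>2) ^ l"
    if m: "\<bar>m\<bar> \<le> int l" for l m
  proof -
    have Kl: "norm (\<integral>x. of_real (f x) * (Complex ((x - c) \<bullet> u) ((x - c) \<bullet> v) / of_real R) ^ l \<partial>sphere_measure c R) \<le> K * (p ^ 4) ^ l"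
      if "norm u = 1" "norm v = 1" "u \<bullet> v = 0" for u v
      using beam_integral_decay[OF R f ext _ _ that, of "r0 / 2" l] r0 by (simp only: p4 K_def)
    have K0: "K * (p ^ 4) ^ l \<ge> 0"
      using order_trans[OF norm_ge_zero Kl[of "axis 1 1" "axis 2 1"]] by (simp add: inner_axis_axis)
    moreover have "(p ^ 4) ^ l > 0" using p by simp
    ultimately have K: "K \<ge> 0" by (simp add: zero_le_mult_iff)
    have "(real l + 1) * p ^ l \<le> B + 1"
      using B(2)[of l] p power_le_one[of p l] by (simp add: algebra_simps)
    then have "((real l + 1) * p ^ l)\<^sup>2 \<le> (B + 1)\<^sup>2" using p by (intro power_mono) auto
    then have *: "4 * K * (p\<^sup>2) ^ l * ((real l + 1) * p ^ l)\<^sup>2 \<le> 4 * K * (p\<^sup>2) ^ l * (B + 1)\<^sup>2"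
      using K by (intro mult_left_mono) auto
    have "\<bar>\<integral>x. f x * Ylm l m ((x - c) /\<^sub>R R) \<partial>sphere_measure c R\<bar> \<le> 4 * (real l + 1)\<^sup>2 * (K * (p ^ 4) ^ l)"
      by (rule Ylm_integral_bound[OF R f m Kl])
    also have "\<dots> = 4 * K * (p\<^sup>2) ^ l * ((real l + 1) * p ^ l)\<^sup>2"
      by (simp add: power_mult_distrib mult_ac flip: power_mult power_add)
    also note *
    finally show ?thesis by (simp add: mult_ac)
  qed
  moreover have "0 < p\<^sup>2" "p\<^sup>2 < 1" using p by (auto simp: power_less_one_iff)
  ultimately show ?thesis by blast
qed

subsection \<open>Sobolev norms of analytic functions\<close>

lemma sph_disjoint:
  assumes G: "admissible_geometry G" and ij: "i < nsph G" "j < nsph G" "i \<noteq> j"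
  shows "sph G i \<inter> sph G j = {}"
proof -
  let ?D = "{dist (ctr G i) (ctr G j) - rad G i - rad G j | i j. i < nsph G \<and> j < nsph G \<and> i \<noteq> j}"
  have n: "nsph G \<ge> 2" using ij by linarith
  have "?D \<subseteq> (\<lambda>(i, j). dist (ctr G i) (ctr G j) - rad G i - rad G j) ` ({..<nsph G} \<times> {..<nsph G})"
    by auto
  then have "finite ?D" by (rule finite_subset) auto
  then have "Min ?D \<le> dist (ctr G i) (ctr G j) - rad G i - rad G j"
    by (rule Min_le) (use ij in blast)
  moreover have "Min ?D > 0"
    using G n by (simp add: admissible_geometry_def sep_dist_def)
  ultimately have d: "dist (ctr G i) (ctr G j) > rad G i + rad G j" by linarith
  show ?thesis
  proof (rule ccontr)
    assume "\<not> ?thesis"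
    then obtain x where "dist (ctr G i) x = rad G i" "dist (ctr G j) x = rad G j"
      by (auto simp: sph_def)
    then show False using d dist_triangle2[of "ctr G i" "ctr G j" x] by linarith
  qed
qed

lemma rad_pos: "admissible_geometry G \<Longrightarrow> i < nsph G \<Longrightarrow> rad G i > 0"
  by (simp add: admissible_geometry_def)

lemma space_surf [simp]: "space (surf G i) = sph G i"
  by (simp add: surf_def sph_def)

lemma finite_measure_surf: "admissible_geometry G \<Longrightarrow> i < nsph G \<Longrightarrow> finite_measure (surf G i)"
  unfolding surf_def by (intro finite_sphere_measure rad_pos)

lemma measure_surf_pos:
  assumes "admissible_geometry G" "i < nsph G"
  shows "measure (surf G i) (sph G i) > 0"
proof -
  let ?B = "ball (0::pt) 1 - {0}"
  have R: "rad G i > 0" by (rule rad_pos[OF assms])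
  have "measure (surf G i) (sph G i) = (\<integral>x. 1 \<partial>surf G i)" by simp
  also have "\<dots> = (3 * (rad G i)\<^sup>2) * (\<integral>y. indicator ?B y \<partial>lborel)"
    unfolding surf_def by (subst integral_sphere_measure[OF R]) auto
  also have "(\<integral>y. indicator ?B y \<partial>lborel) = measure lborel ?B" by simp
  also have "\<dots> = measure lborel (ball (0::pt) 1)"
    by (rule measure_Diff_null_set) auto
  also have "(3 * (rad G i)\<^sup>2) * \<dots> > 0"
    using R content_ball_pos[of 1 "0::pt"] by simp
  finally show ?thesis .
qed

lemma analytic_bdry_continuous_on:
  assumes "admissible_geometry G" "analytic_bdry G f" "i < nsph G"
  shows "continuous_on (sph G i) f"
proof -
  have "\<exists>F e. real_analytic_at F p \<and> e > 0 \<and> (\<forall>x\<in>sphere (ctr G i) (rad G i) \<inter> ball p e. F x = f x)"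
    if "p \<in> sphere (ctr G i) (rad G i)" for p
    using assms(2,3) that unfolding analytic_bdry_def sph_def by blast
  from analytic_imp_rotation_extends(1)[OF rad_pos[OF assms(1,3)] this] show ?thesis
    by (simp add: sph_def)
qed

lemma analytic_bdry_L2:
  assumes "admissible_geometry G" "analytic_bdry G f"
  shows "f \<in> L2 G"
  unfolding L2_def sq_integrable_def surf_def
  using analytic_bdry_continuous_on[OF assms] rad_pos[OF assms(1)]
  by (auto simp: sph_def intro!: borel_measurable_sphere_measure integrable_sphere_measure continuous_intros)

lemma real_analytic_at_diff_const:
  assumes "real_analytic_at F p"
  shows "real_analytic_at (\<lambda>x. F x - b) p"
proof -
  obtain a e where e: "e > 0" and a: "\<And>x. x \<in> ball p e \<Longrightarrow>
     ((\<lambda>(i, j, k). a i j k * (x $ 1 - p $ 1) ^ i * (x $ 2 - p $ 2) ^ j * (x $ 3 - p $ 3) ^ k) has_sum F x) UNIV"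
    using assms unfolding real_analytic_at_def by blast
  define a' where "a' i j k = a i j k + (if (i, j, k) = (0, 0, 0) then - b else 0)" for i j k :: nat
  have "((\<lambda>(i, j, k). a' i j k * (x $ 1 - p $ 1) ^ i * (x $ 2 - p $ 2) ^ j * (x $ 3 - p $ 3) ^ k) has_sum (F x - b)) UNIV"
    if "x \<in> ball p e" for x
  proof -
    let ?q = "\<lambda>q :: nat \<times> nat \<times> nat. if q = (0, 0, 0) then - b else (0::real)"
    have "(?q has_sum - b) {(0, 0, 0)}"
      using has_sum_finite[of "{(0, 0, 0)}" ?q] by simp
    moreover have "(?q has_sum - b) {(0, 0, 0)} \<longleftrightarrow> (?q has_sum - b) UNIV"
      by (rule has_sum_cong_neutral) auto
    ultimately have "(?q has_sum - b) UNIV" by simp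
    from has_sum_add[OF a[OF that] this] show ?thesis
      by (rule back_subst[where P = "\<lambda>h. (h has_sum _) UNIV", THEN back_subst[where P = "\<lambda>y. (_ has_sum y) UNIV"]])
        (auto simp: fun_eq_iff a'_def algebra_simps)
  qed
  then show ?thesis using e unfolding real_analytic_at_def by blast
qed

lemma analytic_bdry_diff_Cconst:
  assumes f: "analytic_bdry G f" and c: "c \<in> Cconst G"
  shows "analytic_bdry G (\<lambda>x. f x - c x)"
  unfolding analytic_bdry_def
proof (intro allI impI ballI)
  fix i p assume i: "i < nsph G" and p: "p \<in> sph G i"
  obtain F e where "real_analytic_at F p" "e > 0" "\<forall>x\<in>sph G i \<inter> ball p e. F x = f x"
    using f i p unfolding analytic_bdry_def by blast
  moreover obtain b where "\<forall>x\<in>sph G i. c x = b" using c i unfolding Cconst_def by blast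
  ultimately show "\<exists>F e. real_analytic_at F p \<and> e > 0 \<and> (\<forall>x\<in>sph G i \<inter> ball p e. F x = f x - c x)"
    by (intro exI[of _ "\<lambda>x. F x - b"] exI[of _ e]) (auto intro: real_analytic_at_diff_const)
qed

section \<open>Coefficients on all spheres, and growth of the Sobolev norms in s\<close>

lemma analytic_bdry_coef_decay:
  assumes G: "admissible_geometry G" and f: "analytic_bdry G f"
  shows "\<exists>K q. 0 < q \<and> q < 1 \<and> 0 \<le> K \<and>
    (\<forall>i<nsph G. \<forall>l m. \<bar>m\<bar> \<le> int l \<longrightarrow> \<bar>coef G f i l m\<bar> \<le> K * q ^ l)"
proof -
  have "\<exists>K q. 0 < q \<and> q < 1 \<and> (\<forall>l m. \<bar>m\<bar> \<le> int l \<longrightarrow> \<bar>coef G f i l m\<bar> \<le> K * q ^ l)"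
    if i: "i < nsph G" for i
  proof -
    let ?c = "ctr G i" and ?R = "rad G i"
    have R: "?R > 0" by (rule rad_pos[OF G i])
    have "\<exists>F e. real_analytic_at F p \<and> e > 0 \<and> (\<forall>x\<in>sphere ?c ?R \<inter> ball p e. F x = f x)"
      if "p \<in> sphere ?c ?R" for p
      using f i that unfolding analytic_bdry_def sph_def by blast
    from analytic_Ylm_integral_decay[OF R this] obtain K q where q: "0 < q" "q < 1"
      and K: "\<And>l m. \<bar>m\<bar> \<le> int l \<Longrightarrow> \<bar>\<integral>x. f x * Ylm l m ((x - ?c) /\<^sub>R ?R) \<partial>sphere_measure ?c ?R\<bar> \<le> K * q ^ l"
      by blast
    have "\<bar>coef G f i l m\<bar> \<le> K / ?R\<^sup>2 * q ^ l" if m: "\<bar>m\<bar> \<le> int l" for l m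
    proof -
      have "(\<integral>x. f x * Ysph G i l m x \<partial>surf G i) = (\<integral>x. f x * Ylm l m ((x - ?c) /\<^sub>R ?R) \<partial>sphere_measure ?c ?R)"
        unfolding surf_def
        by (intro Bochner_Integration.integral_cong refl) (simp add: Ysph_def dist_norm norm_minus_commute)
      then have "\<bar>coef G f i l m\<bar> = \<bar>\<integral>x. f x * Ylm l m ((x - ?c) /\<^sub>R ?R) \<partial>sphere_measure ?c ?R\<bar> / ?R\<^sup>2"
        by (simp add: coef_def)
      also have "\<dots> \<le> K * q ^ l / ?R\<^sup>2" by (intro divide_right_mono K m) simp
      finally show ?thesis by simp
    qed
    then show ?thesis using q by blast
  qed
  then obtain K q where q: "\<And>i. i < nsph G \<Longrightarrow> 0 < q i" "\<And>i. i < nsph G \<Longrightarrow> q i < 1"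
    and K: "\<And>i l m. i < nsph G \<Longrightarrow> \<bar>m\<bar> \<le> int l \<Longrightarrow> \<bar>coef G f i l m\<bar> \<le> K i * q i ^ l"
    by metis
  have n: "nsph G \<ge> 1" using G by (simp add: admissible_geometry_def)
  define q' where "q' = Max (q ` {..<nsph G})"
  define K' where "K' = Max (K ` {..<nsph G})"
  have ne: "{..<nsph G} \<noteq> {}" using n by (auto simp: lessThan_empty_iff)
  have q': "q i \<le> q'" and K': "K i \<le> K'" if "i < nsph G" for i
    using that by (auto simp: q'_def K'_def)
  have K0: "0 \<le> K i" if "i < nsph G" for i
    using K[OF that, of 0 0] by simp
  have "0 < q'" "0 \<le> K'" using q(1)[of 0] q'[of 0] K0[of 0] K'[of 0] n by auto
  moreover have "q' < 1" using q(2) ne by (auto simp: q'_def)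
  moreover have "\<bar>coef G f i l m\<bar> \<le> K' * q' ^ l" if "i < nsph G" "\<bar>m\<bar> \<le> int l" for i l m
  proof -
    have "\<bar>coef G f i l m\<bar> \<le> K i * q i ^ l" by (rule K[OF that])
    also have "\<dots> \<le> K' * q' ^ l"
      using q(1) q' K' K0 \<open>0 \<le> K'\<close> that by (intro mult_mono power_mono) (auto intro: less_imp_le)
    finally show ?thesis .
  qed
  ultimately show ?thesis by blast
qed

text \<open>Squared coefficients are O(q^(2 l)). One factor q^l tames the weight: with y = l \<mu> /
  (2 s), ln y <= y - 1 gives y^(2 s) <= exp (l \<mu>) = q^(-l), and l / rmin = b s y. The other
  factor q^l sums against the 2 l + 1 orders. Since \<open>b\<close> is free of \<open>s\<close>,
  the bound can be used with \<open>s\<close> growing.\<close>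

lemma analytic_bdry_Hs_norm_bound:
  assumes G: "admissible_geometry G" and f: "analytic_bdry G f"
  shows "\<exists>D b. D \<ge> 0 \<and> b > 0 \<and> (\<forall>s>0. f \<in> Hs G s \<and> Hs_norm G s f \<le> D * (1 + (b * s) powr s))"
proof -
  obtain K q where q: "0 < q" "q < 1" and K0: "0 \<le> K"
    and K: "\<And>i l m. i < nsph G \<Longrightarrow> \<bar>m\<bar> \<le> int l \<Longrightarrow> \<bar>coef G f i l m\<bar> \<le> K * q ^ l"
    using analytic_bdry_coef_decay[OF G f] by blast
  define \<mu> where "\<mu> = - ln q"
  have \<mu>: "\<mu> > 0" using q by (simp add: \<mu>_def)
  have n: "nsph G \<ge> 1" using G by (simp add: admissible_geometry_def)
  define rmin where "rmin = Min (rad G ` {..<nsph G})"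
  have ne: "{..<nsph G} \<noteq> {}" using n by (auto simp: lessThan_empty_iff)
  have rmin: "rmin > 0" using rad_pos[OF G] ne by (simp add: rmin_def)
  have rmin_le: "rmin \<le> rad G i" and rmax: "rad G i \<le> max_rad G" if "i < nsph G" for i
    using that by (auto simp: rmin_def max_rad_def)
  define b where "b = 2 / (\<mu> * rmin)"
  have b: "b > 0" using \<mu> rmin by (simp add: b_def)
  \<comment> \<open>For degree l = n + 1: the 2 l + 1 = 2 n + 3 orders times the factor q^l kept for
    summation.\<close>
  define t where "t n = (2 * real n + 3) * q ^ Suc n" for n
  have t: "summable t"
  proof -
    have "summable (\<lambda>n. 2 * q * (real (Suc n) * q ^ n) + q * q ^ n)"
      using q by (intro summable_add summable_mult summable_geometric sums_summable[OF geometric_deriv_sums]) auto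
    then show ?thesis by (rule back_subst[where P = summable]) (auto simp: t_def fun_eq_iff algebra_simps)
  qed
  have t0: "t n \<ge> 0" for n using q by (simp add: t_def)
  define S where "S = suminf t"
  have S0: "S \<ge> 0" unfolding S_def by (rule suminf_nonneg[OF t t0])
  define D where "D = sqrt (real (nsph G)) * max_rad G * K * (1 + sqrt S)"
  have Rmax: "max_rad G > 0" using rmax[of 0] rad_pos[OF G, of 0] n by simp
  have D: "D \<ge> 0" using Rmax K0 S0 by (simp add: D_def)
  have hs_le: "Hs_term G s f i n \<le> K\<^sup>2 * (b * s) powr (2 * s) * t n" "0 \<le> Hs_term G s f i n"
    if s: "s > 0" and i: "i < nsph G" for s i n
  proof -
    define l where "l = Suc n"
    have l: "real l > 0" by (simp add: l_def)
    have r: "rad G i > 0" by (rule rad_pos[OF G i])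
    show "0 \<le> Hs_term G s f i n" unfolding Hs_term_def by (intro sum_nonneg) simp
    have "(real l / rad G i) powr (2 * s) * q ^ l \<le> (b * s) powr (2 * s)"
    proof -
      have "real l * \<mu> / (2 * s) > 0" using l \<mu> s by simp
      then have "ln (real l * \<mu> / (2 * s)) \<le> real l * \<mu> / (2 * s) - 1" by (rule ln_le_minus_one)
      then have "(2 * s) * ln (real l * \<mu> / (2 * s)) \<le> (2 * s) * (real l * \<mu> / (2 * s))"
        using s by (intro mult_left_mono) auto
      then have "(real l * \<mu> / (2 * s)) powr (2 * s) \<le> exp (real l * \<mu>)"
        using l \<mu> s by (simp add: powr_def)
      then have "(real l * \<mu> / (2 * s)) powr (2 * s) * q ^ l \<le> exp (real l * \<mu>) * q ^ l"
        using q by (intro mult_right_mono) auto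
      also have "q ^ l = exp (- (real l * \<mu>))"
        using q by (simp add: \<mu>_def exp_of_nat_mult)
      finally have 1: "(real l * \<mu> / (2 * s)) powr (2 * s) * q ^ l \<le> 1"
        using q by (simp add: \<mu>_def exp_of_nat_mult exp_minus)
      have "real l / rad G i \<le> real l / rmin" using l r rmin rmin_le[OF i] by (intro divide_left_mono) auto
      also have "\<dots> = (b * s) * (real l * \<mu> / (2 * s))" using \<mu> s by (simp add: b_def)
      finally have "(real l / rad G i) powr (2 * s) \<le> ((b * s) * (real l * \<mu> / (2 * s))) powr (2 * s)"
        using l r s by (intro powr_mono2) auto
      also have "\<dots> = (b * s) powr (2 * s) * (real l * \<mu> / (2 * s)) powr (2 * s)"
        by (rule powr_mult)
      finally have "(real l / rad G i) powr (2 * s) * q ^ l \<le> (b * s) powr (2 * s) * (real l * \<mu> / (2 * s)) powr (2 * s) * q ^ l"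
        using q by (intro mult_right_mono) auto
      also have "\<dots> \<le> (b * s) powr (2 * s) * 1"
        unfolding mult.assoc by (intro mult_left_mono 1) auto
      finally show ?thesis by simp
    qed
    then have *: "(real l / rad G i) powr (2 * s) * q ^ l * (K\<^sup>2 * q ^ l) \<le> (b * s) powr (2 * s) * (K\<^sup>2 * q ^ l)"
      using q by (intro mult_right_mono) auto
    have "Hs_term G s f i n \<le> (\<Sum>m\<in>{- int l..int l}. (b * s) powr (2 * s) * (K\<^sup>2 * q ^ l))"
      unfolding Hs_term_def l_def[symmetric]
    proof (rule sum_mono)
      fix m assume "m \<in> {- int l..int l}"
      then have "\<bar>coef G f i l m\<bar> \<le> K * q ^ l" by (intro K i) auto
      then have "(coef G f i l m)\<^sup>2 \<le> (K * q ^ l)\<^sup>2" by (rule abs_le_square_iff[THEN iffD1, OF order_trans[OF _ abs_ge_self]])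
      then have "(real l / rad G i) powr (2 * s) * (coef G f i l m)\<^sup>2 \<le> (real l / rad G i) powr (2 * s) * (K * q ^ l)\<^sup>2"
        by (intro mult_left_mono) auto
      also have "\<dots> = (real l / rad G i) powr (2 * s) * q ^ l * (K\<^sup>2 * q ^ l)"
        by (simp add: power2_eq_square)
      also note *
      finally show "(real l / rad G i) powr (2 * s) * (coef G f i l m)\<^sup>2 \<le> (b * s) powr (2 * s) * (K\<^sup>2 * q ^ l)" .
    qed
    also have "\<dots> = K\<^sup>2 * (b * s) powr (2 * s) * t n"
      by (simp add: t_def l_def algebra_simps)
    finally show "Hs_term G s f i n \<le> K\<^sup>2 * (b * s) powr (2 * s) * t n" .
  qed
  have "f \<in> Hs G s \<and> Hs_norm G s f \<le> D * (1 + (b * s) powr s)" if s: "s > 0" for s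
  proof
    have sumt: "summable (\<lambda>n. K\<^sup>2 * (b * s) powr (2 * s) * t n)" by (intro summable_mult t)
    have summ: "summable (Hs_term G s f i)" if "i < nsph G" for i
      by (rule summable_comparison_test'[OF sumt, of 0]) (use hs_le[OF s that] in auto)
    then show "f \<in> Hs G s" using analytic_bdry_L2[OF G f] by (simp add: Hs_def)
    have "(\<Sum>i<nsph G. (rad G i)\<^sup>2 * (coef G f i 0 0)\<^sup>2 + (rad G i)\<^sup>2 * (\<Sum>n. Hs_term G s f i n))
      \<le> (\<Sum>i<nsph G. (max_rad G)\<^sup>2 * K\<^sup>2 + (max_rad G)\<^sup>2 * (K\<^sup>2 * (b * s) powr (2 * s) * S))"
    proof (rule sum_mono)
      fix i assume "i \<in> {..<nsph G}"
      then have i: "i < nsph G" by simp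
      have r2: "(rad G i)\<^sup>2 \<le> (max_rad G)\<^sup>2" using rmax[OF i] rad_pos[OF G i] by (intro power_mono) auto
      have "\<bar>coef G f i 0 0\<bar> \<le> K" using K[OF i, of 0 0] by simp
      then have "(coef G f i 0 0)\<^sup>2 \<le> K\<^sup>2" by (rule abs_le_square_iff[THEN iffD1, OF order_trans[OF _ abs_ge_self]])
      moreover have "(\<Sum>n. Hs_term G s f i n) \<le> K\<^sup>2 * (b * s) powr (2 * s) * S"
        unfolding S_def suminf_mult[OF t, symmetric]
        by (intro suminf_le hs_le s i summ sumt)
      moreover have "(\<Sum>n. Hs_term G s f i n) \<ge> 0"
        by (intro suminf_nonneg summ i hs_le s)
      ultimately show "(rad G i)\<^sup>2 * (coef G f i 0 0)\<^sup>2 + (rad G i)\<^sup>2 * (\<Sum>n. Hs_term G s f i n)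
        \<le> (max_rad G)\<^sup>2 * K\<^sup>2 + (max_rad G)\<^sup>2 * (K\<^sup>2 * (b * s) powr (2 * s) * S)"
        using r2 by (intro add_mono mult_mono) auto
    qed
    also have "\<dots> = real (nsph G) * (max_rad G)\<^sup>2 * K\<^sup>2 * (1 + (b * s) powr (2 * s) * S)"
      by (simp add: algebra_simps)
    \<comment> \<open>A perfect square, so that the root below is explicit and separates into
      \<open>D\<close> and the growth in \<open>s\<close>.\<close>
    also have "\<dots> \<le> real (nsph G) * (max_rad G)\<^sup>2 * K\<^sup>2 * ((1 + sqrt S) * (1 + (b * s) powr s))\<^sup>2"
    proof (intro mult_left_mono)
      have "(b * s) powr (2 * s) = ((b * s) powr s)\<^sup>2" by (simp add: power2_eq_square flip: powr_add)
      moreover have "S = (sqrt S)\<^sup>2" using S0 by simp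
      moreover have "1 + x\<^sup>2 * y\<^sup>2 \<le> ((1 + y) * (1 + x))\<^sup>2" if "x \<ge> 0" "y \<ge> 0" for x y :: real
      proof -
        have "1 + x\<^sup>2 * y\<^sup>2 \<le> (1 + x * y)\<^sup>2" using that by (simp add: power2_eq_square algebra_simps)
        also have "\<dots> \<le> ((1 + y) * (1 + x))\<^sup>2" using that by (intro power_mono) (auto simp: algebra_simps)
        finally show ?thesis .
      qed
      ultimately show "1 + (b * s) powr (2 * s) * S \<le> ((1 + sqrt S) * (1 + (b * s) powr s))\<^sup>2"
        using S0 by (metis powr_ge_zero real_sqrt_ge_zero)
    qed simp
    finally have "Hs_norm G s f \<le> sqrt (real (nsph G) * (max_rad G)\<^sup>2 * K\<^sup>2 * ((1 + sqrt S) * (1 + (b * s) powr s))\<^sup>2)"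
      unfolding Hs_norm_def by (rule real_sqrt_le_mono)
    also have "\<dots> = D * (1 + (b * s) powr s)"
      using Rmax K0 S0 by (simp add: D_def real_sqrt_mult abs_mult)
    finally show "Hs_norm G s f \<le> D * (1 + (b * s) powr s)" .
  qed
  then show ?thesis using D b by blast
qed

subsection \<open>The projection onto piecewise constant functions\<close>

lemma sq_integrable_mult:
  assumes "sq_integrable M f" "sq_integrable M g"
  shows "integrable M (\<lambda>x. f x * g x)"
proof (rule Bochner_Integration.integrable_bound)
  show "integrable M (\<lambda>x. (f x)\<^sup>2 + (g x)\<^sup>2)"
    using assms by (auto simp: sq_integrable_def)
  show "(\<lambda>x. f x * g x) \<in> borel_measurable M"
    using assms by (auto simp: sq_integrable_def)
  have "\<bar>a * b\<bar> \<le> a\<^sup>2 + b\<^sup>2" for a b :: real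
  proof -
    have "2 * (\<bar>a\<bar> * \<bar>b\<bar>) \<le> a\<^sup>2 + b\<^sup>2" using sum_squares_bound[of "\<bar>a\<bar>" "\<bar>b\<bar>"] by simp
    moreover have "0 \<le> \<bar>a\<bar> * \<bar>b\<bar>" by simp
    ultimately show ?thesis unfolding abs_mult by linarith
  qed
  then show "AE x in M. norm (f x * g x) \<le> norm ((f x)\<^sup>2 + (g x)\<^sup>2)" by simp
qed

lemma sq_integrable_add:
  assumes "sq_integrable M f" "sq_integrable M g"
  shows "sq_integrable M (\<lambda>x. f x + g x)"
  using assms sq_integrable_mult[OF assms]
  by (auto simp: sq_integrable_def power2_sum mult.assoc)

lemma sq_integrable_scale:
  assumes "sq_integrable M f"
  shows "sq_integrable M (\<lambda>x. a * f x)"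
  using assms by (auto simp: sq_integrable_def power_mult_distrib)

lemma integral_mult_le_sqrt:
  assumes "sq_integrable M f" "sq_integrable M g"
  shows "\<bar>\<integral>x. f x * g x \<partial>M\<bar> \<le> sqrt (\<integral>x. (f x)\<^sup>2 \<partial>M) * sqrt (\<integral>x. (g x)\<^sup>2 \<partial>M)"
proof -
  let ?A = "\<integral>x. (f x)\<^sup>2 \<partial>M" and ?C = "\<integral>x. f x * g x \<partial>M" and ?B = "\<integral>x. (g x)\<^sup>2 \<partial>M"
  have AB: "?A \<ge> 0" "?B \<ge> 0" by simp_all
  have quad: "?A - 2 * t * ?C + t\<^sup>2 * ?B \<ge> 0" for t
  proof -
    have "0 \<le> (\<integral>x. (f x - t * g x)\<^sup>2 \<partial>M)" by simp
    also have "\<dots> = (\<integral>x. (f x)\<^sup>2 - 2 * t * (f x * g x) + t\<^sup>2 * (g x)\<^sup>2 \<partial>M)"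
      by (intro Bochner_Integration.integral_cong refl) (simp add: power2_eq_square algebra_simps)
    also have "\<dots> = ?A - 2 * t * ?C + t\<^sup>2 * ?B"
      using assms sq_integrable_mult[OF assms] by (simp add: sq_integrable_def)
    finally show ?thesis .
  qed
  have "?C\<^sup>2 \<le> ?A * ?B"
  proof (cases "?B = 0")
    case True
    have "?C = 0"
    proof (rule ccontr)
      assume "?C \<noteq> 0"
      \<comment> \<open>With \<open>?B = 0\<close> the expression is linear in \<open>t\<close>, and
        this \<open>t\<close> gives it the value -1.\<close>
      then show False using quad[of "(?A + 1) / (2 * ?C)"] True by simp
    qed
    then show ?thesis using AB by simp
  next
    case False
    then have B: "?B > 0" using AB(2) by linarith
    have "?A - 2 * (?C / ?B) * ?C + (?C / ?B)\<^sup>2 * ?B = ?A - ?C\<^sup>2 / ?B"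
      using False by (simp add: power2_eq_square)
    then have "?C\<^sup>2 / ?B \<le> ?A" using quad[of "?C / ?B"] by linarith
    then show ?thesis using B by (simp add: pos_divide_le_eq)
  qed
  then have "sqrt (?C\<^sup>2) \<le> sqrt (?A * ?B)" by (rule real_sqrt_le_mono)
  then show ?thesis by (simp add: real_sqrt_mult)
qed

lemma borel_measurable_slobodeckij:
  assumes "f \<in> borel_measurable (surf G i)"
  shows "slobodeckij f \<in> borel_measurable (surf G i \<Otimes>\<^sub>M surf G i)"
proof -
  have id: "(\<lambda>x. x) \<in> borel_measurable (surf G i)"
    unfolding surf_def by (intro borel_measurable_sphere_measure continuous_intros)
  have [measurable]: "(\<lambda>p. f (fst p)) \<in> borel_measurable (surf G i \<Otimes>\<^sub>M surf G i)"
    "(\<lambda>p. f (snd p)) \<in> borel_measurable (surf G i \<Otimes>\<^sub>M surf G i)"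
    "(\<lambda>p. fst p) \<in> borel_measurable (surf G i \<Otimes>\<^sub>M surf G i)"
    "(\<lambda>p. snd p) \<in> borel_measurable (surf G i \<Otimes>\<^sub>M surf G i)"
    using measurable_compose[OF measurable_fst assms] measurable_compose[OF measurable_snd assms]
      measurable_compose[OF measurable_fst id] measurable_compose[OF measurable_snd id] by auto
  show ?thesis unfolding slobodeckij_def case_prod_unfold by measurable
qed

lemma slobodeckij_nonneg: "0 \<le> slobodeckij f p"
  by (simp add: slobodeckij_def case_prod_unfold)

text \<open>\<open>dual_of\<close> tests membership in \<open>Hhalf G\<close>, so its additivity
  rests on closure under sums. The double integral is handled by (a + b)^2 <= 2 a^2 + 2 b^2.\<close>

lemma Hhalf_add:
  assumes "f \<in> Hhalf G" "g \<in> Hhalf G"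
  shows "(\<lambda>x. f x + g x) \<in> Hhalf G"
proof -
  have "sq_integrable (surf G i) (\<lambda>x. f x + g x)" if "i < nsph G" for i
    using assms that by (intro sq_integrable_add) (auto simp: Hhalf_def L2_def)
  moreover have "integrable (surf G i \<Otimes>\<^sub>M surf G i) (slobodeckij (\<lambda>x. f x + g x))" if i: "i < nsph G" for i
  proof (rule Bochner_Integration.integrable_bound)
    show "integrable (surf G i \<Otimes>\<^sub>M surf G i) (\<lambda>p. 2 * slobodeckij f p + 2 * slobodeckij g p)"
      using assms i by (auto simp: Hhalf_def)
    show "slobodeckij (\<lambda>x. f x + g x) \<in> borel_measurable (surf G i \<Otimes>\<^sub>M surf G i)"
      using assms i by (intro borel_measurable_slobodeckij borel_measurable_add) (auto simp: Hhalf_def L2_def sq_integrable_def)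
    have "slobodeckij (\<lambda>x. f x + g x) p \<le> 2 * slobodeckij f p + 2 * slobodeckij g p" for p
    proof -
      obtain x y where p: "p = (x, y)" by (cases p)
      have "(a + b)\<^sup>2 \<le> 2 * a\<^sup>2 + 2 * b\<^sup>2" for a b :: real
        using sum_squares_bound[of a b] by (simp add: power2_sum)
      from this[of "f x - f y" "g x - g y"]
      have "(f x + g x - (f y + g y))\<^sup>2 / norm (x - y) ^ 3 \<le> (2 * (f x - f y)\<^sup>2 + 2 * (g x - g y)\<^sup>2) / norm (x - y) ^ 3"
        by (intro divide_right_mono) (simp_all add: algebra_simps)
      then show ?thesis by (simp add: p slobodeckij_def add_divide_distrib)
    qed
    then show "AE p in surf G i \<Otimes>\<^sub>M surf G i. norm (slobodeckij (\<lambda>x. f x + g x) p)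
      \<le> norm (2 * slobodeckij f p + 2 * slobodeckij g p)"
      using slobodeckij_nonneg by (auto simp: abs_of_nonneg)
  qed
  ultimately show ?thesis by (simp add: Hhalf_def L2_def)
qed

lemma Hhalf_scale:
  assumes "f \<in> Hhalf G"
  shows "(\<lambda>x. a * f x) \<in> Hhalf G"
proof -
  have "slobodeckij (\<lambda>x. a * f x) = (\<lambda>p. a\<^sup>2 * slobodeckij f p)"
    by (auto simp: slobodeckij_def fun_eq_iff power_mult_distrib simp flip: right_diff_distrib)
  then show ?thesis using assms
    by (auto simp: Hhalf_def L2_def intro: sq_integrable_scale)
qed

text \<open>\<open>Hminus_breve\<close> includes boundedness of the functional, so this enters the
  proof that the choice in \<open>Q0\<close> has a witness. The bound is Cauchy-Schwarz on each
  sphere with the L^2 part of the norm.\<close>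

lemma dual_of_Hminus:
  assumes v: "v \<in> L2 G"
  shows "dual_of G v \<in> Hminus G"
proof -
  have sv: "sq_integrable (surf G i) v" if "i < nsph G" for i using v that by (simp add: L2_def)
  have sf: "sq_integrable (surf G i) f" if "f \<in> Hhalf G" "i < nsph G" for f i
    using that by (simp add: Hhalf_def L2_def)
  have "dual_of G v (\<lambda>x. f x + g x) = dual_of G v f + dual_of G v g" if "f \<in> Hhalf G" "g \<in> Hhalf G" for f g
    using that sq_integrable_mult[OF sv sf]
    by (simp add: dual_of_def Hhalf_add L2_inner_def distrib_left sum.distrib)
  moreover have "dual_of G v (\<lambda>x. a * f x) = a * dual_of G v f" if "f \<in> Hhalf G" for f a
    using that by (simp add: dual_of_def Hhalf_scale L2_inner_def sum_distrib_left mult.left_commute)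
  moreover have "\<bar>dual_of G v f\<bar> \<le> (\<Sum>i<nsph G. sqrt (\<integral>x. (v x)\<^sup>2 \<partial>surf G i)) * Hhalf_norm G f"
    if f: "f \<in> Hhalf G" for f
  proof -
    have "\<bar>dual_of G v f\<bar> \<le> (\<Sum>i<nsph G. \<bar>\<integral>x. v x * f x \<partial>surf G i\<bar>)"
      using f by (simp add: dual_of_def L2_inner_def sum_abs)
    also have "\<dots> \<le> (\<Sum>i<nsph G. sqrt (\<integral>x. (v x)\<^sup>2 \<partial>surf G i) * Hhalf_norm G f)"
    proof (rule sum_mono)
      fix i assume i: "i \<in> {..<nsph G}"
      let ?h = "\<lambda>i. (\<integral>x. (f x)\<^sup>2 \<partial>surf G i) + (\<integral>p. slobodeckij f p \<partial>(surf G i \<Otimes>\<^sub>M surf G i))"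
      have h0: "0 \<le> (\<integral>p. slobodeckij f p \<partial>(surf G i \<Otimes>\<^sub>M surf G i))" for i
        by (simp add: slobodeckij_nonneg)
      have "(\<integral>x. (f x)\<^sup>2 \<partial>surf G i) \<le> ?h i" using h0[of i] by linarith
      also have "\<dots> \<le> (\<Sum>i<nsph G. ?h i)"
        by (rule member_le_sum[OF i]) (auto intro!: add_nonneg_nonneg h0)
      finally have "sqrt (\<integral>x. (f x)\<^sup>2 \<partial>surf G i) \<le> Hhalf_norm G f"
        unfolding Hhalf_norm_def by (rule real_sqrt_le_mono)
      then have "sqrt (\<integral>x. (v x)\<^sup>2 \<partial>surf G i) * sqrt (\<integral>x. (f x)\<^sup>2 \<partial>surf G i)
        \<le> sqrt (\<integral>x. (v x)\<^sup>2 \<partial>surf G i) * Hhalf_norm G f"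
        by (intro mult_left_mono) auto
      moreover have "\<bar>\<integral>x. v x * f x \<partial>surf G i\<bar> \<le> sqrt (\<integral>x. (v x)\<^sup>2 \<partial>surf G i) * sqrt (\<integral>x. (f x)\<^sup>2 \<partial>surf G i)"
        using i by (intro integral_mult_le_sqrt sv sf[OF f]) auto
      ultimately show "\<bar>\<integral>x. v x * f x \<partial>surf G i\<bar> \<le> sqrt (\<integral>x. (v x)\<^sup>2 \<partial>surf G i) * Hhalf_norm G f"
        by linarith
    qed
    finally show ?thesis by (simp add: sum_distrib_right)
  qed
  moreover have "dual_of G v f = 0" if "f \<notin> Hhalf G" for f using that by (simp add: dual_of_def)
  ultimately show ?thesis unfolding Hminus_def by blast
qed

lemma dual_diff_Hminus:
  assumes "\<sigma> \<in> Hminus G" "\<tau> \<in> Hminus G"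
  shows "dual_diff \<sigma> \<tau> \<in> Hminus G"
proof -
  obtain B1 B2 where B: "\<And>f. f \<in> Hhalf G \<Longrightarrow> \<bar>\<sigma> f\<bar> \<le> B1 * Hhalf_norm G f"
    "\<And>f. f \<in> Hhalf G \<Longrightarrow> \<bar>\<tau> f\<bar> \<le> B2 * Hhalf_norm G f"
  proof -
    have "\<exists>B. \<forall>f\<in>Hhalf G. \<bar>\<sigma> f\<bar> \<le> B * Hhalf_norm G f" "\<exists>B. \<forall>f\<in>Hhalf G. \<bar>\<tau> f\<bar> \<le> B * Hhalf_norm G f"
      using assms by (simp_all add: Hminus_def)
    then show ?thesis using that by blast
  qed
  have "\<bar>\<sigma> f - \<tau> f\<bar> \<le> (B1 + B2) * Hhalf_norm G f" if "f \<in> Hhalf G" for f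
    using B[OF that] abs_triangle_ineq4[of "\<sigma> f" "\<tau> f"] by (simp add: distrib_right)
  moreover have "\<sigma> (\<lambda>x. f x + g x) - \<tau> (\<lambda>x. f x + g x) = \<sigma> f - \<tau> f + (\<sigma> g - \<tau> g)"
    if "f \<in> Hhalf G" "g \<in> Hhalf G" for f g
    using assms that by (simp add: Hminus_def)
  moreover have "\<sigma> (\<lambda>x. a * f x) - \<tau> (\<lambda>x. a * f x) = a * (\<sigma> f - \<tau> f)" if "f \<in> Hhalf G" for f a
    using assms that by (simp add: Hminus_def right_diff_distrib)
  moreover have "\<sigma> f - \<tau> f = 0" if "f \<notin> Hhalf G" for f
    using assms that by (simp add: Hminus_def)
  ultimately show ?thesis unfolding Hminus_def dual_diff_def by blast
qed

text \<open>Without the mean-value function below, the choice operator in \<^const>\<open>Q0\<close> could return a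
  function that is not piecewise constant.\<close>

lemma Q0_Cconst:
  assumes G: "admissible_geometry G" and v: "v \<in> L2 G"
  shows "Q0 G (dual_of G v) \<in> Cconst G"
proof -
  define a where "a i = (\<integral>x. v x \<partial>surf G i) / measure (surf G i) (sph G i)" for i
  define c where "c x = (\<Sum>j<nsph G. a j * indicator (sph G j) x)" for x
  have c: "c x = a i" if i: "i < nsph G" and x: "x \<in> sph G i" for i x
  proof -
    have "c x = (\<Sum>j<nsph G. if j = i then a j else 0)"
      unfolding c_def
    proof (intro sum.cong refl)
      fix j assume "j \<in> {..<nsph G}"
      then show "a j * indicator (sph G j) x = (if j = i then a j else 0)"
        using x sph_disjoint[OF G i, of j] by (auto simp: indicator_def)
    qed
    then show ?thesis using i by simp
  qed
  then have cC: "c \<in> Cconst G" unfolding Cconst_def by blast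
  have cL2: "c \<in> L2 G"
    unfolding L2_def sq_integrable_def
  proof (intro CollectI allI impI conjI)
    fix i assume i: "i < nsph G"
    interpret finite_measure "surf G i" by (rule finite_measure_surf[OF G i])
    show "c \<in> borel_measurable (surf G i)"
      by (subst measurable_cong[of _ _ "\<lambda>_. a i"]) (auto simp: c[OF i])
    show "integrable (surf G i) (\<lambda>x. (c x)\<^sup>2)"
      by (subst Bochner_Integration.integrable_cong[OF refl, of _ _ "\<lambda>_. (a i)\<^sup>2"]) (auto simp: c[OF i])
  qed
  have "dual_diff (dual_of G v) (dual_of G c) \<in> Hminus_breve G"
    unfolding Hminus_breve_def
  proof (intro CollectI conjI ballI)
    show "dual_diff (dual_of G v) (dual_of G c) \<in> Hminus G"
      by (intro dual_diff_Hminus dual_of_Hminus v cL2)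
    fix d assume d: "d \<in> Cconst G"
    have "(\<integral>x. v x * d x \<partial>surf G i) = (\<integral>x. c x * d x \<partial>surf G i)" if i: "i < nsph G" for i
    proof -
      obtain b where b: "\<And>x. x \<in> sph G i \<Longrightarrow> d x = b" using d i unfolding Cconst_def by blast
      have "(\<integral>x. v x * d x \<partial>surf G i) = (\<integral>x. v x * b \<partial>surf G i)"
        by (intro Bochner_Integration.integral_cong refl) (simp add: b)
      also have "\<dots> = a i * b * measure (surf G i) (sph G i)"
        using measure_surf_pos[OF G i] by (simp add: a_def)
      also have "\<dots> = (\<integral>x. a i * b \<partial>surf G i)" by simp
      also have "\<dots> = (\<integral>x. c x * d x \<partial>surf G i)"
        by (intro Bochner_Integration.integral_cong refl) (simp add: b c[OF i])
      finally show ?thesis .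
    qed
    \<comment> \<open>If \<open>d\<close> is outside \<open>Hhalf G\<close>, both functionals are 0
      by the definition of \<open>dual_of\<close>; otherwise the integrals agree sphere by
      sphere.\<close>
    then show "dual_diff (dual_of G v) (dual_of G c) d = 0"
      by (simp add: dual_diff_def dual_of_def L2_inner_def)
  qed
  then have "\<exists>c. c \<in> Cconst G \<and> dual_diff (dual_of G v) (dual_of G c) \<in> Hminus_breve G" using cC by blast
  then show ?thesis unfolding Q0_def by (rule someI2_ex) blast
qed

subsection \<open>The exponential error estimate\<close>

text \<open>The sacrificed factor exp (- \<theta> (l + 1) / 2) tends to 0 and overtakes any
  constant. In its application \<open>D\<close> contains 1 / k0 and \<open>P\<close> does not, so
  \<open>k0\<close> affects only the threshold for \<open>l\<close>.\<close>

lemma exp_absorb_constant: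
  fixes \<theta> P D :: real
  assumes "\<theta> > 0" "P > 0"
  shows "\<forall>\<^sub>F l :: nat in sequentially. D * exp (- (\<theta> * real (l + 1))) \<le> P * exp (- (\<theta> / 2 * real (l + 1)))"
proof -
  have "((\<lambda>l. D * exp (- (\<theta> / 2 * real (l + 1)))) \<longlongrightarrow> D * 0) sequentially"
    by (intro tendsto_mult_left filterlim_compose[OF exp_at_bot]
        filterlim_compose[OF filterlim_uminus_at_bot_at_top]
        filterlim_tendsto_pos_mult_at_top[OF tendsto_const] filterlim_compose[OF filterlim_real_sequentially]
        filterlim_add_const_nat_at_top) (use assms in auto)
  then have "\<forall>\<^sub>F l in sequentially. D * exp (- (\<theta> / 2 * real (l + 1))) < P"
    by (rule order_tendstoD(2)) (use assms in simp)
  then show ?thesis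
  proof eventually_elim
    case (elim l)
    have "D * exp (- (\<theta> * real (l + 1))) = D * exp (- (\<theta> / 2 * real (l + 1))) * exp (- (\<theta> / 2 * real (l + 1)))"
      by (simp add: mult.assoc flip: exp_add)
    also have "\<dots> \<le> P * exp (- (\<theta> / 2 * real (l + 1)))"
      using elim by (intro mult_right_mono) auto
    finally show ?case .
  qed
qed

text \<open>\<open>\<theta>\<close> is chosen so that R / (l + 1) * (b s) = R b \<theta> = 1 / e:
  the growth (b s)^s and the power of R / (l + 1) combine to exactly exp (- s). The summand 1 is
  covered by R / (l + 1) <= 1 / e, which is the condition on \<open>l\<close>, and the surplus power
  1/2 is bounded by 1.\<close>

lemma Hs_decay_bound:
  fixes R D b s \<theta> :: real and l :: nat
  assumes R: "R > 0" and D: "D \<ge> 0" and b: "b > 0"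
    and \<theta>: "\<theta> = exp (-1) / (R * b)" and s: "s = \<theta> * real (l + 1)" and l: "R * exp 1 \<le> real (l + 1)"
  shows "(R / real (l + 1)) powr (s + 1/2) * (D * (1 + (b * s) powr s)) \<le> 2 * D * exp (- (\<theta> * real (l + 1)))"
proof -
  let ?x = "R / real (l + 1)"
  have \<theta>0: "\<theta> > 0" using R b by (simp add: \<theta>)
  have s0: "s > 0" using \<theta>0 by (simp add: s)
  have x: "0 < ?x" using R by simp
  have "R * exp 1 * exp (-1) \<le> real (l + 1) * exp (-1)" using l by (intro mult_right_mono) auto
  then have xe: "?x \<le> exp (-1)" by (simp add: exp_minus field_simps)
  also have "exp (-1) \<le> (1::real)" by simp
  finally have x1: "?x \<le> 1" .
  have half: "?x powr (s + 1/2) \<le> ?x powr s" using x x1 by (intro powr_mono') auto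
  have "?x powr s \<le> exp (-1) powr s" using xe x s0 by (intro powr_mono2) auto
  then have e1: "?x powr s \<le> exp (- s)" by (simp add: powr_def)
  have "?x * (b * s) = exp (-1)"
    using R b by (simp add: s \<theta> del: of_nat_add of_nat_Suc)
  then have "?x powr s * (b * s) powr s = exp (-1) powr s"
    by (simp only: powr_mult[symmetric])
  then have e2: "?x powr s * (b * s) powr s = exp (- s)" by (simp add: powr_def)
  have "?x powr (s + 1/2) * (D * (1 + (b * s) powr s)) \<le> ?x powr s * (D * (1 + (b * s) powr s))"
    using D by (intro mult_right_mono half) (auto intro!: mult_nonneg_nonneg add_nonneg_nonneg)
  also have "\<dots> = D * (?x powr s + ?x powr s * (b * s) powr s)" by (simp add: algebra_simps)
  also have "\<dots> \<le> D * (exp (- s) + exp (- s))" unfolding e2 using e1 D by (intro mult_left_mono) auto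
  finally show ?thesis by (simp add: s)
qed

theorem theorem2p24:
  fixes G :: spheres and sf :: bfun and \<nu> :: bdual
  assumes geometry: "admissible_geometry G"
    and sf: "smooth_bdry G sf" "analytic_bdry G sf"
    and \<nu>: "\<nu> \<in> Hminus G" "analytic_dual G \<nu>"
  shows "\<exists>C>0. \<forall>(Cmain :: real set \<Rightarrow> real \<Rightarrow> real set \<Rightarrow> real \<Rightarrow> real)
           (k0 :: real) (k :: nat \<Rightarrow> real) (\<nu>l :: nat \<Rightarrow> bfun).
     main_constant Cmain \<and> admissible_dielectric G k0 k \<and>
     solves_P G k0 k (dual_of G sf) \<nu> \<and>
     (\<forall>l\<ge>1. solves_G G k0 k (dual_of G sf) l (\<nu>l l)) \<longrightarrow>
     (let cm = Cmain (rad G ` {..<nsph G}) k0 (k ` {..<nsph G}) (sep_dist G) in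
      \<forall>\<^sub>F l in sequentially.
        1 / sqrt (real (nsph G)) * tnorm_dual G (dual_diff \<nu> (dual_of G (\<nu>l l)))
          \<le> sqrt (8 * pi * Max ((\<lambda>j. (rad G j)\<^sup>2) ` {..<nsph G})) * (2 * max_rad G) powr (1/4) *
            C * cm * exp (- (1 / (4 * C)) * (real (l + 1) / max_rad G) + 1/2) \<and>
        1 / sqrt (real (nsph G)) *
            \<bar>energy G (dual_of G sf) \<nu> - energy G (dual_of G sf) (dual_of G (\<nu>l l))\<bar>
          \<le> sqrt (8 * pi * Max ((\<lambda>j. (rad G j)\<^sup>2) ` {..<nsph G})) * (2 * max_rad G) powr (1/4) *
            C * cm * tnorm G (single_layer G (dual_of G sf)) *
            exp (- (1 / (4 * C)) * (real (l + 1) / max_rad G) + 1/2))"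
proof -
  obtain v where v: "analytic_bdry G v" and \<nu>v: "\<nu> = dual_of G v"
    using \<nu>(2) unfolding analytic_dual_def by blast
  have vL2: "v \<in> L2 G" and sfL2: "sf \<in> L2 G"
    using analytic_bdry_L2[OF geometry] v sf by auto
  have Q: "analytic_bdry G (Q0_perp G v)" "analytic_bdry G (Q0_perp G sf)"
    unfolding Q0_perp_def
    by (rule analytic_bdry_diff_Cconst[OF v Q0_Cconst[OF geometry vL2]],
        rule analytic_bdry_diff_Cconst[OF sf(2) Q0_Cconst[OF geometry sfL2]])
  obtain D1 b1 where D1: "D1 \<ge> 0" "b1 > 0"
    and n1: "\<And>s. s > 0 \<Longrightarrow> Hs_norm G s (Q0_perp G v) \<le> D1 * (1 + (b1 * s) powr s)"
    using analytic_bdry_Hs_norm_bound[OF geometry Q(1)] by blast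
  obtain D2 b2 where D2: "D2 \<ge> 0" "b2 > 0"
    and n2: "\<And>s. s > 0 \<Longrightarrow> Hs_norm G s (Q0_perp G sf) \<le> D2 * (1 + (b2 * s) powr s)"
    using analytic_bdry_Hs_norm_bound[OF geometry Q(2)] by blast
  have vHs: "v \<in> Hs G s" and sfHs: "sf \<in> Hs G s" if "s > 0" for s
    using analytic_bdry_Hs_norm_bound[OF geometry v] analytic_bdry_Hs_norm_bound[OF geometry sf(2)] that by blast+
  \<comment> \<open>Common constants for \<open>v\<close> and \<open>sf\<close>, so that one choice
    of \<open>s\<close> serves both norms.\<close>
  define D where "D = max D1 D2"
  define b where "b = max b1 b2"
  have D: "D \<ge> 0" "D1 \<le> D" "D2 \<le> D" and b: "b > 0" "b1 \<le> b" "b2 \<le> b"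
    using D1 D2 by (auto simp: D_def b_def)
  have mono: "D' * (1 + (b' * s) powr s) \<le> D * (1 + (b * s) powr s)"
    if "s > 0" "D' \<le> D" "0 < b'" "b' \<le> b" for s D' b'
    using that D(1) by (intro mult_mono add_mono powr_mono2) (auto intro: add_nonneg_nonneg)
  define R where "R = max_rad G"
  have N: "nsph G \<ge> 1" using geometry by (simp add: admissible_geometry_def)
  have "rad G 0 \<le> R" using N by (auto simp: R_def max_rad_def)
  then have R: "R > 0" using rad_pos[OF geometry, of 0] N by simp
  define \<theta> where "\<theta> = exp (-1) / (R * b)"
  have \<theta>: "\<theta> > 0" using R b by (simp add: \<theta>_def)
  \<comment> \<open>Solves 1 / (4 C R) = \<theta> / 2, the rate left after one half is given
    away.\<close>
  define C where "C = 1 / (2 * \<theta> * R)"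
  have C: "C > 0" using \<theta> R by (simp add: C_def)
  \<comment> \<open>The claimed right-hand side without \<open>cm\<close>, the norm of the potential
    and the decaying exponential. It is positive, so \<open>exp_absorb_constant\<close>
    applies.\<close>
  define P where "P = sqrt (8 * pi * Max ((\<lambda>j. (rad G j)\<^sup>2) ` {..<nsph G})) * (2 * R) powr (1/4) * C * exp (1/2)"
  have "(rad G 0)\<^sup>2 \<le> Max ((\<lambda>j. (rad G j)\<^sup>2) ` {..<nsph G})" using N by auto
  then have "Max ((\<lambda>j. (rad G j)\<^sup>2) ` {..<nsph G}) > 0"
    using rad_pos[OF geometry, of 0] N by (smt (verit) One_nat_def Suc_le_lessD zero_less_power)
  then have P: "P > 0" using C R by (simp add: P_def)
  have expC: "exp (- (1 / (4 * C)) * (real (l + 1) / R) + 1/2) = exp (1/2) * exp (- (\<theta> / 2 * real (l + 1)))" for l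
  proof -
    have "- (1 / (4 * C)) * (real (l + 1) / R) + 1/2 = 1/2 + - (\<theta> / 2 * real (l + 1))"
      using R \<theta> by (simp add: C_def del: of_nat_add of_nat_Suc)
    then show ?thesis by (simp only: exp_add)
  qed
  show ?thesis
  proof (intro exI[of _ C] conjI allI impI C)
    fix Cmain :: "real set \<Rightarrow> real \<Rightarrow> real set \<Rightarrow> real \<Rightarrow> real" and k0 k \<nu>l
    assume "main_constant Cmain \<and> admissible_dielectric G k0 k \<and> solves_P G k0 k (dual_of G sf) \<nu> \<and>
       (\<forall>l\<ge>1. solves_G G k0 k (dual_of G sf) l (\<nu>l l))"
    then have main: "main_constant Cmain" and diel: "admissible_dielectric G k0 k"
      and sP: "solves_P G k0 k (dual_of G sf) (dual_of G v)"
      and sG: "\<And>l. l \<ge> 1 \<Longrightarrow> solves_G G k0 k (dual_of G sf) l (\<nu>l l)" by (auto simp: \<nu>v)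
    define cm where "cm = Cmain (rad G ` {..<nsph G}) k0 (k ` {..<nsph G}) (sep_dist G)"
    define T where "T = tnorm G (single_layer G (dual_of G sf))"
    define X where "X l = tnorm_dual G (dual_diff \<nu> (dual_of G (\<nu>l l)))" for l
    define Y where "Y l = \<bar>energy G (dual_of G sf) \<nu> - energy G (dual_of G sf) (dual_of G (\<nu>l l))\<bar>" for l
    define Z where "Z s = Hs_norm G s (Q0_perp G v) + 8 * pi / k0 * Hs_norm G s (Q0_perp G sf)" for s
    have k0: "k0 > 0" using diel by (simp add: admissible_dielectric_def)
    have T: "T \<ge> 0" by (simp add: T_def tnorm_def)
    have cm: "cm > 0" and est: "\<And>s l. s > 0 \<Longrightarrow> l \<ge> 1 \<Longrightarrow>
      X l \<le> cm * (R / real (l + 1)) powr (s + 1/2) * Z s \<and>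
      Y l \<le> cm * (R / real (l + 1)) powr (s + 1/2) * T * Z s"
      using main[unfolded main_constant_def, rule_format, OF conjI[OF geometry diel]] sP sG vHs sfHs
      by (auto simp: Let_def cm_def X_def Y_def Z_def T_def R_def \<nu>v)
    have Zs: "Z s \<le> (1 + 8 * pi / k0) * (D * (1 + (b * s) powr s))" if s: "s > 0" for s
    proof -
      have "Hs_norm G s (Q0_perp G v) \<le> D * (1 + (b * s) powr s)"
        using n1[OF s] mono[OF s D(2) D1(2) b(2)] by linarith
      moreover have "Hs_norm G s (Q0_perp G sf) \<le> D * (1 + (b * s) powr s)"
        using n2[OF s] mono[OF s D(3) D2(2) b(3)] by linarith
      then have "8 * pi / k0 * Hs_norm G s (Q0_perp G sf) \<le> 8 * pi / k0 * (D * (1 + (b * s) powr s))"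
        using k0 by (intro mult_left_mono) auto
      ultimately show ?thesis by (simp only: Z_def distrib_right mult_1_left)
    qed
    define M where "M = (1 + 8 * pi / k0) * (2 * D)"
    \<comment> \<open>Both claims have this shape: \<open>t\<close> is 1 for the error in the dual
      norm and \<open>T\<close> for the energy.\<close>
    have final: "1 / sqrt (real (nsph G)) * x \<le> sqrt (8 * pi * Max ((\<lambda>j. (rad G j)\<^sup>2) ` {..<nsph G})) *
        (2 * R) powr (1/4) * C * cm * t * exp (- (1 / (4 * C)) * (real (l + 1) / R) + 1/2)"
      if x: "\<And>s. s > 0 \<Longrightarrow> x \<le> cm * (R / real (l + 1)) powr (s + 1/2) * t * Z s" and t: "t \<ge> 0"
        and l: "R * exp 1 \<le> real (l + 1)"
        and e: "M * exp (- (\<theta> * real (l + 1))) \<le> P * exp (- (\<theta> / 2 * real (l + 1)))" for x t l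
    proof -
      define s where "s = \<theta> * real (l + 1)"
      have s: "s > 0" using \<theta> by (simp add: s_def)
      define p where "p = (R / real (l + 1)) powr (s + 1/2)"
      have "x \<le> cm * p * t * Z s" using x[OF s] by (simp add: p_def)
      also have "\<dots> \<le> cm * p * t * ((1 + 8 * pi / k0) * (D * (1 + (b * s) powr s)))"
        using cm t by (intro mult_left_mono Zs s) (auto simp: p_def)
      also have "\<dots> = cm * t * (1 + 8 * pi / k0) * (p * (D * (1 + (b * s) powr s)))" by (simp only: mult_ac)
      also have "\<dots> \<le> cm * t * (1 + 8 * pi / k0) * (2 * D * exp (- (\<theta> * real (l + 1))))"
        unfolding p_def using cm t k0
        by (intro mult_left_mono Hs_decay_bound[OF R D(1) b(1) \<theta>_def s_def l]) (auto intro!: mult_nonneg_nonneg add_nonneg_nonneg)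
      also have "\<dots> = cm * t * (M * exp (- (\<theta> * real (l + 1))))" by (simp only: M_def mult_ac)
      also have "\<dots> \<le> cm * t * (P * exp (- (\<theta> / 2 * real (l + 1))))"
        using cm t by (intro mult_left_mono e) auto
      finally have xb: "x \<le> cm * t * (P * exp (- (\<theta> / 2 * real (l + 1))))" (is "_ \<le> ?B") .
      have B0: "?B \<ge> 0" using cm t P by simp
      have "1 / sqrt (real (nsph G)) * x \<le> 1 / sqrt (real (nsph G)) * ?B"
        using xb by (intro mult_left_mono) auto
      also have "\<dots> \<le> 1 * ?B" using N by (intro mult_right_mono B0) auto
      also have "\<dots> = sqrt (8 * pi * Max ((\<lambda>j. (rad G j)\<^sup>2) ` {..<nsph G})) * (2 * R) powr (1/4) * C * cm * t *
        (exp (1/2) * exp (- (\<theta> / 2 * real (l + 1))))" by (simp only: P_def mult_ac mult_1_left)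
      finally show ?thesis by (simp only: expC)
    qed
    have "\<forall>\<^sub>F l in sequentially. real l \<ge> R * exp 1"
      using filterlim_real_sequentially unfolding filterlim_at_top by blast
    with exp_absorb_constant[OF \<theta> P, of M] eventually_ge_at_top[of 1]
    have "\<forall>\<^sub>F l in sequentially.
        1 / sqrt (real (nsph G)) * X l \<le> sqrt (8 * pi * Max ((\<lambda>j. (rad G j)\<^sup>2) ` {..<nsph G})) * (2 * R) powr (1/4) *
            C * cm * exp (- (1 / (4 * C)) * (real (l + 1) / R) + 1/2) \<and>
        1 / sqrt (real (nsph G)) * Y l \<le> sqrt (8 * pi * Max ((\<lambda>j. (rad G j)\<^sup>2) ` {..<nsph G})) * (2 * R) powr (1/4) *
            C * cm * T * exp (- (1 / (4 * C)) * (real (l + 1) / R) + 1/2)"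
    proof eventually_elim
      case (elim l)
      have l: "R * exp 1 \<le> real (l + 1)" using elim(3) by simp
      have X: "X l \<le> cm * (R / real (l + 1)) powr (s + 1/2) * 1 * Z s"
        and Y: "Y l \<le> cm * (R / real (l + 1)) powr (s + 1/2) * T * Z s" if "s > 0" for s
        using est[OF that elim(2)] by (simp_all only: mult_1_right)
      show ?case
        using final[OF X _ l elim(1)] final[OF Y T l elim(1)] by (simp only: mult_1_right)
    qed
    then show "let cm = Cmain (rad G ` {..<nsph G}) k0 (k ` {..<nsph G}) (sep_dist G) in
      \<forall>\<^sub>F l in sequentially.
        1 / sqrt (real (nsph G)) * tnorm_dual G (dual_diff \<nu> (dual_of G (\<nu>l l)))
          \<le> sqrt (8 * pi * Max ((\<lambda>j. (rad G j)\<^sup>2) ` {..<nsph G})) * (2 * max_rad G) powr (1/4) *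
            C * cm * exp (- (1 / (4 * C)) * (real (l + 1) / max_rad G) + 1/2) \<and>
        1 / sqrt (real (nsph G)) *
            \<bar>energy G (dual_of G sf) \<nu> - energy G (dual_of G sf) (dual_of G (\<nu>l l))\<bar>
          \<le> sqrt (8 * pi * Max ((\<lambda>j. (rad G j)\<^sup>2) ` {..<nsph G})) * (2 * max_rad G) powr (1/4) *
            C * cm * tnorm G (single_layer G (dual_of G sf)) *
            exp (- (1 / (4 * C)) * (real (l + 1) / max_rad G) + 1/2)"
      unfolding Let_def cm_def X_def Y_def T_def R_def .
  qed
qed

end
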